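(* Let $P(z)=a_0(z-\alpha_1)(z-\alpha_2)\cdots(z-\alpha_n)$ be a complex polynomial of degree $n$ (so $a_0\ne 0$) with $\alpha_i\neq\alpha_j$ for $i\ne j$, and write $$P'(z)=b_0(z-\beta_1)^{q_1}(z-\beta_2)^{q_2}\cdots(z-\beta_k)^{q_k},$$ where $\beta_1,\ldots,\beta_k$ are the distinct zeros of $P'$, with multiplicities $q_1,\ldots,q_k$. Suppose that $P$ is a uniqueness polynomial and that $P(\beta_s)\neq P(\beta_t)$ for all $1\le s<t\le k$. Let $S_1=\{\alpha_1,\alpha_2,\ldots,\alpha_n\}$ and $S_2=\{\beta_1,\beta_2,\ldots,\beta_k\}$. If two non-constant meromorphic (resp. entire) functions $f$ and $g$ share the set $S_1$ with weight two and the set $S_2$ IM, and if $k\ge 3$ and $n\ge k+7$ (resp. $n\ge k+3$), then $f\equiv g$.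
   Context: Meromorphic (resp. entire) functions are meromorphic (resp. holomorphic) in the whole complex plane $\mathbb{C}$. A non-constant polynomial $P$ is called a uniqueness polynomial if, for any two non-constant meromorphic functions $f,g$ and any non-zero constant $c$, $P(f)\equiv cP(g)$ implies $f\equiv g$. For $l$ a non-negative integer or $\infty$, $E_l(a;f)$ is the multiset of all $a$-points of $f$, where an $a$-point of multiplicity $m$ is counted $m$ times if $m\le l$ and $l+1$ times if $m>l$. For a set $S$, $E_f(S,l)=\bigcup_{a\in S}E_l(a;f)$ (as multisets). The functions $f$ and $g$ share $S$ with weight $l$ if $E_f(S,l)=E_g(S,l)$. $f$ and $g$ share $S$ IM if $\overline{E}_f(S)=\overline{E}_g(S)$, where $\overline{E}_f(S)=\{z: f(z)\in S\}$ (multiplicities ignored). The statement with "resp." is two statements: one for meromorphic functions with $n\ge k+7$, and one for entire functions with $n\ge k+3$. *)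

theory Defs
  imports
    "HOL-Complex_Analysis.Complex_Analysis"
    "HOL-Computational_Algebra.Polynomial"
    "HOL-Library.Extended_Nat"
begin

text \<open>
  A meromorphic function on the complex plane is represented by its normalised representative:
  \<^term>\<open>f nicely_meromorphic_on UNIV\<close> says that removable singularities are filled in and that
  \<^term>\<open>f\<close> takes the dummy value \<^term>\<open>0::complex\<close> at its poles. Two meromorphic functions are then
  identically equal iff their representatives are equal as HOL functions. Because of the dummy
  value, poles have to be excluded explicitly whenever points with a prescribed value are collected.
\<close>

definition meromorphic_fun :: "(complex \<Rightarrow> complex) \<Rightarrow> bool" where
  "meromorphic_fun f \<longleftrightarrow> f nicely_meromorphic_on UNIV"

definition entire_fun :: "(complex \<Rightarrow> complex) \<Rightarrow> bool" where
  "entire_fun f \<longleftrightarrow> f holomorphic_on UNIV"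

definition nonconstant_fun :: "(complex \<Rightarrow> complex) \<Rightarrow> bool" where
  "nonconstant_fun f \<longleftrightarrow> \<not> f constant_on UNIV"

text \<open>
  The identity of the meromorphic functions \<open>P(f)\<close> and \<open>c P(g)\<close> is equality outside a set without
  limit points; pointwise equality everywhere would also compare the dummy values at poles.
\<close>

definition uniqueness_polynomial :: "complex poly \<Rightarrow> bool" where
  "uniqueness_polynomial P \<longleftrightarrow> degree P > 0 \<and>
     (\<forall>f g c. meromorphic_fun f \<and> nonconstant_fun f \<and> meromorphic_fun g \<and> nonconstant_fun g \<and>
        c \<noteq> 0 \<and> (\<forall>\<^sub>\<approx>z. poly P (f z) = c * poly P (g z)) \<longrightarrow> f = g)"

definition points_of :: "complex \<Rightarrow> (complex \<Rightarrow> complex) \<Rightarrow> complex set" where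
  "points_of a f = {z. \<not> is_pole f z \<and> f z = a}"

text \<open>
  Since the multisets of \<open>a\<close>-points are infinite in general, they are represented by their
  multiplicity functions \<^typ>\<open>complex \<Rightarrow> enat\<close>. For non-constant \<^term>\<open>f\<close> the order below is a
  positive integer. The weight \<open>l\<close> may be \<open>\<infinity>\<close>.
\<close>

definition E_pt :: "enat \<Rightarrow> complex \<Rightarrow> (complex \<Rightarrow> complex) \<Rightarrow> complex \<Rightarrow> enat" where
  "E_pt l a f z =
     (if z \<in> points_of a f then
        (let m = enat (nat (zorder (\<lambda>w. f w - a) z)) in if m \<le> l then m else l + 1)
      else 0)"

text \<open>
  For distinct \<open>a\<close> the multisets of \<open>a\<close>-points have disjoint supports, so the pointwise supremum
  is at the same time their union and their sum.
\<close>

definition E_set :: "(complex \<Rightarrow> complex) \<Rightarrow> complex set \<Rightarrow> enat \<Rightarrow> complex \<Rightarrow> enat" where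
  "E_set f S l z = (SUP a\<in>S. E_pt l a f z)"

definition share_weight ::
    "(complex \<Rightarrow> complex) \<Rightarrow> (complex \<Rightarrow> complex) \<Rightarrow> complex set \<Rightarrow> enat \<Rightarrow> bool" where
  "share_weight f g S l \<longleftrightarrow> E_set f S l = E_set g S l"

definition E_bar :: "(complex \<Rightarrow> complex) \<Rightarrow> complex set \<Rightarrow> complex set" where
  "E_bar f S = {z. \<not> is_pole f z \<and> f z \<in> S}"

definition share_IM ::
    "(complex \<Rightarrow> complex) \<Rightarrow> (complex \<Rightarrow> complex) \<Rightarrow> complex set \<Rightarrow> bool" where
  "share_IM f g S \<longleftrightarrow> E_bar f S = E_bar g S"

end

theory Submission
  imports Defs "HOL-Computational_Algebra.Fundamental_Theorem_Algebra"
begin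

text \<open>
  Write \<open>f = f1 / f0\<close> and \<open>g = g1 / g0\<close> with entire functions without common zeros, and let \<open>T(r)\<close>
  be the sum of the means of \<open>ln (max \<bar>f0\<bar> \<bar>f1\<bar>)\<close> and \<open>ln (max \<bar>g0\<bar> \<bar>g1\<bar>)\<close> over the circle of
  radius \<open>r\<close>. For \<open>F = 1 / P(f)\<close> and \<open>G = 1 / P(g)\<close> let \<open>H\<close> be the logarithmic derivative of
  \<open>F' / G'\<close>. If \<open>H\<close> does not vanish identically, the sharing hypotheses make
  \<open>Y = H\<^sup>2 W\<^sub>f\<^sup>2 W\<^sub>g\<^sup>2 (f0 g0)\<^sup>2 Q(f) Q(g) / (P(f) P(g))\<close> an entire function, where \<open>W\<close> denotes the
  Wronskians and \<open>P(f)\<close>, \<open>Q(f) = \<Prod>(f - \<beta>)\<close> are taken in homogeneous form. The circle means of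
  \<open>ln \<bar>Y\<bar>\<close> are bounded below; on the other hand the second main theorem and the logarithmic
  derivative estimate bound them above by \<open>- \<kappa> T(r) + O(ln T(r))\<close> with \<open>\<kappa> = n - k - 6\<close>, or
  \<open>\<kappa> = n - k - 2\<close> in the entire case. No counting functions are needed, because logarithmic
  derivatives can be estimated pointwise on circles that stay away from all zeros.

  If \<open>H\<close> vanishes identically, then \<open>1 / P(f) = c / P(g) + c'\<close>. For \<open>c' = 0\<close> the uniqueness
  polynomial property applies. For \<open>c' \<noteq> 0\<close> the polynomial \<open>P + c / c'\<close> has at least three distinct
  roots; \<open>g\<close> takes the simple ones with multiplicity at least \<open>n\<close> and omits the multiple one, as
  that is some \<open>\<beta>\<close> and \<open>f\<close> would have a pole there. This contradicts the second main theorem.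
\<close>

text \<open>\<open>H\<close> has at most simple poles, and the other factors of \<open>Y\<close> pay
  for the poles of \<open>H\<^sup>2\<close> and for the zeros of \<open>P(f) P(g)\<close>. At a
  common simple alpha-point \<open>H\<close> vanishes, so \<open>H\<^sup>2\<close> itself cancels
  both zeros. At a common alpha-point of orders m, m' \<ge> 2 the factor
  \<open>W\<^sub>f\<^sup>2 W\<^sub>g\<^sup>2\<close> has order 2(m - 1) + 2(m' - 1), a surplus of m
  + m' - 4 over \<open>P(f) P(g)\<close>. If m = m', then \<open>H\<close> has no pole there. If m
  and m' differ, sharing with weight two forces both to be at least 3, and the surplus covers the
  double pole of \<open>H\<^sup>2\<close>. At a beta-point IM sharing makes both \<open>Q(f)\<close>
  and \<open>Q(g)\<close> vanish, one order each; at a pole of f or g the factor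
  \<open>(f0 g0)\<^sup>2\<close> suffices; any other zero of F' or G' is a zero of a Wronskian.
  Homogeneous pairs make the poles ordinary points, so that dummy values never enter an estimate and
  Jensen's formula is only applied to entire functions.\<close>

abbreviation entire :: "(complex \<Rightarrow> complex) \<Rightarrow> bool" where
  "entire f \<equiv> f holomorphic_on UNIV"

section \<open>Circle means\<close>

definition cmean :: "complex \<Rightarrow> real \<Rightarrow> (complex \<Rightarrow> 'a::euclidean_space) \<Rightarrow> 'a" where
  "cmean c r \<phi> = integral {0..1} (\<lambda>t. \<phi> (circlepath c r t))"

lemma circlepath_in_sphere: "0 \<le> r \<Longrightarrow> circlepath c r t \<in> sphere c r"
  by (simp add: circlepath dist_norm norm_mult)

lemma continuous_on_circlepath: "continuous_on A (circlepath c r)"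
  unfolding circlepath by (intro continuous_intros)

lemma cmean_shift: "cmean c r \<phi> = cmean 0 r (\<lambda>w. \<phi> (c + w))"
  by (simp add: cmean_def circlepath)

lemma cmean_integrable:
  fixes \<phi> :: "complex \<Rightarrow> 'a::euclidean_space"
  assumes "0 \<le> r" "continuous_on (sphere c r) \<phi>"
  shows "(\<lambda>t. \<phi> (circlepath c r t)) integrable_on {0..1}"
proof (rule integrable_continuous_interval)
  show "continuous_on {0..1} (\<lambda>t. \<phi> (circlepath c r t))"
    by (rule continuous_on_compose2[OF assms(2) continuous_on_circlepath])
       (use circlepath_in_sphere[OF assms(1)] in auto)
qed

lemma cmean_cong:
  assumes "0 \<le> r" "\<And>w. w \<in> sphere c r \<Longrightarrow> \<phi> w = \<psi> w"
  shows "cmean c r \<phi> = cmean c r \<psi>"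
  unfolding cmean_def using assms(2) circlepath_in_sphere[OF assms(1)]
  by (intro integral_cong) auto

lemma cmean_const [simp]: "cmean c r (\<lambda>_. k) = k"
  by (simp add: cmean_def)

lemma cmean_add:
  assumes "0 \<le> r" "continuous_on (sphere c r) \<phi>" "continuous_on (sphere c r) \<psi>"
  shows "cmean c r (\<lambda>w. \<phi> w + \<psi> w) = cmean c r \<phi> + cmean c r \<psi>"
  unfolding cmean_def using assms by (intro integral_add cmean_integrable) auto

lemma cmean_diff:
  assumes "0 \<le> r" "continuous_on (sphere c r) \<phi>" "continuous_on (sphere c r) \<psi>"
  shows "cmean c r (\<lambda>w. \<phi> w - \<psi> w) = cmean c r \<phi> - cmean c r \<psi>"
  unfolding cmean_def using assms by (intro integral_diff cmean_integrable) auto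

lemma cmean_cmult:
  fixes \<phi> :: "complex \<Rightarrow> real"
  shows "cmean c r (\<lambda>w. k * \<phi> w) = k * cmean c r \<phi>"
  unfolding cmean_def by simp

lemma cmean_mono:
  fixes \<phi> \<psi> :: "complex \<Rightarrow> real"
  assumes "0 \<le> r" "continuous_on (sphere c r) \<phi>" "continuous_on (sphere c r) \<psi>"
    and "\<And>w. w \<in> sphere c r \<Longrightarrow> \<phi> w \<le> \<psi> w"
  shows "cmean c r \<phi> \<le> cmean c r \<psi>"
  unfolding cmean_def using assms circlepath_in_sphere[OF assms(1)]
  by (intro integral_le cmean_integrable) auto

lemma norm_cmean_le:
  assumes "0 \<le> r" "continuous_on (sphere c r) \<phi>"
  shows "norm (cmean c r \<phi>) \<le> cmean c r (\<lambda>w. norm (\<phi> w))"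
  unfolding cmean_def
  by (rule integral_norm_bound_integral)
     (use cmean_integrable[OF assms] cmean_integrable[of r c "\<lambda>w. norm (\<phi> w)"] assms
       in \<open>auto intro: continuous_intros\<close>)

lemma cmean_cnj: "cmean c r (\<lambda>w. cnj (\<phi> w)) = cnj (cmean c r \<phi>)"
  unfolding cmean_def by (rule integral_cnj[symmetric])

lemma cmean_Re:
  assumes "0 \<le> r" "continuous_on (sphere c r) \<phi>"
  shows "cmean c r (\<lambda>w. Re (\<phi> w)) = Re (cmean c r \<phi>)"
  unfolding cmean_def
  by (rule integral_linear[OF cmean_integrable[OF assms] bounded_linear_Re, unfolded o_def])

text \<open>On the circle dw = 2 pi i (w - c) dt, so the factor \<open>w - c\<close> turns a contour
  integral into a mean.\<close>

lemma cmean_contour: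
  assumes "(\<psi> has_contour_integral I) (circlepath c r)"
  shows "cmean c r (\<lambda>w. (w - c) * \<psi> w) = I / (2 * pi * \<i>)"
proof -
  have "((\<lambda>x. \<psi> (circlepath c r x) * (2 * pi * \<i> * r * exp (2 * of_real pi * \<i> * x)))
          has_integral I) {0..1}"
    using assms unfolding has_contour_integral_def
    by (rule has_integral_eq[rotated]) (simp add: vector_derivative_circlepath01)
  then have "((\<lambda>x. (1 / (2 * pi * \<i>)) * (\<psi> (circlepath c r x) *
        (2 * pi * \<i> * r * exp (2 * of_real pi * \<i> * x)))) has_integral (1 / (2 * pi * \<i>)) * I) {0..1}"
    by (rule has_integral_mult_right)
  then have "((\<lambda>x. (circlepath c r x - c) * \<psi> (circlepath c r x)) has_integral I / (2 * pi * \<i>)) {0..1}"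
    by (simp add: circlepath field_simps)
  then show ?thesis unfolding cmean_def by (rule integral_unique)
qed

lemma cmean_holomorphic:
  assumes "0 < r" "\<phi> holomorphic_on cball c r"
  shows "cmean c r \<phi> = \<phi> c"
proof -
  have "((\<lambda>u. \<phi> u / (u - c)) has_contour_integral 2 * of_real pi * \<i> * \<phi> c) (circlepath c r)"
    using assms by (intro Cauchy_integral_circlepath_simple) auto
  then have "cmean c r (\<lambda>w. (w - c) * (\<phi> w / (w - c))) = 2 * of_real pi * \<i> * \<phi> c / (2 * pi * \<i>)"
    by (rule cmean_contour)
  moreover have "cmean c r (\<lambda>w. (w - c) * (\<phi> w / (w - c))) = cmean c r \<phi>"
    using assms(1) by (intro cmean_cong) auto
  ultimately show ?thesis by simp
qed

text \<open>Cauchy's formula writes the derivative as a mean of \<open>u\<close> against a kernel,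
  and the conjugate of \<open>u\<close> has mean zero against the same kernel. Adding the two leaves
  only the real part of \<open>u\<close>, which later is the logarithm of a modulus.\<close>

lemma deriv_le_cmean_abs_Re:
  assumes u: "u holomorphic_on cball 0 R" and z: "norm z < R"
  shows "norm (deriv u z) \<le> 2 * R / (R - norm z)^2 * cmean 0 R (\<lambda>w. \<bar>Re (u w)\<bar>)"
proof -
  have R: "R > 0" using z norm_ge_zero[of z] by linarith
  have sph: "w \<noteq> z \<and> w \<noteq> 0" if "w \<in> sphere 0 R" for w using that z R by auto
  have cu: "continuous_on (sphere 0 R) u"
    using holomorphic_on_imp_continuous_on[OF u] continuous_on_subset sphere_cball by blast
  have 1: "((\<lambda>w. u w / (w - z) ^ (Suc 1)) has_contour_integral ((2 * pi * \<i>) / (fact 1) * (deriv ^^ 1) u z))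
           (circlepath 0 R)"
    by (rule Cauchy_has_contour_integral_higher_derivative_circlepath)
       (use u z in \<open>auto intro: holomorphic_on_imp_continuous_on holomorphic_on_subset[OF u]\<close>)
  have A: "cmean 0 R (\<lambda>w. w * (u w / (w - z)^2)) = deriv u z"
    using cmean_contour[OF 1] by (simp add: numeral_2_eq_2)
  \<comment> \<open>On the circle R^2 = w \<open>cnj w\<close>, so the conjugate of
    \<open>\<psi>\<close> is the conjugate of \<open>u\<close> times the kernel. Inside,
    \<open>\<psi>\<close> is holomorphic with \<open>\<psi> 0 = 0\<close>, so its mean is
    zero.\<close>
  define \<psi> where "\<psi> w = of_real (R^2) * w * u w / (of_real (R^2) - cnj z * w)^2" for w
  have nz: "of_real (R^2) - cnj z * w \<noteq> 0" if "w \<in> cball 0 R" for w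
  proof
    assume "of_real (R^2) - cnj z * w = 0"
    then have "norm (complex_of_real (R^2)) = norm (cnj z * w)" by simp
    then have "R^2 = norm z * norm w" by (simp add: norm_mult norm_power)
    also have "\<dots> \<le> norm z * R" using that by (intro mult_left_mono) auto
    also have "\<dots> < R * R" using z R by simp
    finally show False by (simp add: power2_eq_square)
  qed
  have "\<psi> holomorphic_on cball 0 R"
    unfolding \<psi>_def using nz by (intro holomorphic_intros u) auto
  then have "cmean 0 R \<psi> = 0" using R by (subst cmean_holomorphic) (auto simp: \<psi>_def)
  then have "cmean 0 R (\<lambda>w. cnj (\<psi> w)) = 0" by (simp add: cmean_cnj)
  moreover have conj: "cnj (\<psi> w) = w * (cnj (u w) / (w - z)^2)" if w: "w \<in> sphere 0 R" for w
  proof -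
    have e: "complex_of_real (R^2) = w * cnj w" using w by (simp add: complex_norm_square[symmetric])
    have "of_real (R^2) - z * cnj w = cnj w * (w - z)"
      unfolding e by (simp add: algebra_simps)
    then have "cnj (\<psi> w) = (w * cnj w) * cnj w * cnj (u w) / (cnj w * (w - z))^2"
      unfolding \<psi>_def e[symmetric] by (simp only: complex_cnj_divide complex_cnj_mult complex_cnj_power complex_cnj_diff complex_cnj_complex_of_real complex_cnj_cnj)
    moreover have "(w * cnj w) * cnj w * cnj (u w) / (cnj w * (w - z))^2 = w * (cnj (u w) / (w - z)^2)"
      using sph[OF w] by (simp add: power_mult_distrib power2_eq_square)
    ultimately show ?thesis by simp
  qed
  ultimately have B: "cmean 0 R (\<lambda>w. w * (cnj (u w) / (w - z)^2)) = 0"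
    using cmean_cong[of R 0 "\<lambda>w. cnj (\<psi> w)" "\<lambda>w. w * (cnj (u w) / (w - z)^2)", OF _ conj] R by simp
  have "deriv u z = cmean 0 R (\<lambda>w. w * (u w / (w - z)^2)) + cmean 0 R (\<lambda>w. w * (cnj (u w) / (w - z)^2))"
    using A B by simp
  also have "\<dots> = cmean 0 R (\<lambda>w. w * (u w / (w - z)^2) + w * (cnj (u w) / (w - z)^2))"
    by (rule cmean_add[symmetric]) (use R sph in \<open>auto intro!: continuous_intros cu\<close>)
  finally have eq: "deriv u z = cmean 0 R (\<lambda>w. w * (u w / (w - z)^2) + w * (cnj (u w) / (w - z)^2))" .
  have cont: "continuous_on (sphere 0 R) (\<lambda>w. w * (u w / (w - z)^2) + w * (cnj (u w) / (w - z)^2))"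
    using sph by (auto intro!: continuous_intros cu)
  have "norm (deriv u z) \<le> cmean 0 R (\<lambda>w. norm (w * (u w / (w - z)^2) + w * (cnj (u w) / (w - z)^2)))"
    unfolding eq using norm_cmean_le[OF _ cont] R by simp
  also have "\<dots> \<le> cmean 0 R (\<lambda>w. 2 * R / (R - norm z)^2 * \<bar>Re (u w)\<bar>)"
  proof (rule cmean_mono)
    fix w :: complex assume w: "w \<in> sphere 0 R"
    have "w * (u w / (w - z)^2) + w * (cnj (u w) / (w - z)^2) = of_real (2 * Re (u w)) * (w / (w - z)^2)"
      unfolding complex_add_cnj[symmetric] by (simp add: add_divide_distrib ring_distribs mult_ac)
    then have "norm (w * (u w / (w - z)^2) + w * (cnj (u w) / (w - z)^2)) = 2 * \<bar>Re (u w)\<bar> * (R / norm (w - z)^2)"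
      using w by (simp add: norm_mult norm_divide norm_power)
    also have "\<dots> \<le> 2 * \<bar>Re (u w)\<bar> * (R / (R - norm z)^2)"
    proof -
      have "R - norm z \<le> norm (w - z)" using w norm_triangle_ineq2[of w z] by simp
      then have "(R - norm z)^2 \<le> norm (w - z)^2" using z by (intro power_mono) auto
      moreover have "0 < (R - norm z)^2" using z by simp
      ultimately show ?thesis using R by (intro mult_left_mono frac_le) auto
    qed
    finally show "norm (w * (u w / (w - z)^2) + w * (cnj (u w) / (w - z)^2)) \<le> 2 * R / (R - norm z)^2 * \<bar>Re (u w)\<bar>"
      by (simp add: mult_ac)
  qed (use R sph z in \<open>auto intro!: continuous_intros cu\<close>)
  finally show ?thesis unfolding cmean_cmult .
qed

section \<open>Jensen's formula and logarithmic derivatives\<close>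

lemma entire_zero_factor:
  assumes E: "entire E" and nz: "E w0 \<noteq> 0"
  obtains m \<phi> where "entire \<phi>" "\<phi> z \<noteq> 0" "\<And>w. E w = (w - z) ^ m * \<phi> w"
proof (cases "E z = 0")
  case False
  then show ?thesis using that[of E 0] E by auto
next
  case True
  have nc: "\<not> E constant_on UNIV" using True nz unfolding constant_on_def by (metis UNIV_I)
  obtain g r n where g: "0 < n" "0 < r" "g holomorphic_on ball z r"
      "\<And>w. w \<in> ball z r \<Longrightarrow> E w = (w - z) ^ n * g w" "\<And>w. w \<in> ball z r \<Longrightarrow> g w \<noteq> 0"
    using holomorphic_factor_zero_nonconstant[OF E open_UNIV connected_UNIV _ True nc] by (metis UNIV_I)
  define \<phi> where "\<phi> w = (if w \<in> ball z r then g w else E w / (w - z) ^ n)" for w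
  have \<phi>2: "\<phi> w = E w / (w - z) ^ n" if "w \<noteq> z" for w
    using that g(4)[of w] by (auto simp: \<phi>_def)
  have "\<phi> holomorphic_on ball z r"
    using g(3) by (rule holomorphic_transform) (simp add: \<phi>_def)
  moreover have "\<phi> holomorphic_on (- {z})"
  proof (rule holomorphic_transform)
    show "(\<lambda>w. E w / (w - z) ^ n) holomorphic_on (- {z})"
      by (intro holomorphic_intros holomorphic_on_subset[OF E]) auto
  qed (use \<phi>2 in auto)
  ultimately have "\<phi> holomorphic_on (ball z r \<union> - {z})"
    by (intro holomorphic_on_Un) auto
  moreover have "ball z r \<union> - {z} = UNIV" using g(2) by auto
  ultimately have "entire \<phi>" by simp
  moreover have "\<phi> z \<noteq> 0" using g by (simp add: \<phi>_def)
  moreover have "E w = (w - z) ^ n * \<phi> w" for w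
    using g(4)[of w] \<phi>2[of w] by (cases "w = z") (auto simp: \<phi>_def g(2))
  ultimately show ?thesis using that by blast
qed

lemma entire_finite_zeros:
  assumes E: "entire E" and nz: "E w0 \<noteq> 0" and K: "compact K"
  shows "finite {w \<in> K. E w = 0}"
proof (cases "E constant_on UNIV")
  case True
  then show ?thesis using nz by (auto simp: constant_on_def)
next
  case False
  show ?thesis by (rule holomorphic_compact_finite_zeros[OF E _ _ K _ False]) auto
qed

text \<open>Splitting off one zero with its full power lowers the number of distinct zeros in the
  disc. The zeros form a list so that multiplicities are kept.\<close>

lemma entire_finite_zero_factorization:
  assumes "entire E" "E w0 \<noteq> 0"
  shows "\<exists>xs G. entire G \<and> (\<forall>a\<in>set xs. E a = 0 \<and> norm a \<le> R) \<and>
           (\<forall>w\<in>cball 0 R. G w \<noteq> 0) \<and> (\<forall>w. E w = (\<Prod>a\<leftarrow>xs. (w - a)) * G w)"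
  using assms
proof (induction "card {w \<in> cball 0 R. E w = 0}" arbitrary: E rule: less_induct)
  case less
  have fin: "finite {w \<in> cball 0 R. E w = 0}"
    by (rule entire_finite_zeros[OF less.prems]) auto
  show ?case
  proof (cases "{w \<in> cball 0 R. E w = 0} = {}")
    case True
    then show ?thesis using less.prems by (intro exI[of _ "[]"] exI[of _ E]) auto
  next
    case False
    then obtain z where z: "z \<in> cball 0 R" "E z = 0" by blast
    obtain m \<phi> where \<phi>: "entire \<phi>" "\<phi> z \<noteq> 0" "\<And>w. E w = (w - z) ^ m * \<phi> w"
      using entire_zero_factor[OF less.prems] by blast
    have "{w \<in> cball 0 R. \<phi> w = 0} \<subset> {w \<in> cball 0 R. E w = 0}"
      using z \<phi> by auto
    then have "card {w \<in> cball 0 R. \<phi> w = 0} < card {w \<in> cball 0 R. E w = 0}"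
      using fin by (rule psubset_card_mono[rotated])
    moreover have "\<phi> w0 \<noteq> 0" using less.prems(2) \<phi>(3)[of w0] by auto
    ultimately obtain xs G where G: "entire G" "\<forall>a\<in>set xs. \<phi> a = 0 \<and> norm a \<le> R"
        "\<forall>w\<in>cball 0 R. G w \<noteq> 0" "\<forall>w. \<phi> w = (\<Prod>a\<leftarrow>xs. (w - a)) * G w"
      using less.hyps[OF _ \<phi>(1)] by blast
    show ?thesis
    proof (intro exI conjI)
      show "\<forall>a\<in>set (replicate m z @ xs). E a = 0 \<and> norm a \<le> R"
        using z G(2) \<phi>(3) by auto
      show "\<forall>w. E w = (\<Prod>a\<leftarrow>replicate m z @ xs. w - a) * G w"
        using \<phi>(3) G(4) by (simp add: prod_list_replicate)
    qed (use G in auto)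
  qed
qed

text \<open>Each factor \<open>w - a\<close> is traded for a Blaschke factor, of modulus 1 on the
  circle. The compensating factors have no zero in the closed disc, so what remains is zero-free
  there and has a holomorphic logarithm.\<close>

lemma blaschke_form:
  assumes E: "entire E" and R: "0 < R" and E0: "E 0 \<noteq> 0"
    and sph: "\<And>w. norm w = R \<Longrightarrow> E w \<noteq> 0"
  shows "\<exists>u xs. u holomorphic_on cball 0 R \<and>
    (\<forall>a\<in>set xs. a \<noteq> 0 \<and> norm a < R \<and> E a = 0) \<and>
    (\<forall>w\<in>cball 0 R. E w = (\<Prod>a\<leftarrow>xs. of_real R * (w - a) / (of_real (R^2) - cnj a * w)) * exp (u w))"
proof -
  obtain xs G where G: "entire G" "\<forall>a\<in>set xs. E a = 0 \<and> norm a \<le> R"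
        "\<forall>w\<in>cball 0 R. G w \<noteq> 0" "\<And>w. E w = (\<Prod>a\<leftarrow>xs. (w - a)) * G w"
    using entire_finite_zero_factorization[OF E E0, of R] by blast
  have xs: "a \<noteq> 0 \<and> norm a < R \<and> E a = 0" if "a \<in> set xs" for a
    using G(2) E0 sph that by (metis order_le_less)
  have nz: "of_real (R^2) - cnj a * w \<noteq> 0" if "w \<in> cball 0 R" "a \<in> set xs" for a w
  proof
    assume "of_real (R^2) - cnj a * w = 0"
    then have "norm (complex_of_real (R^2)) = norm (cnj a * w)" by simp
    then have "R^2 = norm a * norm w" by (simp add: norm_mult norm_power)
    also have "\<dots> \<le> norm a * R" using that by (intro mult_left_mono) auto
    also have "\<dots> < R * R" using xs[OF that(2)] R by simp
    finally show False by (simp add: power2_eq_square)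
  qed
  define G' where "G' w = G w * (\<Prod>a\<leftarrow>xs. (of_real (R^2) - cnj a * w) / of_real R)" for w
  have hol: "(\<lambda>w. \<Prod>a\<leftarrow>ys. (of_real (R^2) - cnj a * w) / of_real R) holomorphic_on A" for ys A
    using R by (induction ys) (auto intro!: holomorphic_intros)
  have nzp: "(\<Prod>a\<leftarrow>ys. (of_real (R^2) - cnj a * w) / of_real R) \<noteq> 0"
    if "w \<in> cball 0 R" "set ys \<subseteq> set xs" for ys w
    using that(2) nz[OF that(1)] R by (induction ys) auto
  have "G' holomorphic_on cball 0 R"
    unfolding G'_def by (intro holomorphic_intros hol holomorphic_on_subset[OF G(1)]) auto
  moreover have "G' w \<noteq> 0" if "w \<in> cball 0 R" for w
    using G(3) nzp[OF that, of xs] that by (auto simp: G'_def)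
  ultimately obtain u where u: "u holomorphic_on cball 0 R" "\<And>w. w \<in> cball 0 R \<Longrightarrow> G' w = exp (u w)"
    using contractible_imp_holomorphic_log[of G' "cball 0 R"] convex_imp_contractible[of "cball (0::complex) R"] by auto
  have pr: "(\<Prod>a\<leftarrow>ys. of_real R * (w - a) / (of_real (R^2) - cnj a * w)) *
      (\<Prod>a\<leftarrow>ys. (of_real (R^2) - cnj a * w) / of_real R) = (\<Prod>a\<leftarrow>ys. (w - a))"
    if "w \<in> cball 0 R" "set ys \<subseteq> set xs" for ys w
    using that(2)
  proof (induction ys)
    case (Cons a ys)
    have "of_real R * (w - a) / (of_real (R^2) - cnj a * w) * ((of_real (R^2) - cnj a * w) / of_real R) = w - a"
      using nz[OF that(1), of a] Cons.prems R by simp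
    then have "(of_real R * (w - a) / (of_real (R^2) - cnj a * w) * ((of_real (R^2) - cnj a * w) / of_real R)) *
       ((\<Prod>a\<leftarrow>ys. of_real R * (w - a) / (of_real (R^2) - cnj a * w)) *
      (\<Prod>a\<leftarrow>ys. (of_real (R^2) - cnj a * w) / of_real R)) = (w - a) * (\<Prod>a\<leftarrow>ys. (w - a))"
      using Cons.IH Cons.prems by simp
    then show ?case unfolding list.map prod_list.Cons by (simp only: mult_ac)
  qed auto
  have "E w = (\<Prod>a\<leftarrow>xs. of_real R * (w - a) / (of_real (R^2) - cnj a * w)) * exp (u w)"
    if "w \<in> cball 0 R" for w
    using pr[OF that, of xs] u(2)[OF that, symmetric] G(4)[of w] by (simp add: G'_def mult_ac)
  then show ?thesis using u(1) xs by blast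
qed

text \<open>Derivatives are given as multiples \<open>b' a\<close> of the values, so that the
  logarithmic derivatives add up without any division.\<close>

lemma has_field_derivative_prod_list:
  fixes b :: "'b \<Rightarrow> 'a::real_normed_field \<Rightarrow> 'a"
  assumes "\<And>a. a \<in> set xs \<Longrightarrow> (b a has_field_derivative b' a * b a z) (at z)"
  shows "((\<lambda>w. \<Prod>a\<leftarrow>xs. b a w) has_field_derivative (\<Sum>a\<leftarrow>xs. b' a) * (\<Prod>a\<leftarrow>xs. b a z)) (at z)"
  using assms
proof (induction xs)
  case (Cons a xs)
  have "(b a has_field_derivative b' a * b a z) (at z)"
    "((\<lambda>w. \<Prod>a\<leftarrow>xs. b a w) has_field_derivative (\<Sum>a\<leftarrow>xs. b' a) * (\<Prod>a\<leftarrow>xs. b a z)) (at z)"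
    using Cons by auto
  from DERIV_mult[OF this] show ?case by (simp add: algebra_simps)
qed simp

lemma norm_sum_list_le: "norm (\<Sum>a\<leftarrow>xs. b a) \<le> (\<Sum>a\<leftarrow>xs. norm (b a :: 'a::real_normed_vector))"
  by (induction xs) (auto intro: order_trans[OF norm_triangle_ineq])

lemma one_minus_le_ln_divide:
  fixes s R :: real
  assumes "0 < s" "0 < R"
  shows "1 - s / R \<le> ln (R / s)"
proof -
  have "ln (s / R) \<le> s / R - 1" using assms by (intro ln_le_minus_one) auto
  then show ?thesis using assms by (simp add: ln_div)
qed

lemma norm_blaschke_denominator_ge:
  assumes "norm a < R" "norm z < R"
  shows "R * (R - norm z) \<le> norm (of_real (R^2) - cnj a * z)"
proof -
  have R: "0 < R" using assms norm_ge_zero[of a] by linarith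
  have "norm (cnj a * z) \<le> R * norm z" using assms by (simp add: norm_mult mult_right_mono)
  moreover have "norm (complex_of_real (R^2)) = R * R" using R by (simp add: norm_power power2_eq_square norm_mult)
  moreover have "norm (complex_of_real (R^2)) - norm (cnj a * z) \<le> norm (of_real (R^2) - cnj a * z)"
    by (rule norm_triangle_ineq2)
  ultimately show ?thesis by (simp add: algebra_simps)
qed

text \<open>The two fractions combine to a single one with numerator R^2 - |a|^2. The estimate R -
  |a| \<le> R ln (R / |a|) turns it into a multiple of the term that \<open>a\<close> contributes to
  Jensen's formula.\<close>

lemma norm_log_deriv_blaschke_le:
  assumes a: "a \<noteq> 0" "norm a < R" and z: "norm z < R" and d: "0 < d" "d \<le> norm (z - a)"
  shows "norm (1 / (z - a) + cnj a / (of_real (R^2) - cnj a * z)) \<le> 2 * R * ln (R / norm a) / (d * (R - norm z))"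
proof -
  have R: "0 < R" using assms norm_ge_zero[of a] by linarith
  have ge: "R * (R - norm z) \<le> norm (of_real (R^2) - cnj a * z)"
    by (rule norm_blaschke_denominator_ge[OF a(2) z])
  have pos: "0 < R * (R - norm z)" using R z by simp
  have nz: "of_real (R^2) - cnj a * z \<noteq> 0" using ge pos by auto
  have "z \<noteq> a" using d by auto
  have e: "1 / (z - a) + cnj a / (of_real (R^2) - cnj a * z) = (of_real (R^2) - cnj a * a) / ((z - a) * (of_real (R^2) - cnj a * z))"
    using nz \<open>z \<noteq> a\<close> by (simp add: add_frac_eq) (simp add: algebra_simps)
  have "cnj a * a = of_real ((norm a)^2)" by (metis complex_norm_square mult.commute of_real_power)
  then have "norm (of_real (R^2) - cnj a * a) = \<bar>R^2 - (norm a)^2\<bar>"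
    by (simp only: of_real_diff[symmetric] norm_of_real)
  also have "\<dots> = (R + norm a) * (R - norm a)"
  proof -
    have "(norm a)^2 \<le> R^2" using a R by (intro power_mono) auto
    then show ?thesis by (simp add: power2_eq_square algebra_simps)
  qed
  also have "\<dots> \<le> (2 * R) * (R * ln (R / norm a))"
  proof (rule mult_mono)
    have "1 - norm a / R \<le> ln (R / norm a)" using a R by (intro one_minus_le_ln_divide) auto
    then have "R * (1 - norm a / R) \<le> R * ln (R / norm a)" using R by (intro mult_left_mono) auto
    moreover have "R * (1 - norm a / R) = R - norm a" using R by (simp add: field_simps)
    ultimately show "R - norm a \<le> R * ln (R / norm a)" by simp
  qed (use a R in auto)
  finally have num: "norm (of_real (R^2) - cnj a * a) \<le> (2 * R) * (R * ln (R / norm a))" .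
  have ln0: "0 \<le> ln (R / norm a)" using a by simp
  have "norm (1 / (z - a) + cnj a / (of_real (R^2) - cnj a * z)) =
     norm (of_real (R^2) - cnj a * a) / (norm (z - a) * norm (of_real (R^2) - cnj a * z))"
    unfolding e by (simp only: norm_divide norm_mult)
  also have "\<dots> \<le> ((2 * R) * (R * ln (R / norm a))) / (d * (R * (R - norm z)))"
    using num ge d pos R ln0 z by (intro frac_le mult_mono mult_nonneg_nonneg) auto
  also have "\<dots> = (R * (2 * R * ln (R / norm a))) / (R * (d * (R - norm z)))"
    by (simp only: mult_ac)
  also have "\<dots> = 2 * R * ln (R / norm a) / (d * (R - norm z))"
    using R by (simp only: mult_divide_mult_cancel_left_if split: if_splits) simp
  finally show ?thesis .
qed

lemma sum_list_ge_sum_set: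
  assumes "\<And>x. x \<in> set xs \<Longrightarrow> 0 \<le> (f x :: real)"
  shows "sum f (set xs) \<le> (\<Sum>x\<leftarrow>xs. f x)"
  using assms
proof (induction xs)
  case (Cons a xs)
  then have "sum f (set xs) \<le> (\<Sum>x\<leftarrow>xs. f x)" "0 \<le> f a" by auto
  moreover have "sum f (set (a # xs)) \<le> f a + sum f (set xs)"
    using \<open>0 \<le> f a\<close> by (cases "a \<in> set xs") (auto simp: insert_absorb)
  ultimately show ?case by simp
qed simp

text \<open>
  Write \<open>E\<close> on the disc of radius \<open>R\<close> as a Blaschke product times \<open>exp u\<close>. Then \<open>N\<close> below is
  the sum of \<open>ln (R / \<bar>a\<bar>)\<close> over the zeros \<open>a\<close> (Jensen's formula), and it controls both the
  logarithmic derivative of the Blaschke product and the number of zeros in a smaller disc.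
\<close>

lemma entire_disc_estimates:
  assumes E: "entire E" and R: "0 < R" and E0: "E 0 \<noteq> 0"
    and sph: "\<And>w. norm w = R \<Longrightarrow> E w \<noteq> 0"
  defines "N \<equiv> cmean 0 R (\<lambda>w. ln (norm (E w))) - ln (norm (E 0))"
  obtains u where "u holomorphic_on cball 0 R"
    "\<And>w. norm w = R \<Longrightarrow> ln (norm (E w)) = Re (u w)"
    "0 \<le> N"
    "\<And>z d. \<lbrakk>norm z < R; 0 < d; \<And>a. E a = 0 \<Longrightarrow> d \<le> norm (z - a)\<rbrakk> \<Longrightarrow>
       norm (deriv E z / E z - deriv u z) \<le> 2 * R * N / (d * (R - norm z))"
    "\<And>s. \<lbrakk>0 < s; s < R\<rbrakk> \<Longrightarrow> real (card {a. E a = 0 \<and> norm a \<le> s}) * ln (R / s) \<le> N"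
    "\<And>a. \<lbrakk>E a = 0; norm a < R\<rbrakk> \<Longrightarrow> ln (R / norm a) \<le> N"
proof -
  from blaschke_form[OF E R E0 sph] obtain u xs where u: "u holomorphic_on cball 0 R"
    and xs': "\<forall>a\<in>set xs. a \<noteq> 0 \<and> norm a < R \<and> E a = 0"
    and Eu': "\<forall>w\<in>cball 0 R. E w = (\<Prod>a\<leftarrow>xs. of_real R * (w - a) / (of_real (R^2) - cnj a * w)) * exp (u w)"
    by iprover
  have xs: "a \<noteq> 0 \<and> norm a < R \<and> E a = 0" if "a \<in> set xs" for a using xs' that by blast
  define b where "b a w = of_real R * (w - a) / (of_real (R^2) - cnj a * w)" for a w
  have Eu: "E w = (\<Prod>a\<leftarrow>xs. b a w) * exp (u w)" if "norm w \<le> R" for w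
    using Eu' that by (simp add: b_def)
  have b1: "norm (b a w) = 1" if w: "norm w = R" and "norm a < R" for a w
  proof -
    have e: "complex_of_real (R^2) = w * cnj w" using w by (simp add: complex_norm_square[symmetric])
    have "of_real (R^2) - cnj a * w = w * cnj (w - a)" unfolding e by (simp add: algebra_simps)
    then have "norm (of_real (R^2) - cnj a * w) = R * norm (w - a)"
      using w by (simp only: norm_mult complex_mod_cnj)
    moreover have "norm (w - a) > 0" using that by auto
    ultimately show ?thesis using R unfolding b_def by (simp add: norm_divide norm_mult)
  qed
  have pb1: "norm (\<Prod>a\<leftarrow>ys. b a w) = 1" if "norm w = R" "set ys \<subseteq> set xs" for ys w
    using that(2) b1[OF that(1)] xs by (induction ys) (auto simp: norm_mult)
  have ln_E: "ln (norm (E w)) = Re (u w)" if "norm w = R" for w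
    using Eu[of w] pb1[OF that, of xs] that by (simp add: norm_mult norm_exp_eq_Re)
  have cu: "continuous_on (sphere 0 R) u"
    using holomorphic_on_imp_continuous_on[OF u] continuous_on_subset sphere_cball by blast
  have "cmean 0 R (\<lambda>w. ln (norm (E w))) = cmean 0 R (\<lambda>w. Re (u w))"
    using R ln_E by (intro cmean_cong) auto
  also have "\<dots> = Re (u 0)" using R cu by (simp add: cmean_Re cmean_holomorphic[OF R u])
  finally have 1: "cmean 0 R (\<lambda>w. ln (norm (E w))) = Re (u 0)" .
  have b0: "norm (b a 0) = norm a / R" for a
    using R by (simp add: b_def norm_divide norm_mult norm_power power2_eq_square)
  have "norm (\<Prod>a\<leftarrow>ys. b a 0) > 0 \<and> ln (norm (\<Prod>a\<leftarrow>ys. b a 0)) = - (\<Sum>a\<leftarrow>ys. ln (R / norm a))"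
    if "set ys \<subseteq> set xs" for ys
    using that
  proof (induction ys)
    case (Cons a ys)
    have "a \<noteq> 0" using Cons.prems xs by auto
    then show ?case using Cons R by (simp add: norm_mult b0 ln_mult ln_div)
  qed simp
  from this[of xs] have "ln (norm (E 0)) = - (\<Sum>a\<leftarrow>xs. ln (R / norm a)) + Re (u 0)"
    using Eu[of 0] R by (simp add: norm_mult ln_mult norm_exp_eq_Re)
  \<comment> \<open>The mean of \<open>ln \<bar>E\<bar>\<close> only sees \<open>exp u\<close>,
    whereas at the centre each Blaschke factor contributes its modulus |a| / R.\<close>
  then have N: "N = (\<Sum>a\<leftarrow>xs. ln (R / norm a))" using 1 unfolding N_def by simp
  have lnp: "0 \<le> ln (R / norm a)" if "a \<in> set xs" for a using xs[OF that] by simp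
  have N0: "0 \<le> N" unfolding N using lnp by (intro sum_list_nonneg) auto
  have zeros: "a \<in> set xs" if a: "E a = 0" "norm a < R" for a
  proof -
    have "(\<Prod>a'\<leftarrow>xs. b a' a) = 0" using Eu[of a] a by simp
    then obtain a' where a': "a' \<in> set xs" "b a' a = 0" by (auto simp: prod_list_zero_iff)
    have "0 < R * (R - norm a)" using R a by simp
    then have "of_real (R^2) - cnj a' * a \<noteq> 0"
      using norm_blaschke_denominator_ge[of a' R a] xs[OF a'(1)] a(2) by auto
    then have "a = a'" using a'(2) R by (simp add: b_def)
    then show ?thesis using a' by simp
  qed
  show thesis
  proof (rule that[OF u ln_E N0])
    fix z d assume z: "norm z < R" and d: "0 < (d::real)" "\<And>a. E a = 0 \<Longrightarrow> d \<le> norm (z - a)"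
    define b' where "b' a = 1 / (z - a) + cnj a / (of_real (R^2) - cnj a * z)" for a
    have db: "(b a has_field_derivative b' a * b a z) (at z)" if "a \<in> set xs" for a
    proof -
      have "0 < R * (R - norm z)" using R z by simp
      then have nz: "of_real (R^2) - cnj a * z \<noteq> 0"
        using norm_blaschke_denominator_ge[of a R z] xs[OF that] z by auto
      have "z \<noteq> a" using d(1) d(2)[of a] xs[OF that] by auto
      define D where "D = of_real (R^2) - cnj a * z"
      have "(b a has_field_derivative (of_real R * D - of_real R * (z - a) * (- cnj a)) / (D * D)) (at z)"
        unfolding b_def D_def using nz by (auto intro!: derivative_eq_intros)
      also have "(of_real R * D - of_real R * (z - a) * (- cnj a)) / (D * D) = b' a * b a z"
        using nz \<open>z \<noteq> a\<close> unfolding b'_def b_def D_def[symmetric] by (simp add: field_simps)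
      finally show ?thesis .
    qed
    have du: "(u has_field_derivative deriv u z) (at z)"
      using holomorphic_derivI[OF holomorphic_on_subset[OF u ball_subset_cball] open_ball, of z] z by simp
    have "((\<lambda>w. (\<Prod>a\<leftarrow>xs. b a w) * exp (u w)) has_field_derivative
        ((\<Sum>a\<leftarrow>xs. b' a) + deriv u z) * E z) (at z)"
      by (rule DERIV_cong[OF DERIV_mult[OF has_field_derivative_prod_list[OF db] DERIV_chain2[OF DERIV_exp du]]])
         (use Eu[of z] z in \<open>auto simp: algebra_simps\<close>)
    then have "(E has_field_derivative ((\<Sum>a\<leftarrow>xs. b' a) + deriv u z) * E z) (at z)"
      by (rule has_field_derivative_transform_within_open[OF _ open_ball[of 0 R]])
         (use z Eu in auto)
    then have "deriv E z = ((\<Sum>a\<leftarrow>xs. b' a) + deriv u z) * E z" by (rule DERIV_imp_deriv)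
    moreover have "E z \<noteq> 0" using d(1) d(2)[of z] by auto
    ultimately have "deriv E z / E z - deriv u z = (\<Sum>a\<leftarrow>xs. b' a)" by simp
    then have "norm (deriv E z / E z - deriv u z) \<le> (\<Sum>a\<leftarrow>xs. norm (b' a))"
      using norm_sum_list_le by metis
    also have "\<dots> \<le> (\<Sum>a\<leftarrow>xs. (2 * R / (d * (R - norm z))) * ln (R / norm a))"
    proof (rule sum_list_mono)
      fix a assume a: "a \<in> set xs"
      have "norm (b' a) \<le> 2 * R * ln (R / norm a) / (d * (R - norm z))"
        unfolding b'_def using xs[OF a] z d by (intro norm_log_deriv_blaschke_le) auto
      then show "norm (b' a) \<le> (2 * R / (d * (R - norm z))) * ln (R / norm a)" by simp
    qed
    also have "\<dots> = 2 * R * N / (d * (R - norm z))"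
      unfolding N sum_list_const_mult by simp
    finally show "norm (deriv E z / E z - deriv u z) \<le> 2 * R * N / (d * (R - norm z))" .
  next
    fix s assume s: "0 < s" "s < R"
    let ?Z = "{a. E a = 0 \<and> norm a \<le> s}"
    have sub: "?Z \<subseteq> set xs" using zeros s by auto
    have "real (card ?Z) * ln (R / s) = (\<Sum>a\<in>?Z. ln (R / s))" by simp
    also have "\<dots> \<le> (\<Sum>a\<in>?Z. ln (R / norm a))"
    proof (rule sum_mono)
      fix a assume a: "a \<in> ?Z"
      then have "a \<noteq> 0" using E0 by auto
      then show "ln (R / s) \<le> ln (R / norm a)" using a s R by (auto intro!: divide_left_mono)
    qed
    also have "\<dots> \<le> (\<Sum>a\<in>set xs. ln (R / norm a))"
      using sub lnp by (intro sum_mono2) auto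
    also have "\<dots> \<le> N" unfolding N using lnp by (rule sum_list_ge_sum_set)
    finally show "real (card ?Z) * ln (R / s) \<le> N" .
  next
    fix a assume "E a = 0" "norm a < R"
    then have "a \<in> set xs" using zeros by auto
    then have "ln (R / norm a) \<le> (\<Sum>a\<in>set xs. ln (R / norm a))"
      using lnp by (intro member_le_sum) auto
    also have "\<dots> \<le> N" unfolding N using lnp by (rule sum_list_ge_sum_set)
    finally show "ln (R / norm a) \<le> N" .
  qed
qed

lemma continuous_on_ln_norm_entire:
  assumes "entire E" "\<And>w. w \<in> S \<Longrightarrow> E w \<noteq> 0"
  shows "continuous_on S (\<lambda>w. ln (norm (E w)))"
proof -
  have "continuous_on S E"
    using assms(1) holomorphic_on_imp_continuous_on holomorphic_on_subset by blast
  then show ?thesis by (rule continuous_on_ln[OF continuous_on_norm]) (use assms(2) in auto)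
qed

lemma cmean_nonneg:
  fixes \<phi> :: "complex \<Rightarrow> real"
  assumes "0 \<le> r" "continuous_on (sphere c r) \<phi>" "\<And>w. w \<in> sphere c r \<Longrightarrow> 0 \<le> \<phi> w"
  shows "0 \<le> cmean c r \<phi>"
  using cmean_mono[of r c "\<lambda>_. 0" \<phi>] assms by simp

text \<open>Jensen's formula recentred at \<open>c\<close>: the sum over the zeros is non-negative,
  and it is at least the term of any single zero.\<close>

lemma cmean_ln_norm_ge:
  assumes E: "entire E" and R: "0 < R" and E0: "E c \<noteq> 0"
    and sph: "\<And>w. w \<in> sphere c R \<Longrightarrow> E w \<noteq> 0"
  shows "ln (norm (E c)) \<le> cmean c R (\<lambda>w. ln (norm (E w)))"
    and "\<lbrakk>E a = 0; norm (a - c) < R\<rbrakk> \<Longrightarrow> ln (norm (E c)) + ln (R / norm (a - c)) \<le> cmean c R (\<lambda>w. ln (norm (E w)))"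
proof -
  let ?E = "\<lambda>w. E (c + w)"
  have hol: "entire ?E"
    by (rule holomorphic_on_compose[OF _ holomorphic_on_subset[OF E], of "\<lambda>w. c + w" UNIV, unfolded o_def])
       (auto intro!: holomorphic_intros)
  have sph': "?E w \<noteq> 0" if "norm w = R" for w using sph[of "c + w"] that by (simp add: dist_norm)
  have E0': "?E 0 \<noteq> 0" using E0 by simp
  note est = entire_disc_estimates[OF hol R E0' sph', simplified]
  have 1: "0 \<le> cmean 0 R (\<lambda>w. ln (norm (?E w))) - ln (norm (E c))"
    by (rule est) auto
  have 2: "ln (R / norm b) \<le> cmean 0 R (\<lambda>w. ln (norm (?E w))) - ln (norm (E c))"
    if "?E b = 0" "norm b < R" for b
    by (rule est) (use that in auto)
  show "ln (norm (E c)) \<le> cmean c R (\<lambda>w. ln (norm (E w)))"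
    using 1 by (subst cmean_shift) simp
  show "ln (norm (E c)) + ln (R / norm (a - c)) \<le> cmean c R (\<lambda>w. ln (norm (E w)))"
    if "E a = 0" "norm (a - c) < R"
    using 2[of "a - c"] that by (subst cmean_shift) simp
qed

section \<open>Circles away from zeros and the pointwise logarithmic derivative estimate\<close>

text \<open>Pigeonhole: of card X + 1 cells of equal length one contains no point of
  \<open>X\<close>, so its midpoint is half a cell away from \<open>X\<close>. Moving by at most a
  quarter of a cell then avoids the finite set \<open>Y\<close>.\<close>

lemma avoid_radius:
  fixes X Y :: "real set"
  assumes fX: "finite X" and fY: "finite Y" and ab: "a < b"
  shows "\<exists>r. a \<le> r \<and> r \<le> b \<and> r \<notin> Y \<and> (\<forall>x\<in>X. (b - a) / (4 * (real (card X) + 1)) \<le> \<bar>r - x\<bar>)"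
proof -
  define m where "m = card X + 1"
  define L where "L = b - a"
  have L: "L > 0" using ab by (simp add: L_def)
  have m: "m > 0" by (simp add: m_def)
  \<comment> \<open>The index of the cell that contains \<open>x\<close>. Points left of
    \<open>a\<close> are sent to cell 0 by \<open>nat\<close>; this can only spoil an additional
    cell and leaves the count of at most card X spoilt cells intact.\<close>
  define g where "g x = nat \<lfloor>(x - a) * m / L\<rfloor>" for x
  have "card (g ` X) < card {..<m}" using card_image_le[OF fX, of g] by (simp add: m_def)
  then have "\<not> {..<m} \<subseteq> g ` X" using fX by (metis card_mono finite_imageI linorder_not_less)
  then obtain i where i: "i < m" "i \<notin> g ` X" by auto
  define r0 where "r0 = a + (i + 1/2) * L / m"
  have far: "L / (2 * m) \<le> \<bar>r0 - x\<bar>" if x: "x \<in> X" for x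
  proof (rule ccontr)
    assume "\<not> L / (2 * m) \<le> \<bar>r0 - x\<bar>"
    then have "\<bar>r0 - x\<bar> * (m / L) < L / (2 * m) * (m / L)"
      using L m by (intro mult_strict_right_mono) auto
    also have "L / (2 * m) * (m / L) = 1/2" using L m by simp
    finally have "\<bar>(r0 - x) * (m / L)\<bar> < 1/2" using L m by (simp only: abs_mult) simp
    moreover have "(r0 - x) * (m / L) = i + 1/2 - (x - a) * m / L"
      using L m unfolding r0_def by (simp add: field_simps)
    ultimately have "\<bar>i + 1/2 - (x - a) * m / L\<bar> < 1/2" by (simp only:)
    then have "i < (x - a) * m / L" "(x - a) * m / L < i + 1" unfolding abs_less_iff by linarith+
    then have "\<lfloor>(x - a) * m / L\<rfloor> = int i" by (intro floor_unique) auto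
    then have "g x = i" by (simp add: g_def)
    then show False using i x by auto
  qed
  define d where "d = L / (4 * m)"
  have d: "d > 0" using L m by (simp add: d_def)
  have "infinite ({r0 - d..r0 + d} - Y)" using d fY by (simp add: infinite_Icc_iff)
  then obtain r where r: "r0 - d \<le> r" "r \<le> r0 + d" "r \<notin> Y"
    by (metis (no_types, lifting) Diff_iff atLeastAtMost_iff ex_in_conv finite.emptyI)
  have d2: "d = (1/4) * (L / m)" by (simp add: d_def)
  have Lm: "0 < L / m" "L / m * m = L" using L m by auto
  have r0: "r0 = a + (i + 1/2) * (L / m)" by (simp add: r0_def)
  have "a \<le> r"
  proof -
    have "(1/4) * (L / m) \<le> (i + 1/2) * (L / m)" using Lm(1) by (intro mult_right_mono) auto
    then show ?thesis using r(1) d2 r0 by linarith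
  qed
  moreover have "r \<le> b"
  proof -
    have "(i + 1/2) * (L / m) + (1/4) * (L / m) = (i + 3/4) * (L / m)" by (simp add: algebra_simps)
    also have "\<dots> \<le> m * (L / m)" using Lm(1) i by (intro mult_right_mono) auto
    also have "\<dots> = b - a" using Lm(2) m by (simp add: L_def)
    finally show ?thesis using r(2) d2 r0 by linarith
  qed
  moreover have "(b - a) / (4 * (real (card X) + 1)) \<le> \<bar>r - x\<bar>" if "x \<in> X" for x
  proof -
    have "L / (2 * m) = 2 * d" by (simp add: d_def)
    then have "d \<le> \<bar>r - x\<bar>" using far[OF that] r(1,2) by linarith
    then show ?thesis by (simp add: d_def L_def m_def add.commute)
  qed
  ultimately show ?thesis using r(3) by blast
qed

text \<open>With e = (Blaschke product) exp u for each function, the difference of logarithmic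
  derivatives consists of two Blaschke parts and the derivative of \<open>u1 - u0\<close>. The
  former are controlled by the distance to the zeros, whose number is bounded by Jensen's formula,
  the latter by the mean of |Re (u1 - u0)|.\<close>

lemma window_center_0:
  fixes F :: "(complex \<Rightarrow> complex) set" and A R \<rho> :: real
  assumes F: "finite F" "F \<noteq> {}" "\<And>e. e \<in> F \<Longrightarrow> entire e \<and> e 0 \<noteq> 0"
    and \<rho>: "0 < \<rho>" "\<rho> < R" "1 \<le> R"
    and sph: "\<And>e w. \<lbrakk>e \<in> F; norm w = R\<rbrakk> \<Longrightarrow> e w \<noteq> 0"
    and A1: "\<And>e. e \<in> F \<Longrightarrow> cmean 0 R (\<lambda>w. ln (norm (e w))) - ln (norm (e 0)) \<le> A"
    and P: "P \<subseteq> F \<times> F"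
    and A2: "\<And>e1 e0. (e1, e0) \<in> P \<Longrightarrow> cmean 0 R (\<lambda>w. \<bar>ln (norm (e1 w)) - ln (norm (e0 w))\<bar>) \<le> A"
    and A: "1 \<le> A" and D: "entire D" "D w0 \<noteq> 0"
  shows "\<exists>r. \<rho> \<le> r \<and> r < R \<and> (\<forall>w. norm w = r \<longrightarrow> D w \<noteq> 0 \<and> (\<forall>e\<in>F. e w \<noteq> 0) \<and>
     (\<forall>(e1, e0)\<in>P. norm (deriv e1 w / e1 w - deriv e0 w / e0 w) \<le> 300 * card F * A^2 * (R / (R - \<rho>))^3))"
proof -
  define L where "L = R - \<rho>"
  have L: "0 < L" "L < R" using \<rho> by (auto simp: L_def)
  \<comment> \<open>The radius is sought in the first third of the window, and zeros are counted up
    to the end of the second third. Zeros further out are at least L / 3 away anyway.\<close>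
  define s where "s = \<rho> + 2 * L / 3"
  have s: "0 < s" "s < R" "R - s = L / 3" using \<rho> L by (auto simp: s_def L_def field_simps)
  define Z where "Z = (\<Union>e\<in>F. {a. e a = 0 \<and> norm a \<le> s})"
  have finZ: "finite {a. e a = 0 \<and> norm a \<le> s}" if "e \<in> F" for e
  proof -
    have "finite {a \<in> cball 0 s. e a = 0}"
      by (rule entire_finite_zeros[of e 0]) (use F(3) that in auto)
    then show ?thesis by (rule finite_subset[rotated]) auto
  qed
  have cF: "1 \<le> real (card F)" using F(1,2) by (simp add: Suc_leI card_gt_0_iff)
  have "real (card {a. e a = 0 \<and> norm a \<le> s}) \<le> 3 * R * A / L" if e: "e \<in> F" for e
  proof -
    note est = entire_disc_estimates[of e R]
    have "real (card {a. e a = 0 \<and> norm a \<le> s}) * ln (R / s) \<le> cmean 0 R (\<lambda>w. ln (norm (e w))) - ln (norm (e 0))"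
      by (rule est) (use F(3)[OF e] \<rho> s sph[OF e] in auto)
    also have "\<dots> \<le> A" by (rule A1[OF e])
    finally have "real (card {a. e a = 0 \<and> norm a \<le> s}) * ln (R / s) \<le> A" .
    moreover have "L / (3 * R) \<le> ln (R / s)"
    proof -
      have "1 - s / R = (R - s) / R" using \<rho> by (simp add: diff_divide_distrib)
      then have "1 - s / R = L / (3 * R)" using s(3) by simp
      then show ?thesis using one_minus_le_ln_divide[of s R] s \<rho> by simp
    qed
    then have "real (card {a. e a = 0 \<and> norm a \<le> s}) * (L / (3 * R)) \<le> real (card {a. e a = 0 \<and> norm a \<le> s}) * ln (R / s)"
      by (intro mult_left_mono) auto
    ultimately have "real (card {a. e a = 0 \<and> norm a \<le> s}) * (L / (3 * R)) \<le> A" by linarith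
    then show ?thesis using L \<rho> by (simp add: field_simps)
  qed
  then have "(\<Sum>e\<in>F. real (card {a. e a = 0 \<and> norm a \<le> s})) \<le> (\<Sum>e\<in>F. 3 * R * A / L)"
    by (rule sum_mono)
  moreover have "real (card Z) \<le> (\<Sum>e\<in>F. real (card {a. e a = 0 \<and> norm a \<le> s}))"
  proof -
    have "card Z \<le> (\<Sum>e\<in>F. card {a. e a = 0 \<and> norm a \<le> s})"
      unfolding Z_def by (rule card_UN_le[OF F(1)])
    then have "real (card Z) \<le> real (\<Sum>e\<in>F. card {a. e a = 0 \<and> norm a \<le> s})"
      by (simp only: of_nat_le_iff)
    then show ?thesis by simp
  qed
  ultimately have cZ: "real (card Z) \<le> card F * (3 * R * A / L)" by simp
  have fZ: "finite Z" unfolding Z_def using F(1) finZ by blast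
  have cX: "real (card (norm ` Z)) \<le> card F * (3 * R * A / L)"
    using card_image_le[OF fZ, of norm] cZ by linarith
  have "finite {a \<in> cball 0 R. D a = 0}" by (rule entire_finite_zeros[OF D]) auto
  then obtain r where r: "\<rho> \<le> r" "r \<le> \<rho> + L / 3" "r \<notin> norm ` {a \<in> cball 0 R. D a = 0}"
     and far: "\<And>x. x \<in> norm ` Z \<Longrightarrow> (\<rho> + L / 3 - \<rho>) / (4 * (real (card (norm ` Z)) + 1)) \<le> \<bar>r - x\<bar>"
    using avoid_radius[of "norm ` Z" "norm ` {a \<in> cball 0 R. D a = 0}" \<rho> "\<rho> + L / 3"] fZ L by auto
  \<comment> \<open>With y = card F R A / L there are at most 3 y moduli to avoid, and 3 y + 1 \<le>
    4 y. A third of the window divided by 4 (4 y) is L^2 / K.\<close>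
  define K where "K = 48 * card F * R * A"
  have K: "0 < K" using cF \<rho> A by (simp add: K_def)
  define d where "d = L^2 / K"
  have d: "0 < d" using L K by (simp add: d_def)
  have RL: "1 \<le> R / L" using L by simp
  have one: "1 \<le> card F * (R * A / L)"
  proof -
    have "1 * 1 \<le> (R / L) * A" using RL A by (intro mult_mono) auto
    then have "1 * 1 \<le> card F * ((R / L) * A)" using cF by (intro mult_mono) auto
    then show ?thesis by simp
  qed
  have dle: "d \<le> (L / 3) / (4 * (real (card (norm ` Z)) + 1))"
  proof -
    define y where "y = card F * (R * A / L)"
    have y3: "card F * (3 * R * A / L) = 3 * y" by (simp add: y_def)
    have "real (card (norm ` Z)) \<le> 3 * y" using cX unfolding y3 .
    then have "real (card (norm ` Z)) + 1 \<le> 4 * y" using one[folded y_def] by linarith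
    then have "(L / 3) / (4 * (4 * y)) \<le> (L / 3) / (4 * (real (card (norm ` Z)) + 1))"
      using L by (intro frac_le) auto
    moreover have "(L / 3) / (4 * (4 * y)) = d"
      using L cF \<rho> A unfolding d_def K_def y_def by (simp add: field_simps power2_eq_square)
    ultimately show ?thesis by simp
  qed
  have "(L / 3) / (4 * (real (card (norm ` Z)) + 1)) \<le> (L / 3) / 1"
    using L by (intro frac_le) auto
  then have d3: "d \<le> L / 3" using dle by linarith
  have dist: "d \<le> norm (z - a)" if z: "norm z = r" and e: "e \<in> F" "e a = 0" for z a e
  proof -
    have tri: "\<bar>r - norm a\<bar> \<le> norm (z - a)" using z norm_triangle_ineq3[of z a] by simp
    show ?thesis
    proof (cases "norm a \<le> s")
      case True
      then have "a \<in> Z" using e unfolding Z_def by auto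
      then show ?thesis using far[of "norm a"] dle tri by auto
    next
      case False
      then have "L / 3 \<le> \<bar>r - norm a\<bar>" using r by (simp add: s_def)
      then show ?thesis using d3 tri by linarith
    qed
  qed
  have LR: "R = \<rho> + L" by (simp add: L_def)
  have rR: "r < R" "2 * L / 3 \<le> R - r" unfolding LR using r L(1) by linarith+
  define B where "B = R^2 * A^2 / L^3"
  have dp: "d * (R - r) \<ge> d * (2 * L / 3)" "d * (2 * L / 3) > 0" using d rR L by (auto intro: mult_left_mono)
  have main: "norm (deriv e1 z / e1 z - deriv e0 z / e0 z) \<le> 300 * card F * A^2 * (R / L)^3"
    if z: "norm z = r" and e10: "(e1, e0) \<in> P" for z e1 e0
  proof -
    have e1: "e1 \<in> F" and e0: "e0 \<in> F" using e10 P by auto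
    have ex: "\<exists>u. u holomorphic_on cball 0 R \<and> (\<forall>w. norm w = R \<longrightarrow> ln (norm (e w)) = Re (u w)) \<and>
        norm (deriv e z / e z - deriv u z) \<le> 144 * card F * B" if e: "e \<in> F" for e
    proof -
      define N where "N = cmean 0 R (\<lambda>w. ln (norm (e w))) - ln (norm (e 0))"
      have H: "entire e" "0 < R" "e 0 \<noteq> 0" "\<And>w. norm w = R \<Longrightarrow> e w \<noteq> 0"
        using F(3)[OF e] \<rho> sph[OF e] by auto
      show ?thesis
      proof (rule entire_disc_estimates[of e R])
        fix u assume u: "u holomorphic_on cball 0 R" "\<And>w. norm w = R \<Longrightarrow> ln (norm (e w)) = Re (u w)"
          and N0': "0 \<le> cmean 0 R (\<lambda>w. ln (norm (e w))) - ln (norm (e 0))"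
          and ub': "\<And>z d. \<lbrakk>norm z < R; 0 < d; \<And>a. e a = 0 \<Longrightarrow> d \<le> norm (z - a)\<rbrakk> \<Longrightarrow>
           norm (deriv e z / e z - deriv u z) \<le> 2 * R * (cmean 0 R (\<lambda>w. ln (norm (e w))) - ln (norm (e 0))) / (d * (R - norm z))"
        have N0: "0 \<le> N" using N0' unfolding N_def .
        note ub = ub'[folded N_def]
      have "norm (deriv e z / e z - deriv u z) \<le> 2 * R * N / (d * (R - norm z))"
        by (rule ub) (use z rR d dist[OF z e] in auto)
      also have "\<dots> \<le> 2 * R * A / (d * (2 * L / 3))"
      proof (intro frac_le)
        show "d * (2 * L / 3) \<le> d * (R - norm z)" using dp z by simp
        show "2 * R * N \<le> 2 * R * A" using A1[OF e] \<rho> unfolding N_def[symmetric] by (intro mult_left_mono) auto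
      qed (use dp \<rho> A in auto)
      also have "\<dots> = 144 * card F * B"
        using L K cF \<rho> A unfolding d_def B_def K_def by (simp add: field_simps power2_eq_square power3_eq_cube)
      finally show ?thesis using u by blast
      qed (use H in auto)
    qed
    obtain u1 where u1: "u1 holomorphic_on cball 0 R" "\<And>w. norm w = R \<Longrightarrow> ln (norm (e1 w)) = Re (u1 w)"
        "norm (deriv e1 z / e1 z - deriv u1 z) \<le> 144 * card F * B" using ex[OF e1] by blast
    obtain u0 where u0: "u0 holomorphic_on cball 0 R" "\<And>w. norm w = R \<Longrightarrow> ln (norm (e0 w)) = Re (u0 w)"
        "norm (deriv e0 z / e0 z - deriv u0 z) \<le> 144 * card F * B" using ex[OF e0] by blast
    have hu: "(\<lambda>w. u1 w - u0 w) holomorphic_on cball 0 R" by (intro holomorphic_intros u1 u0)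
    have "norm (deriv (\<lambda>w. u1 w - u0 w) z) \<le> 2 * R / (R - norm z)^2 * cmean 0 R (\<lambda>w. \<bar>Re (u1 w - u0 w)\<bar>)"
      by (rule deriv_le_cmean_abs_Re[OF hu]) (use z rR in auto)
    also have "cmean 0 R (\<lambda>w. \<bar>Re (u1 w - u0 w)\<bar>) = cmean 0 R (\<lambda>w. \<bar>ln (norm (e1 w)) - ln (norm (e0 w))\<bar>)"
      using \<rho> u1(2) u0(2) by (intro cmean_cong) auto
    also have "2 * R / (R - norm z)^2 * \<dots> \<le> 2 * R / (2 * L / 3)^2 * A"
    proof (intro mult_mono A2 e10 frac_le power_mono)
      show "0 \<le> cmean 0 R (\<lambda>w. \<bar>ln (norm (e1 w)) - ln (norm (e0 w))\<bar>)"
        using F(3)[OF e1] F(3)[OF e0] \<rho> sph[OF e1] sph[OF e0]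
        by (intro cmean_nonneg continuous_on_rabs continuous_on_diff continuous_on_ln_norm_entire) auto
    qed (use \<rho> z rR L in auto)
    also have "\<dots> = (9/2) * (R * A / L^2)" using L by (simp add: field_simps power2_eq_square)
    also have "\<dots> \<le> (9/2) * (card F * B)"
    proof -
      have "R * A / L^2 * 1 \<le> R * A / L^2 * (card F * (R * A / L))"
        using one L \<rho> A by (intro mult_left_mono) auto
      also have "\<dots> = card F * B" by (simp add: B_def power2_eq_square power3_eq_cube)
      finally have "R * A / L^2 \<le> card F * B" by simp
      then show ?thesis by (intro mult_left_mono) auto
    qed
    finally have 3: "norm (deriv (\<lambda>w. u1 w - u0 w) z) \<le> (9/2) * (card F * B)" .
    have zb: "z \<in> ball 0 R" using z rR by simp
    have diff: "(u field_differentiable at z)" if "u holomorphic_on cball 0 R" for u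
      using holomorphic_on_imp_differentiable_at[OF holomorphic_on_subset[OF that ball_subset_cball] open_ball zb] .
    have "deriv (\<lambda>w. u1 w - u0 w) z = deriv u1 z - deriv u0 z"
      by (rule deriv_diff) (use diff u1(1) u0(1) in auto)
    then have "deriv e1 z / e1 z - deriv e0 z / e0 z = (deriv e1 z / e1 z - deriv u1 z) -
       (deriv e0 z / e0 z - deriv u0 z) + deriv (\<lambda>w. u1 w - u0 w) z" by simp
    then have "norm (deriv e1 z / e1 z - deriv e0 z / e0 z) \<le> norm (deriv e1 z / e1 z - deriv u1 z) +
       norm (deriv e0 z / e0 z - deriv u0 z) + norm (deriv (\<lambda>w. u1 w - u0 w) z)"
      by (simp only:) (intro order_trans[OF norm_triangle_ineq] add_right_mono norm_triangle_ineq4)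
    \<comment> \<open>144 + 144 + 9/2 \<le> 300.\<close>
    also have "\<dots> \<le> 300 * (card F * B)" 
    proof -
      have "0 \<le> card F * B" using \<rho> L by (simp add: B_def)
      then show ?thesis using u1(3) u0(3) 3 by simp
    qed
    also have "\<dots> \<le> 300 * (card F * (A^2 * (R / L)^3))"
    proof -
      \<comment> \<open>The extra factor R \<ge> 1 makes the bound depend on the ratio R / L
        only.\<close>
      have "B * 1 \<le> B * R" using \<rho> L by (intro mult_left_mono) (auto simp: B_def)
      also have "B * R = A^2 * (R / L)^3" by (simp add: B_def power_divide power2_eq_square power3_eq_cube)
      finally show ?thesis using cF by (intro mult_left_mono) auto
    qed
    finally show ?thesis by (simp add: mult_ac)
  qed
  show ?thesis
  proof (intro exI[of _ r] conjI allI impI ballI)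
    show "D w \<noteq> 0" if "norm w = r" for w
    proof
      assume "D w = 0"
      then have "r \<in> norm ` {a \<in> cball 0 R. D a = 0}" using that rR by (intro image_eqI[of _ _ w]) auto
      then show False using r(3) by simp
    qed
    show "e w \<noteq> 0" if "norm w = r" "e \<in> F" for w e
      using dist[OF that, of w] d by auto
  qed (use r rR main in \<open>auto simp: L_def\<close>)
qed

section \<open>The characteristic function\<close>

text \<open>Borel's growth lemma. If it failed, \<open>T\<close> would double with each step from x
  to x (1 + 1 / T x). Then the relative step lengths are dominated by a geometric series, so the
  points stay bounded while \<open>T\<close> tends to infinity, against monotonicity.\<close>

lemma borel_growth:
  fixes T :: "real \<Rightarrow> real"
  assumes mono: "\<And>x y. \<lbrakk>0 < x; x \<le> y\<rbrakk> \<Longrightarrow> T x \<le> T y"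
    and unb: "\<And>M. \<exists>x\<ge>1. M \<le> T x"
  shows "\<exists>\<rho>\<ge>1. M \<le> T \<rho> \<and> T (\<rho> * (1 + 1 / T \<rho>)) \<le> 2 * T \<rho>"
proof (rule ccontr)
  assume neg: "\<not> ?thesis"
  obtain x1 where x1: "1 \<le> x1" "max M 1 \<le> T x1" using unb by blast
  have step: "2 * T x < T (x * (1 + 1 / T x))" if "x1 \<le> x" for x
  proof (rule ccontr)
    assume "\<not> ?thesis"
    moreover have "1 \<le> x" "M \<le> T x" using that x1 mono[of x1 x] by auto
    ultimately show False using neg by (meson not_le)
  qed
  define X where "X = rec_nat x1 (\<lambda>_ x. x * (1 + 1 / T x))"
  have X0: "X 0 = x1" and XS: "X (Suc n) = X n * (1 + 1 / T (X n))" for n by (simp_all add: X_def)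
  \<comment> \<open>2 - 2 / 2^n is the sum of 1 / 2^j over j < n, the accumulated relative step
    lengths.\<close>
  have inv: "x1 \<le> X n \<and> 2 ^ n \<le> T (X n) \<and> X n \<le> x1 * exp (2 - 2 / 2 ^ n)" for n
  proof (induction n)
    case 0
    show ?case using x1 by (simp add: X0)
  next
    case (Suc n)
    define t where "t = T (X n)"
    have t: "2 ^ n \<le> t" "x1 \<le> X n" using Suc by (auto simp: t_def)
    have t1: "1 \<le> t" using t(1) one_le_power[of "2::real" n] by linarith
    have pos: "0 < X n" using t(2) x1(1) by linarith
    have "X n * 1 \<le> X n * (1 + 1 / t)" using pos t1 by (intro mult_left_mono) auto
    then have 1: "x1 \<le> X (Suc n)" using t(2) by (simp add: XS t_def)
    have 2: "2 ^ Suc n \<le> T (X (Suc n))" using step[OF t(2)] t(1) by (simp add: XS t_def)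
    have "1 + 1 / t \<le> 1 + 1 / 2 ^ n" using t(1) t1 by (simp add: frac_le)
    also have "\<dots> \<le> exp (1 / 2 ^ n)" by (rule exp_ge_add_one_self)
    finally have "X (Suc n) \<le> (x1 * exp (2 - 2 / 2 ^ n)) * exp (1 / 2 ^ n)"
      unfolding XS t_def[symmetric] using Suc pos t1 x1 by (intro mult_mono) auto
    also have "\<dots> = x1 * exp (2 - 2 / 2 ^ Suc n)" by (simp flip: exp_add)
    finally show ?case using 1 2 by simp
  qed
  obtain n where n: "T (x1 * exp 2) < 2 ^ n" using real_arch_pow[of 2] by auto
  have "X n \<le> x1 * exp (2 - 2 / 2 ^ n)" using inv by blast
  also have "\<dots> \<le> x1 * exp 2" using x1 by (intro mult_left_mono) auto
  finally have "T (X n) \<le> T (x1 * exp 2)" using inv[of n] x1 by (intro mono) auto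
  then show False using inv[of n] n by linarith
qed

text \<open>The sum is invariant under shifting \<open>t\<close> by 1 / N, so only shifts in
  [0, 1/N] matter; there each sample point lies in its own cell of the partition and uniform
  continuity applies. This makes \<open>N0\<close> independent of \<open>t\<close>.\<close>

lemma uniform_Riemann_sum:
  fixes v :: "real \<Rightarrow> real"
  assumes cont: "continuous_on UNIV v" and per: "\<And>t. v (t + 1) = v t" and eps: "0 < \<epsilon>"
  shows "\<exists>N0>(0::nat). \<forall>N\<ge>N0. \<forall>t\<ge>0. \<bar>(\<Sum>k<N. v (t + real k / real N)) - N * integral {0..1} v\<bar> \<le> N * \<epsilon>"
proof -
  have "uniformly_continuous_on {0..2} v"
    by (rule compact_uniformly_continuous) (auto intro: continuous_on_subset[OF cont])
  then obtain d where d: "d > 0" "\<And>x y. \<lbrakk>x \<in> {0..2}; y \<in> {0..2}; dist y x < d\<rbrakk> \<Longrightarrow> dist (v y) (v x) < \<epsilon>"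
    using eps unfolding uniformly_continuous_on_def by metis
  obtain n where n: "1 / real (Suc n) < d" using d(1) by (rule nat_approx_posE)
  have "\<forall>t\<ge>0. \<bar>(\<Sum>k<N. v (t + real k / real N)) - N * integral {0..1} v\<bar> \<le> N * \<epsilon>" if Nn: "N \<ge> Suc n" for N
  proof -
  have N0: "N > 0" using Nn by simp
  have "1 / real N \<le> 1 / real (Suc n)" using Nn by (intro frac_le) auto
  then have N: "N > 0" "1 / real N < d" using n N0 by auto
  define S where "S t = (\<Sum>k<N. v (t + real k / real N))" for t
  have shift: "S (t + 1 / real N) = S t" for t
  proof -
    have "S (t + 1 / real N) = (\<Sum>k<N. v (t + real (Suc k) / real N))"
      unfolding S_def by (intro sum.cong refl arg_cong[of _ _ v]) (simp add: add_divide_distrib)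
    moreover have "v (t + 0 / N) + (\<Sum>k<N. v (t + real (Suc k) / real N)) = (\<Sum>k<N. v (t + real k / real N)) + v (t + N / N)"
      using sum.lessThan_Suc_shift[of "\<lambda>k. v (t + real k / real N)" N] sum.lessThan_Suc[of "\<lambda>k. v (t + real k / real N)" N] by simp
    ultimately show ?thesis using N per[of t] by (simp add: S_def)
  qed
  have shifts: "S (t + real j / real N) = S t" for t j
  proof (induction j)
    case (Suc j)
    have "S (t + real (Suc j) / real N) = S ((t + real j / real N) + 1 / real N)"
      by (intro arg_cong[of _ _ S]) (simp add: add_divide_distrib)
    then show ?case using shift Suc by simp
  qed simp
  have int: "v integrable_on {a..b}" for a b
    by (rule integrable_continuous_interval) (rule continuous_on_subset[OF cont], simp)
  have small: "\<bar>S s - N * integral {0..1} v\<bar> \<le> N * \<epsilon>" if s: "0 \<le> s" "s \<le> 1 / real N" for s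
  proof -
    have "m \<le> N \<Longrightarrow> \<bar>(\<Sum>k<m. v (s + real k / real N)) - N * integral {0..real m / real N} v\<bar> \<le> m * \<epsilon>" for m
    proof (induction m)
      case (Suc m)
      have comb: "integral {0..real m / real N} v + integral {real m / real N..real (Suc m) / real N} v = integral {0..real (Suc m) / real N} v"
        by (rule Henstock_Kurzweil_Integration.integral_combine) (use int N in \<open>auto simp: divide_right_mono\<close>)
      have m1: "real (Suc m) / real N \<le> 1" using Suc.prems N by simp
      have step: "real (Suc m) / real N = real m / real N + 1 / real N" by (simp add: add_divide_distrib)
      have "norm (integral (cbox (real m / real N) (real (Suc m) / real N)) (\<lambda>x. v x - v (s + real m / real N))) \<le> \<epsilon> * measure lborel (cbox (real m / real N) (real (Suc m) / real N))"
      proof (rule integrable_bound)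
        show "(\<lambda>x. v x - v (s + real m / real N)) integrable_on cbox (real m / real N) (real (Suc m) / real N)"
          using int by (intro integrable_diff) auto
        fix x assume x: "x \<in> cbox (real m / real N) (real (Suc m) / real N)"
        have "dist x (s + real m / real N) < d"
          using x s N(2) step unfolding dist_real_def by auto
        then have "dist (v x) (v (s + real m / real N)) < \<epsilon>"
          using x s m1 step order_trans[of 0 "real m / real N" x] by (intro d(2)) auto
        then show "norm (v x - v (s + real m / real N)) \<le> \<epsilon>" by (simp add: dist_real_def)
      qed (use eps in auto)
      moreover have "integral (cbox (real m / real N) (real (Suc m) / real N)) (\<lambda>x. v x - v (s + real m / real N)) = 
         integral {real m / real N..real (Suc m) / real N} v - v (s + real m / real N) / N"
        using int N step by (subst integral_diff) auto
      ultimately have "\<bar>integral {real m / real N..real (Suc m) / real N} v - v (s + real m / real N) / N\<bar> \<le> \<epsilon> / N"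
        using N step by simp
      then have "N * \<bar>integral {real m / real N..real (Suc m) / real N} v - v (s + real m / real N) / N\<bar> \<le> \<epsilon>"
        using N by (simp add: field_simps)
      moreover have "N * \<bar>integral {real m / real N..real (Suc m) / real N} v - v (s + real m / real N) / N\<bar> =
         \<bar>N * (integral {real m / real N..real (Suc m) / real N} v - v (s + real m / real N) / N)\<bar>" by (simp add: abs_mult)
      moreover have "N * (integral {real m / real N..real (Suc m) / real N} v - v (s + real m / real N) / N) = N * integral {real m / real N..real (Suc m) / real N} v - v (s + real m / real N)"
        using N by (simp add: field_simps)
      ultimately have A: "\<bar>N * integral {real m / real N..real (Suc m) / real N} v - v (s + real m / real N)\<bar> \<le> \<epsilon>" by simp
      have B: "\<bar>(\<Sum>k<m. v (s + real k / real N)) - N * integral {0..real m / real N} v\<bar> \<le> m * \<epsilon>" using Suc by simp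
      have C: "N * integral {0..real (Suc m) / real N} v = N * integral {0..real m / real N} v + N * integral {real m / real N..real (Suc m) / real N} v"
        unfolding comb[symmetric] by (simp add: distrib_left)
      have D: "real (Suc m) * \<epsilon> = m * \<epsilon> + \<epsilon>" by (simp add: algebra_simps)
      show ?case using A B unfolding C D sum.lessThan_Suc by linarith
    qed simp
    from this[of N] show ?thesis using N by (simp add: S_def)
  qed
  show ?thesis
  proof (intro allI impI)
    fix t :: real assume t: "0 \<le> t"
    define j where "j = nat \<lfloor>t * N\<rfloor>"
    define s where "s = t - real j / real N"
    have "real j = of_int \<lfloor>t * N\<rfloor>" using t by (simp add: j_def)
    then have "real j \<le> t * N" "t * N < j + 1" using floor_correct[of "t * N"] by linarith+
    then have "real j / N \<le> t" "t \<le> (j + 1) / N" using N0 by (simp_all add: pos_divide_le_eq pos_le_divide_eq)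
    then have "0 \<le> s" "s \<le> 1 / real N" unfolding s_def by (simp_all add: add_divide_distrib)
    moreover have "S t = S s" using shifts[of s j] by (simp add: s_def)
    ultimately show "\<bar>(\<Sum>k<N. v (t + real k / real N)) - N * integral {0..1} v\<bar> \<le> N * \<epsilon>"
      using small[of s] unfolding S_def by simp
  qed
  qed
  then show ?thesis by blast
qed

lemma circlepath_plus_1: "circlepath c r (t + 1) = circlepath c r t"
proof -
  have "2 * complex_of_real pi * \<i> * of_real (t + 1) = 2 * complex_of_real pi * \<i> * of_real t + 2 * of_real pi * \<i>"
    by (simp add: algebra_simps)
  then show ?thesis unfolding circlepath by (simp add: exp_plus_2pin exp_add)
qed

lemma circlepath_rotate:
  "circlepath c r (t + s) = c + (circlepath c r t - c) * exp (2 * of_real pi * \<i> * of_real s)"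
  unfolding circlepath by (simp add: algebra_simps exp_add)

text \<open>
  The average of \<open>ln (max \<bar>f0\<bar> \<bar>f1\<bar>)\<close> over the \<open>N\<close> rotations of a point is the maximum of
  \<open>ln \<bar>E\<bar> / N\<close> over the finitely many products \<open>E\<close> of rotated copies of \<open>f0\<close> and \<open>f1\<close>, so the
  maximum modulus principle applies to it; then let \<open>N\<close> tend to infinity.
\<close>

lemma cmean_ln_max_mono:
  assumes hol: "entire f0" "entire f1"
    and nz: "\<And>z. f0 z \<noteq> 0 \<or> f1 z \<noteq> 0" and r: "0 < r" "r \<le> R"
  defines "u \<equiv> \<lambda>z. ln (max (norm (f0 z)) (norm (f1 z)))"
  shows "cmean c r u \<le> cmean c R u"
proof (rule field_le_epsilon)
  fix \<epsilon>' :: real assume "0 < \<epsilon>'"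
  define \<epsilon> where "\<epsilon> = \<epsilon>' / 2"
  have eps: "0 < \<epsilon>" using \<open>0 < \<epsilon>'\<close> by (simp add: \<epsilon>_def)
  have cf: "continuous_on UNIV f0" "continuous_on UNIV f1"
    using hol holomorphic_on_imp_continuous_on by auto
  have pos: "0 < max (norm (f0 z)) (norm (f1 z))" for z using nz[of z] by (simp add: less_max_iff_disj)
  have cu: "continuous_on UNIV u" unfolding u_def
    by (intro continuous_intros cf) (use pos in \<open>metis less_irrefl\<close>)
  have cv: "continuous_on UNIV (\<lambda>t. u (circlepath c s t))" for s
    by (rule continuous_on_compose2[OF cu continuous_on_circlepath]) auto
  have R: "0 < R" using r by simp
  have cm: "cmean c s u = integral {0..1} (\<lambda>t. u (circlepath c s t))" for s by (simp add: cmean_def)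
  have "\<exists>N0>(0::nat). \<forall>N\<ge>N0. \<forall>t\<ge>0. \<bar>(\<Sum>k<N. u (circlepath c s (t + real k / real N))) - N * cmean c s u\<bar> \<le> N * \<epsilon>" for s
    unfolding cm by (rule uniform_Riemann_sum[OF cv _ eps]) (simp add: circlepath_plus_1)
  then obtain N0 where N0: "\<And>s. 0 < N0 s"
    "\<And>s N t. \<lbrakk>N0 s \<le> N; 0 \<le> t\<rbrakk> \<Longrightarrow> \<bar>(\<Sum>k<N. u (circlepath c s (t + real k / real N))) - N * cmean c s u\<bar> \<le> N * \<epsilon>"
    by metis
  define N where "N = max (N0 r) (N0 R)"
  have N: "0 < N" "N0 r \<le> N" "N0 R \<le> N" using N0(1)[of r] by (auto simp: N_def)
  define rot where "rot k w = c + (w - c) * exp (2 * of_real pi * \<i> * of_real (real k / real N))" for k :: nat and w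
  define z0 where "z0 = circlepath c r 0"
  \<comment> \<open>At each rotation of \<open>z0\<close> the larger of \<open>f0\<close> and
    \<open>f1\<close> is chosen. Hence the modulus of \<open>E z0\<close> is exactly the exponential
    of the sum, while on the outer circle the same choice is at most the maximum.\<close>
  define \<sigma> where "\<sigma> k = (if norm (f1 (rot k z0)) \<le> norm (f0 (rot k z0)) then f0 else f1)" for k
  define E where "E w = (\<Prod>k<N. \<sigma> k (rot k w))" for w
  have eu: "exp (u z) = max (norm (f0 z)) (norm (f1 z))" for z using pos[of z] by (simp add: u_def)
  have "norm (\<sigma> k (rot k z0)) = exp (u (circlepath c r (0 + real k / real N)))" for k
    unfolding circlepath_rotate eu z0_def[symmetric] rot_def[symmetric] by (auto simp: \<sigma>_def max_def)
  then have Ez0: "norm (E z0) = exp (\<Sum>k<N. u (circlepath c r (0 + real k / real N)))"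
    unfolding E_def by (simp add: prod_norm[symmetric] exp_sum)
  have Ew: "norm (E w) \<le> exp (N * cmean c R u + N * \<epsilon>)" if w: "w \<in> sphere c R" for w
  proof -
    obtain t where t: "t \<in> {0..1}" "w = circlepath c R t"
    proof -
      have "w \<in> circlepath c R ` {0..1}"
        using w R path_image_circlepath[of c R] unfolding path_image_def by simp
      then show ?thesis using that by blast
    qed
    have "norm (\<sigma> k (rot k w)) \<le> exp (u (circlepath c R (t + real k / real N)))" for k
      unfolding circlepath_rotate eu t(2)[symmetric] rot_def[symmetric] by (auto simp: \<sigma>_def)
    then have "norm (E w) \<le> exp (\<Sum>k<N. u (circlepath c R (t + real k / real N)))"
      unfolding E_def by (simp add: prod_norm[symmetric] exp_sum prod_mono)
    also have "\<dots> \<le> exp (N * cmean c R u + N * \<epsilon>)"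
      using N0(2)[OF N(3), of t] t(1) by simp
    finally show ?thesis .
  qed
  have "entire E"
    unfolding E_def
  proof (rule holomorphic_on_prod)
    fix k
    have "entire (rot k)" unfolding rot_def by (intro holomorphic_intros)
    then have "entire (\<sigma> k \<circ> rot k)"
      by (rule holomorphic_on_compose) (use hol in \<open>auto simp: \<sigma>_def intro: holomorphic_on_subset\<close>)
    then show "entire (\<lambda>w. \<sigma> k (rot k w))" by (simp add: o_def)
  qed
  then have holE: "E holomorphic_on S" for S by (rule holomorphic_on_subset) simp
  have z0c: "z0 \<in> cball c R"
  proof -
    have "z0 \<in> sphere c r" unfolding z0_def using r by (intro circlepath_in_sphere) simp
    then show ?thesis using r by simp
  qed
  have "norm (E z0) \<le> exp (N * cmean c R u + N * \<epsilon>)"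
    by (rule maximum_modulus_frontier[of E "cball c R"])
       (use Ew z0c holE R in \<open>auto intro: holomorphic_on_imp_continuous_on\<close>)
  then have "(\<Sum>k<N. u (circlepath c r (0 + real k / real N))) \<le> N * cmean c R u + N * \<epsilon>"
    unfolding Ez0 by simp
  moreover have "N * cmean c r u - N * \<epsilon> \<le> (\<Sum>k<N. u (circlepath c r (0 + real k / real N)))"
    using N0(2)[OF N(2), of 0] by simp
  ultimately have "N * cmean c r u \<le> N * (cmean c R u + \<epsilon>')"
    by (simp add: \<epsilon>_def algebra_simps)
  then show "cmean c r u \<le> cmean c R u + \<epsilon>'" using N(1) by simp
qed

section \<open>Linear forms, Wronskians and the characteristic in homogeneous coordinates\<close>

text \<open>For pairs without common zeros, the circle means of this function are Cartan's form of
  the Nevanlinna characteristic of f1 / f0, up to an additive constant.\<close>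

definition lnmax :: "(complex \<Rightarrow> complex) \<Rightarrow> (complex \<Rightarrow> complex) \<Rightarrow> complex \<Rightarrow> real" where
  "lnmax f0 f1 z = ln (max (norm (f0 z)) (norm (f1 z)))"

text \<open>This is f0 (f1 / f0 - a); for pairs without common zeros its zeros are the a-points of
  f1 / f0 with the same orders.\<close>

definition lform :: "(complex \<Rightarrow> complex) \<Rightarrow> (complex \<Rightarrow> complex) \<Rightarrow> complex \<Rightarrow> complex \<Rightarrow> complex" where
  "lform f0 f1 a z = f1 z - a * f0 z"

text \<open>This is f0^2 times the derivative of f1 / f0, so the denominator is the first
  argument.\<close>

definition wronskian :: "(complex \<Rightarrow> complex) \<Rightarrow> (complex \<Rightarrow> complex) \<Rightarrow> complex \<Rightarrow> complex" where
  "wronskian f0 f1 z = deriv f1 z * f0 z - f1 z * deriv f0 z"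

lemma lform_holomorphic [holomorphic_intros]:
  "\<lbrakk>f0 holomorphic_on A; f1 holomorphic_on A\<rbrakk> \<Longrightarrow> lform f0 f1 a holomorphic_on A"
  unfolding lform_def by (intro holomorphic_intros)

lemma wronskian_holomorphic [holomorphic_intros]:
  "\<lbrakk>entire f0; entire f1\<rbrakk> \<Longrightarrow> entire (wronskian f0 f1)"
  unfolding wronskian_def by (intro holomorphic_intros) auto

lemma deriv_lform:
  assumes "entire f0" "entire f1"
  shows "deriv (lform f0 f1 a) z = deriv f1 z - a * deriv f0 z"
proof -
  have "(lform f0 f1 a has_field_derivative deriv f1 z - a * deriv f0 z) (at z)"
    unfolding lform_def using assms
    by (auto intro!: derivative_eq_intros holomorphic_derivI[of _ UNIV])
  then show ?thesis by (rule DERIV_imp_deriv)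
qed

lemma log_deriv_lform:
  assumes "entire f0" "entire f1" "f0 z \<noteq> 0" "lform f0 f1 a z \<noteq> 0"
  shows "deriv (lform f0 f1 a) z / lform f0 f1 a z - deriv f0 z / f0 z = wronskian f0 f1 z / (lform f0 f1 a z * f0 z)"
proof -
  have "deriv (lform f0 f1 a) z * f0 z - deriv f0 z * lform f0 f1 a z = wronskian f0 f1 z"
    unfolding deriv_lform[OF assms(1,2)] by (simp add: lform_def wronskian_def algebra_simps)
  then show ?thesis using assms(3,4) by (simp add: diff_frac_eq mult.commute)
qed

lemma ln_norm_lform_le:
  assumes "f0 z \<noteq> 0 \<or> f1 z \<noteq> 0" "lform f0 f1 a z \<noteq> 0"
  shows "ln (norm (lform f0 f1 a z)) \<le> lnmax f0 f1 z + norm a"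
proof -
  define m where "m = max (norm (f0 z)) (norm (f1 z))"
  have m: "0 < m" using assms(1) by (simp add: m_def less_max_iff_disj)
  have "norm (lform f0 f1 a z) \<le> norm (f1 z) + norm (a * f0 z)"
    unfolding lform_def by (rule norm_triangle_ineq4)
  also have "\<dots> \<le> m + norm a * m"
    by (intro add_mono) (auto simp: m_def norm_mult intro: mult_left_mono)
  also have "\<dots> \<le> m * exp (norm a)"
    using mult_left_mono[OF exp_ge_add_one_self[of "norm a"], of m] m by (simp add: algebra_simps)
  finally have "ln (norm (lform f0 f1 a z)) \<le> ln (m * exp (norm a))"
    using assms(2) m by (intro ln_mono) auto
  also have "\<dots> = lnmax f0 f1 z + norm a"
    using m by (simp add: ln_mult lnmax_def m_def)
  finally show ?thesis .
qed

lemma ln_norm_le_lnmax: "f0 z \<noteq> 0 \<Longrightarrow> ln (norm (f0 z)) \<le> lnmax f0 f1 z"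
  unfolding lnmax_def by (intro ln_mono) (auto simp: less_max_iff_disj)

lemma continuous_on_lnmax:
  assumes "entire f0" "entire f1" "\<And>z. f0 z \<noteq> 0 \<or> f1 z \<noteq> 0"
  shows "continuous_on A (lnmax f0 f1)"
proof -
  have "continuous_on A f0" "continuous_on A f1"
    using assms(1,2) holomorphic_on_imp_continuous_on holomorphic_on_subset by blast+
  moreover have "max (norm (f0 z)) (norm (f1 z)) \<noteq> 0" for z
    using assms(3)[of z] by (metis less_max_iff_disj norm_eq_zero less_irrefl zero_less_norm_iff)
  ultimately show ?thesis unfolding lnmax_def by (intro continuous_intros) auto
qed

lemma radius_avoiding_zeros:
  assumes D: "entire D" "D w0 \<noteq> 0" and ab: "a < b"
  shows "\<exists>r. a \<le> r \<and> r \<le> b \<and> (\<forall>w\<in>sphere c r. D w \<noteq> 0)"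
proof -
  let ?Y = "(\<lambda>w. dist c w) ` {w \<in> cball c b. D w = 0}"
  have "finite ?Y" by (intro finite_imageI entire_finite_zeros[OF D]) auto
  then obtain r where r: "a \<le> r" "r \<le> b" "r \<notin> ?Y"
    using avoid_radius[of "{}" ?Y a b] ab by auto
  have "D w \<noteq> 0" if "w \<in> sphere c r" for w
  proof
    assume "D w = 0"
    then have "r \<in> ?Y" using that r(2) by (intro image_eqI[of _ _ w]) auto
    then show False using r(3) by simp
  qed
  then show ?thesis using r by blast
qed

text \<open>Moves the centre to a point \<open>c\<close> where no function vanishes. A common
  majorant \<open>U\<close> with bounded mean replaces the two mean conditions, because Jensen's
  formula bounds the means of the logarithms from below. At most 2 card P functions and 4 A in place
  of A give 300 (2) (16) = 9600.\<close>

lemma window: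
  fixes P :: "((complex \<Rightarrow> complex) \<times> (complex \<Rightarrow> complex)) set" and A R \<rho> :: real
  assumes P: "finite P" "P \<noteq> {}"
    and hol: "\<And>e1 e0. (e1, e0) \<in> P \<Longrightarrow> entire e1 \<and> entire e0"
    and cen: "\<And>e1 e0. (e1, e0) \<in> P \<Longrightarrow> e1 c \<noteq> 0 \<and> e0 c \<noteq> 0 \<and> - ln (norm (e1 c)) \<le> A \<and> - ln (norm (e0 c)) \<le> A"
    and U: "\<And>e1 e0. (e1, e0) \<in> P \<Longrightarrow> \<exists>U. continuous_on (sphere c R) U \<and> cmean c R U \<le> A \<and>
       (\<forall>w\<in>sphere c R. e1 w \<noteq> 0 \<and> e0 w \<noteq> 0 \<and> ln (norm (e1 w)) \<le> U w \<and> ln (norm (e0 w)) \<le> U w)"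
    and \<rho>: "0 < \<rho>" "\<rho> < R" "1 \<le> R" and A: "1 \<le> A" and D: "entire D" "D w0 \<noteq> 0"
  shows "\<exists>r. \<rho> \<le> r \<and> r < R \<and> (\<forall>w\<in>sphere c r. D w \<noteq> 0 \<and> (\<forall>(e1, e0)\<in>P. e1 w \<noteq> 0 \<and> e0 w \<noteq> 0 \<and>
     norm (deriv e1 w / e1 w - deriv e0 w / e0 w) \<le> 9600 * card P * A^2 * (R / (R - \<rho>))^3))"
proof -
  define sh where "sh e = (\<lambda>w::complex. e (c + w) :: complex)" for e
  have sh_hol: "entire (sh e)" if "entire e" for e
    unfolding sh_def
    by (rule holomorphic_on_compose[OF _ holomorphic_on_subset[OF that], of "\<lambda>w. c + w" UNIV, unfolded o_def])
       (auto intro!: holomorphic_intros)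
  have sh_deriv: "deriv (sh e) w = deriv e (c + w)" if "entire e" for e w
  proof -
    have "(e has_field_derivative deriv e (c + w)) (at (c + w))"
      using that by (intro holomorphic_derivI[of _ UNIV]) auto
    then have "(sh e has_field_derivative deriv e (c + w) * 1) (at w)"
      unfolding sh_def by (rule DERIV_chain2) (auto intro!: derivative_eq_intros)
    then show ?thesis by (simp add: DERIV_imp_deriv)
  qed
  define F where "F = sh ` (fst ` P \<union> snd ` P)"
  have FP: "\<exists>e. x = sh e \<and> entire e \<and> e c \<noteq> 0 \<and> - ln (norm (e c)) \<le> A \<and>
     (\<forall>w\<in>sphere c R. e w \<noteq> 0) \<and> cmean c R (\<lambda>w. ln (norm (e w))) \<le> A" if x: "x \<in> F" for x
  proof -
    obtain e1 e0 e where e: "(e1, e0) \<in> P" "x = sh e" "e = e1 \<or> e = e0" using x unfolding F_def by auto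
    obtain V where V: "continuous_on (sphere c R) V" "cmean c R V \<le> A"
       "\<forall>w\<in>sphere c R. e1 w \<noteq> 0 \<and> e0 w \<noteq> 0 \<and> ln (norm (e1 w)) \<le> V w \<and> ln (norm (e0 w)) \<le> V w"
      using U[OF e(1)] by blast
    have h: "entire e" using hol[OF e(1)] e(3) by auto
    have nz: "\<forall>w\<in>sphere c R. e w \<noteq> 0" using V(3) e(3) by auto
    have "cmean c R (\<lambda>w. ln (norm (e w))) \<le> cmean c R V"
      using \<rho> nz V h e(3) by (intro cmean_mono continuous_on_ln_norm_entire) auto
    then show ?thesis using e cen[OF e(1)] h nz V(2) by auto
  qed
  have r: "\<exists>r. \<rho> \<le> r \<and> r < R \<and> (\<forall>w. norm w = r \<longrightarrow> sh D w \<noteq> 0 \<and> (\<forall>e\<in>F. e w \<noteq> 0) \<and>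
     (\<forall>(e1, e0)\<in>map_prod sh sh ` P. norm (deriv e1 w / e1 w - deriv e0 w / e0 w) \<le> 300 * card F * (4 * A)^2 * (R / (R - \<rho>))^3))"
  proof (rule window_center_0)
    show "finite F" "F \<noteq> {}" using P by (auto simp: F_def)
    show "entire e \<and> e 0 \<noteq> 0" if "e \<in> F" for e
      using FP[OF that] sh_hol by (auto simp: sh_def)
    show "e w \<noteq> 0" if "e \<in> F" "norm w = R" for e w
      using FP[OF that(1)] that(2) by (auto simp: sh_def dist_norm)
    show "cmean 0 R (\<lambda>w. ln (norm (e w))) - ln (norm (e 0)) \<le> 4 * A" if "e \<in> F" for e
      using FP[OF that] A by (subst (asm) cmean_shift) (auto simp: sh_def)
    show "map_prod sh sh ` P \<subseteq> F \<times> F" by (force simp: F_def)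
    show "cmean 0 R (\<lambda>w. \<bar>ln (norm (x1 w)) - ln (norm (x0 w))\<bar>) \<le> 4 * A"
      if x: "(x1, x0) \<in> map_prod sh sh ` P" for x1 x0
    proof -
      obtain e1 e0 where e: "(e1, e0) \<in> P" "x1 = sh e1" "x0 = sh e0" using x by auto
      obtain V where V: "continuous_on (sphere c R) V" "cmean c R V \<le> A"
         "\<forall>w\<in>sphere c R. e1 w \<noteq> 0 \<and> e0 w \<noteq> 0 \<and> ln (norm (e1 w)) \<le> V w \<and> ln (norm (e0 w)) \<le> V w"
        using U[OF e(1)] by blast
      have h: "entire e1" "entire e0" using hol[OF e(1)] by auto
      have c1: "continuous_on (sphere c R) (\<lambda>w. ln (norm (e1 w)))" "continuous_on (sphere c R) (\<lambda>w. ln (norm (e0 w)))"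
        using h V(3) by (auto intro!: continuous_on_ln_norm_entire)
      have R0: "0 \<le> R" "0 < R" using \<rho> by auto
      have "cmean 0 R (\<lambda>w. \<bar>ln (norm (x1 w)) - ln (norm (x0 w))\<bar>) = cmean c R (\<lambda>w. \<bar>ln (norm (e1 w)) - ln (norm (e0 w))\<bar>)"
        unfolding e sh_def by (rule cmean_shift[symmetric])
      \<comment> \<open>Two numbers x, y below V satisfy |x - y| \<le> 2 V - x - y.\<close>
      also have "\<dots> \<le> cmean c R (\<lambda>w. (2 * V w - ln (norm (e1 w))) - ln (norm (e0 w)))"
      proof (rule cmean_mono[OF R0(1)])
        fix w assume "w \<in> sphere c R"
        then have "ln (norm (e1 w)) \<le> V w" "ln (norm (e0 w)) \<le> V w" using V(3) by auto
        then show "\<bar>ln (norm (e1 w)) - ln (norm (e0 w))\<bar> \<le> (2 * V w - ln (norm (e1 w))) - ln (norm (e0 w))" by linarith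
      qed (intro continuous_intros c1 V(1))+
      also have "\<dots> = (2 * cmean c R V - cmean c R (\<lambda>w. ln (norm (e1 w)))) - cmean c R (\<lambda>w. ln (norm (e0 w)))"
        using R0 c1 V(1) by (simp add: cmean_diff cmean_cmult continuous_on_diff continuous_on_mult_left)
      also have "\<dots> \<le> 4 * A"
        using cmean_ln_norm_ge(1)[OF h(1) R0(2), of c] cmean_ln_norm_ge(1)[OF h(2) R0(2), of c] cen[OF e(1)] V(2,3) by auto
      finally show ?thesis .
    qed
    show "entire (sh D)" using D by (intro sh_hol)
    show "sh D (w0 - c) \<noteq> 0" using D by (simp add: sh_def)
  qed (use \<rho> A in auto)
  have cF: "card F \<le> 2 * card P"
  proof -
    have "card F \<le> card (fst ` P \<union> snd ` P)" unfolding F_def using P by (intro card_image_le) auto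
    also have "\<dots> \<le> card (fst ` P) + card (snd ` P)" by (rule card_Un_le)
    also have "\<dots> \<le> card P + card P" using P by (intro add_mono card_image_le) auto
    finally show ?thesis by simp
  qed
  have "300 * real (card F) * (4 * A)^2 * (R / (R - \<rho>))^3 \<le> 300 * (2 * real (card P)) * (4 * A)^2 * (R / (R - \<rho>))^3"
    using cF \<rho> by (intro mult_right_mono mult_left_mono) auto
  also have "\<dots> = 9600 * card P * A^2 * (R / (R - \<rho>))^3" by (simp add: power_mult_distrib)
  finally have bd: "300 * real (card F) * (4 * A)^2 * (R / (R - \<rho>))^3 \<le> 9600 * card P * A^2 * (R / (R - \<rho>))^3" .
  obtain r where r: "\<rho> \<le> r" "r < R"
    and r3: "\<And>w. norm w = r \<Longrightarrow> sh D w \<noteq> 0 \<and> (\<forall>e\<in>F. e w \<noteq> 0) \<and>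
     (\<forall>(e1, e0)\<in>map_prod sh sh ` P. norm (deriv e1 w / e1 w - deriv e0 w / e0 w) \<le> 300 * card F * (4 * A)^2 * (R / (R - \<rho>))^3)"
    using r by blast
  show ?thesis
  proof (intro exI[of _ r] conjI ballI)
    fix w assume w: "w \<in> sphere c r"
    have nw: "norm (w - c) = r" using w by (simp add: dist_norm norm_minus_commute)
    note r3' = r3[OF nw]
    show "D w \<noteq> 0" using r3' by (simp add: sh_def)
    fix x assume "x \<in> P"
    then obtain e1 e0 where x: "x = (e1, e0)" "(e1, e0) \<in> P" by (cases x) auto
    have "sh e1 \<in> F" "sh e0 \<in> F" using x(2) by (force simp: F_def)+
    then have "e1 w \<noteq> 0" "e0 w \<noteq> 0" using r3' by (auto simp: sh_def)
    moreover have "(sh e1, sh e0) \<in> map_prod sh sh ` P" using x(2) by force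
    from bspec[OF conjunct2[OF conjunct2[OF r3']] this]
    have "norm (deriv (sh e1) (w - c) / sh e1 (w - c) - deriv (sh e0) (w - c) / sh e0 (w - c)) \<le>
        300 * card F * (4 * A)^2 * (R / (R - \<rho>))^3" by (simp only: prod.case)
    then have "norm (deriv e1 w / e1 w - deriv e0 w / e0 w) \<le> 300 * card F * (4 * A)^2 * (R / (R - \<rho>))^3"
      using hol[OF x(2)] by (simp add: sh_deriv) (simp add: sh_def)
    ultimately show "case x of (e1, e0) \<Rightarrow> e1 w \<noteq> 0 \<and> e0 w \<noteq> 0 \<and>
       norm (deriv e1 w / e1 w - deriv e0 w / e0 w) \<le> 9600 * card P * A^2 * (R / (R - \<rho>))^3"
      using bd x by simp
  qed (use r in auto)
qed

section \<open>Unbounded characteristic and the comparison on two nested windows\<close>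

lemma entire_common_nonzero:
  assumes "finite Z" "\<And>e. e \<in> Z \<Longrightarrow> entire e \<and> (\<exists>w. e w \<noteq> 0)"
  shows "\<exists>c::complex. \<forall>e\<in>Z. e c \<noteq> (0::complex)"
proof -
  have "finite (\<Union>e\<in>Z. {w \<in> cball 0 1. e w = 0})"
    by (intro finite_UN_I assms(1)) (metis assms(2) entire_finite_zeros compact_cball)
  moreover have "infinite (cball (0::complex) 1)" using uncountable_cball[of 1 "0::complex"] countable_finite by auto
  ultimately have "infinite (cball 0 1 - (\<Union>e\<in>Z. {w \<in> cball 0 1. e w = 0}))" by (rule Diff_infinite_finite)
  then have "cball 0 1 - (\<Union>e\<in>Z. {w \<in> cball 0 1. e w = 0}) \<noteq> {}" by (rule infinite_imp_nonempty)
  then obtain c where c: "c \<in> cball 0 1" "c \<notin> (\<Union>e\<in>Z. {w \<in> cball 0 1. e w = 0})"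
    unfolding ex_in_conv[symmetric] Diff_iff by (elim exE conjE)
  show ?thesis
  proof (intro exI[of _ c] ballI notI)
    fix e assume "e \<in> Z" "e c = 0"
    have "c \<in> (\<Union>e\<in>Z. {w \<in> cball 0 1. e w = 0})"
      by (rule UN_I[OF \<open>e \<in> Z\<close>]) (simp add: c(1)[simplified] \<open>e c = 0\<close>)
    with c(2) show False by (rule notE)
  qed
qed

lemma ln_less_linear:
  fixes a b \<kappa> :: real
  assumes "0 < \<kappa>" "0 \<le> b"
  shows "\<exists>M\<ge>1. \<forall>t\<ge>M. a + b * ln t < \<kappa> * t"
proof -
  define s where "s = max 1 ((\<bar>a\<bar> + 2 * b + 1) / \<kappa>)"
  have s: "1 \<le> s" "\<bar>a\<bar> + 2 * b + 1 \<le> \<kappa> * s" using assms(1)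
    by (auto simp: s_def max_def field_simps)
  show ?thesis
  proof (intro exI[of _ "s^2"] conjI allI impI)
    show "1 \<le> s^2" using s(1) by simp
    fix t assume "s^2 \<le> t"
    then have st: "s \<le> sqrt t" using s(1) by (simp add: real_le_rsqrt)
    have "0 < s^2" using s(1) by simp
    then have t1: "1 \<le> sqrt t" "0 < t" using st s(1) \<open>s^2 \<le> t\<close> by linarith+
    have "ln t = 2 * ln (sqrt t)" using t1 by (simp add: ln_sqrt)
    also have "\<dots> \<le> 2 * sqrt t" using ln_le_minus_one[of "sqrt t"] t1 by simp
    finally have "a + b * ln t \<le> a + b * (2 * sqrt t)" using assms(2) by (intro add_left_mono mult_left_mono) auto
    also have "\<dots> < (\<bar>a\<bar> + 2 * b + 1) * sqrt t"
    proof -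
      have "\<bar>a\<bar> * 1 \<le> \<bar>a\<bar> * sqrt t" using t1 by (intro mult_left_mono) auto
      moreover have "(\<bar>a\<bar> + 2 * b + 1) * sqrt t = \<bar>a\<bar> * sqrt t + b * (2 * sqrt t) + sqrt t"
        by (simp add: algebra_simps)
      ultimately show ?thesis using t1 abs_ge_self[of a] by linarith
    qed
    also have "\<dots> \<le> (\<kappa> * s) * sqrt t" using s(2) t1 by (intro mult_right_mono) auto
    also have "\<dots> \<le> (\<kappa> * sqrt t) * sqrt t" using st assms(1) t1 by (intro mult_right_mono mult_left_mono) auto
    also have "\<dots> = \<kappa> * t" using t1 by simp
    finally show "a + b * ln t < \<kappa> * t" .
  qed
qed

lemma lnmax_cmean_mono:
  assumes "entire f0" "entire f1" "\<And>z. f0 z \<noteq> 0 \<or> f1 z \<noteq> 0" "0 < r" "r \<le> R"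
  shows "cmean c r (lnmax f0 f1) \<le> cmean c R (lnmax f0 f1)"
proof -
  have e: "lnmax f0 f1 = (\<lambda>z. ln (max (norm (f0 z)) (norm (f1 z))))" by (rule ext) (simp add: lnmax_def)
  show ?thesis unfolding e by (rule cmean_ln_max_mono[OF assms])
qed

text \<open>A combination \<open>L\<close> of \<open>f0\<close> and \<open>f1\<close> vanishes at
  \<open>z1\<close> but not at \<open>c\<close>. Its zero \<open>z1\<close> alone contributes ln (x
  / |z1 - c|) to Jensen's formula, and \<open>ln \<bar>L\<bar>\<close> exceeds \<open>lnmax\<close>
  by at most a constant.\<close>

lemma lnmax_cmean_unbounded:
  assumes hol: "entire f0" "entire f1" and nz: "\<And>z. f0 z \<noteq> 0 \<or> f1 z \<noteq> 0"
    and Lc: "f0 z1 * f1 c \<noteq> f1 z1 * f0 c"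
  shows "\<exists>x\<ge>1. M \<le> cmean c x (lnmax f0 f1)"
proof -
  define L where "L w = f0 z1 * f1 w - f1 z1 * f0 w" for w
  have L: "entire L" "L c \<noteq> 0" "L z1 = 0"
    using Lc unfolding L_def by (auto intro!: holomorphic_intros hol)
  define k where "k = norm (f0 z1) + norm (f1 z1)"
  have k: "0 < k" using nz[of z1] norm_ge_zero[of "f0 z1"] norm_ge_zero[of "f1 z1"]
    unfolding k_def by (metis add_nonneg_eq_0_iff add_nonneg_nonneg less_eq_real_def norm_eq_zero)
  have b: "0 < norm (z1 - c)" using L by auto
  define M' where "M' = M + ln k - ln (norm (L c))"
  define x0 where "x0 = max 1 (max (norm (z1 - c) + 1) (norm (z1 - c) * exp M'))"
  obtain x where x: "x0 \<le> x" "x \<le> x0 + 1" "\<forall>w\<in>sphere c x. L w \<noteq> 0"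
    using radius_avoiding_zeros[OF L(1,2), of x0 "x0 + 1" c] by auto
  have x1: "1 \<le> x" "norm (z1 - c) < x" "norm (z1 - c) * exp M' \<le> x" using x(1) by (auto simp: x0_def)
  have "exp M' \<le> x / norm (z1 - c)" using x1 b by (simp add: field_simps)
  then have "M' \<le> ln (x / norm (z1 - c))" using x1 b by (subst ln_ge_iff) auto
  then have "ln (norm (L c)) + M' \<le> cmean c x (\<lambda>w. ln (norm (L w)))"
    using cmean_ln_norm_ge(2)[OF L(1), of x c z1] x x1 L by auto
  also have "\<dots> \<le> cmean c x (\<lambda>w. lnmax f0 f1 w + ln k)"
  proof (rule cmean_mono)
    show "continuous_on (sphere c x) (\<lambda>w. ln (norm (L w)))" using x L(1) by (intro continuous_on_ln_norm_entire) auto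
    show "continuous_on (sphere c x) (\<lambda>w. lnmax f0 f1 w + ln k)"
      by (intro continuous_intros continuous_on_lnmax hol nz)
    fix w assume w: "w \<in> sphere c x"
    define m where "m = max (norm (f0 w)) (norm (f1 w))"
    have m: "0 < m" using nz[of w] by (simp add: m_def less_max_iff_disj)
    have "norm (L w) \<le> norm (f0 z1) * norm (f1 w) + norm (f1 z1) * norm (f0 w)"
      unfolding L_def norm_mult[symmetric] by (rule norm_triangle_ineq4)
    also have "\<dots> \<le> norm (f0 z1) * m + norm (f1 z1) * m"
      by (intro add_mono mult_left_mono) (auto simp: m_def)
    finally have "norm (L w) \<le> m * k" by (simp add: k_def algebra_simps)
    then have "ln (norm (L w)) \<le> ln (m * k)" using x w by (intro ln_mono) auto
    then show "ln (norm (L w)) \<le> lnmax f0 f1 w + ln k" using m k by (simp add: ln_mult lnmax_def m_def)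
  qed (use x1 in auto)
  also have "\<dots> = cmean c x (lnmax f0 f1) + ln k"
    using x1 by (subst cmean_add) (auto intro!: continuous_on_lnmax hol nz)
  finally have "M \<le> cmean c x (lnmax f0 f1)" by (simp add: M'_def)
  then show ?thesis using x1(1) by blast
qed

text \<open>
  The logarithmic derivative estimate is applied on two nested windows: on the outer one to the
  pairs of linear forms, which bounds the Wronskians and hence \<open>e1\<close> and \<open>e0\<close> on a circle; this
  circle then bounds the inner window, where the estimate is applied to \<open>e1\<close> and \<open>e0\<close> as well.
\<close>

lemma nevanlinna_contradiction:
  fixes S :: "complex set" and \<kappa> d C :: real
  assumes hol: "entire f0" "entire f1" "entire g0" "entire g1"
      "entire e1" "entire e0" "entire Y"
    and nf: "\<And>z. f0 z \<noteq> 0 \<or> f1 z \<noteq> 0" and ng: "\<And>z. g0 z \<noteq> 0 \<or> g1 z \<noteq> 0"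
    and S: "finite S" "S \<noteq> {}"
    and nc: "f0 z1 * f1 z2 \<noteq> f1 z1 * f0 z2"
    and nz: "f0 w1 \<noteq> 0" "g0 w2 \<noteq> 0" "e1 w3 \<noteq> 0" "e0 w4 \<noteq> 0" "Y w5 \<noteq> 0"
      "\<And>a. a \<in> S \<Longrightarrow> \<exists>w. lform f0 f1 a w \<noteq> 0" "\<And>a. a \<in> S \<Longrightarrow> \<exists>w. lform g0 g1 a w \<noteq> 0"
    and pos: "0 < \<kappa>" "0 \<le> d" "0 \<le> C"
    and Be: "\<And>z B. \<lbrakk>1 \<le> B; f0 z \<noteq> 0; g0 z \<noteq> 0; e1 z \<noteq> 0; e0 z \<noteq> 0;
       \<And>a. a \<in> S \<Longrightarrow> lform f0 f1 a z \<noteq> 0 \<and> norm (wronskian f0 f1 z) \<le> B * norm (lform f0 f1 a z * f0 z);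
       \<And>a. a \<in> S \<Longrightarrow> lform g0 g1 a z \<noteq> 0 \<and> norm (wronskian g0 g1 z) \<le> B * norm (lform g0 g1 a z * g0 z)\<rbrakk> \<Longrightarrow>
       ln (norm (e1 z)) \<le> d * (lnmax f0 f1 z + lnmax g0 g1 z) + C + C * ln B \<and>
       ln (norm (e0 z)) \<le> d * (lnmax f0 f1 z + lnmax g0 g1 z) + C + C * ln B"
    and BY: "\<And>z B. \<lbrakk>1 \<le> B; f0 z \<noteq> 0; g0 z \<noteq> 0; e1 z \<noteq> 0; e0 z \<noteq> 0; Y z \<noteq> 0;
       \<And>a. a \<in> S \<Longrightarrow> lform f0 f1 a z \<noteq> 0 \<and> norm (wronskian f0 f1 z) \<le> B * norm (lform f0 f1 a z * f0 z);
       \<And>a. a \<in> S \<Longrightarrow> lform g0 g1 a z \<noteq> 0 \<and> norm (wronskian g0 g1 z) \<le> B * norm (lform g0 g1 a z * g0 z);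
       norm (deriv e1 z / e1 z - deriv e0 z / e0 z) \<le> B\<rbrakk> \<Longrightarrow>
       \<kappa> * (lnmax f0 f1 z + lnmax g0 g1 z) + ln (norm (Y z)) \<le> C + C * ln B"
  shows False
proof -
  \<comment> \<open>Included in \<open>Z\<close> so that the common centre \<open>c\<close> also
    satisfies the condition under which the characteristic of f is unbounded.\<close>
  define L where "L w = f0 z1 * f1 w - f1 z1 * f0 w" for w
  define Z where "Z = {f0, g0, e1, e0, Y, L} \<union> lform f0 f1 ` S \<union> lform g0 g1 ` S"
  have Lhol: "entire L" unfolding L_def by (intro holomorphic_intros hol)
  have Lnz: "L z2 \<noteq> 0" using nc by (simp add: L_def)
  have fZ: "finite Z" using S by (simp add: Z_def)
  have Zhol: "entire e" if "e \<in> Z" for e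
    using that hol Lhol unfolding Z_def by (auto intro!: holomorphic_intros)
  have "\<exists>w. e w \<noteq> 0" if "e \<in> Z" for e
    using that nz Lnz unfolding Z_def by blast
  then obtain c where c: "\<And>e. e \<in> Z \<Longrightarrow> e c \<noteq> 0"
    using entire_common_nonzero[OF fZ] Zhol by metis
  define D where "D w = (\<Prod>e\<in>Z. e w)" for w
  have Dhol: "entire D" unfolding D_def using Zhol by (intro holomorphic_on_prod) auto
  have Dc: "D c \<noteq> 0" using c fZ by (simp add: D_def)
  have DZ: "e w \<noteq> 0" if "D w \<noteq> 0" "e \<in> Z" for e w using that fZ by (auto simp: D_def)
  define uf where "uf = lnmax f0 f1"
  define ug where "ug = lnmax g0 g1"
  have cuf: "continuous_on A uf" and cug: "continuous_on A ug" for A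
    unfolding uf_def ug_def by (intro continuous_on_lnmax hol nf ng)+
  define Tf where "Tf x = cmean c x uf" for x
  define Tg where "Tg x = cmean c x ug" for x
  define T where "T x = Tf x + Tg x" for x
  have Tfm: "Tf x \<le> Tf y" and Tgm: "Tg x \<le> Tg y" if "0 < x" "x \<le> y" for x y
    unfolding Tf_def Tg_def uf_def ug_def using that by (auto intro!: lnmax_cmean_mono hol nf ng)
  have Tm: "T x \<le> T y" if "0 < x" "x \<le> y" for x y
    unfolding T_def using Tfm[OF that] Tgm[OF that] by simp
  have "f0 z1 * f1 c \<noteq> f1 z1 * f0 c" using c[of L] by (simp add: Z_def L_def)
  then have unbf: "\<exists>x\<ge>1. M \<le> Tf x" for M
    unfolding Tf_def uf_def by (intro lnmax_cmean_unbounded hol nf)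
  have unb: "\<exists>x\<ge>1. M \<le> T x" for M
  proof -
    obtain x where "1 \<le> x" "M - Tg 1 \<le> Tf x" using unbf by blast
    then show ?thesis using Tgm[of 1 x] by (intro exI[of _ x]) (auto simp: T_def)
  qed
  \<comment> \<open>\<open>Tf\<close> and \<open>Tg\<close> may be negative. By monotonicity neither
    falls below its value at 1, so each of them is at most \<open>T\<close> plus
    \<open>m\<close>.\<close>
  define m where "m = \<bar>Tf 1\<bar> + \<bar>Tg 1\<bar>"
  have Tfg: "Tf x \<le> T x + m" "Tg x \<le> T x + m" if "1 \<le> x" for x
    using Tfm[of 1 x] Tgm[of 1 x] that by (auto simp: T_def m_def)
  define A0 where "A0 = (\<Sum>e\<in>Z. \<bar>ln (norm (e c))\<bar>)"
  have A0: "- ln (norm (e c)) \<le> A0" if "e \<in> Z" for e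
    using member_le_sum[of e Z "\<lambda>e. \<bar>ln (norm (e c))\<bar>"] fZ that by (auto simp: A0_def)
  have A00: "0 \<le> A0" by (simp add: A0_def sum_nonneg)
  define K0 where "K0 = (\<Sum>a\<in>S. norm a)"
  have K0: "norm a \<le> K0" if "a \<in> S" for a unfolding K0_def using S that by (intro member_le_sum) auto
  have K00: "0 \<le> K0" by (simp add: K0_def sum_nonneg)
  define K1 where "K1 = 3 + m + K0 + A0"
  have K1: "3 \<le> K1" using K00 A00 by (simp add: K1_def m_def)
  define P1 where "P1 = (\<lambda>a. (lform f0 f1 a, f0)) ` S \<union> (\<lambda>a. (lform g0 g1 a, g0)) ` S"
  define P2 where "P2 = insert (e1, e0) P1"
  have fP: "finite P1" "P1 \<noteq> {}" "finite P2" "P2 \<noteq> {}" using S by (auto simp: P1_def P2_def)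
  have PZ: "x1 \<in> Z \<and> x0 \<in> Z" if "(x1, x0) \<in> P2" for x1 x0 using that by (auto simp: P1_def P2_def Z_def)
  have cP: "1 \<le> real (card P1)" "1 \<le> real (card P2)" using fP by (simp_all add: Suc_leI card_gt_0_iff)
  define Kb1 where "Kb1 = 9600 * card P1 * K1^2 * 512"
  define K3 where "K3 = 2 * d + C + C * Kb1 + K1"
  define Kb2 where "Kb2 = 9600 * card P2 * K3^2 * 512"
  have "1 * 1 \<le> real (card P1) * K1^2" using cP K1 by (intro mult_mono) auto
  then have Kb1: "1 \<le> Kb1" by (simp add: Kb1_def)
  have "0 \<le> C * Kb1" using pos Kb1 by simp
  then have K3: "K1 \<le> K3" "1 \<le> K3" using pos K1 unfolding K3_def by linarith+
  have "1 * 1 \<le> real (card P2) * K3^2" using cP K3 by (intro mult_mono) auto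
  then have Kb2: "1 \<le> Kb2" by (simp add: Kb2_def)
  obtain M where M: "1 \<le> M" "\<And>t. M \<le> t \<Longrightarrow> (A0 + C + C * ln Kb2) + (13 * C) * ln t < \<kappa> * t"
    using ln_less_linear[of \<kappa> "13 * C" "A0 + C + C * ln Kb2"] pos by auto
  obtain \<rho> where \<rho>: "1 \<le> \<rho>" "M \<le> T \<rho>" "T (\<rho> * (1 + 1 / T \<rho>)) \<le> 2 * T \<rho>"
    using borel_growth[of T M] Tm unb by blast
  define t where "t = T \<rho>"
  have t: "1 \<le> t" "M \<le> t" using \<rho> M by (auto simp: t_def)
  \<comment> \<open>The interval on which Borel's lemma bounds \<open>T\<close> by 2 t is
    [\<rho>, \<rho> + 4 h]. It accommodates \<rho> \<le> r < r2 < R1 with r2 \<ge> \<rho> + h and R1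
    \<ge> \<rho> + 2 h, so both windows have width at least h and R / (R - \<rho>) is at most 8 t
    for each.\<close>
  define h where "h = \<rho> / (4 * t)"
  have h: "0 < h" "4 * h \<le> \<rho>" using \<rho> t by (auto simp: h_def field_simps)
  have h4: "\<rho> * (1 + 1 / T \<rho>) = \<rho> + 4 * h" using t by (simp add: h_def t_def[symmetric] field_simps)
  have T2: "T x \<le> 2 * t" if "1 \<le> x" "x \<le> \<rho> + 4 * h" for x
    using Tm[of x "\<rho> + 4 * h"] that \<rho>(3) unfolding h4 t_def by auto
  have ratio: "(x / (x - y))^3 \<le> 512 * t^3" if "h \<le> x - y" "x \<le> 2 * \<rho>" "1 \<le> x" for x y
  proof -
    have "x / (x - y) \<le> (2 * \<rho>) / h" using that h \<rho> by (intro frac_le) auto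
    also have "\<dots> = 8 * t" using h \<rho> t by (simp add: h_def)
    finally have "(x / (x - y))^3 \<le> (8 * t)^3" using that h by (intro power_mono) auto
    then show ?thesis by (simp add: power_mult_distrib)
  qed
  have U1: "\<exists>U. continuous_on (sphere c R) U \<and> cmean c R U \<le> A \<and>
       (\<forall>w\<in>sphere c R. x1 w \<noteq> 0 \<and> x0 w \<noteq> 0 \<and> ln (norm (x1 w)) \<le> U w \<and> ln (norm (x0 w)) \<le> U w)"
    if x: "(x1, x0) \<in> P1" and R: "1 \<le> R" "R \<le> \<rho> + 4 * h" "\<And>w. w \<in> sphere c R \<Longrightarrow> D w \<noteq> 0" and A: "K1 * t \<le> A" for x1 x0 R A
  proof -
    have xz: "x1 w \<noteq> 0 \<and> x0 w \<noteq> 0" if "w \<in> sphere c R" for w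
      using DZ[OF R(3)[OF that]] PZ[of x1 x0] x by (auto simp: P2_def)
    have "(m + K0) * 1 \<le> (m + K0) * t" using t K00 by (intro mult_left_mono) (auto simp: m_def)
    then have "2 * t + m + K0 \<le> 2 * t + (m + K0) * t" by (simp add: algebra_simps)
    also have "\<dots> \<le> K1 * t" using t A00 by (simp add: K1_def algebra_simps)
    finally have bd: "2 * t + m + K0 \<le> A" using A by simp
    consider (f) a where "a \<in> S" "x1 = lform f0 f1 a" "x0 = f0" | (g) a where "a \<in> S" "x1 = lform g0 g1 a" "x0 = g0"
      using x by (auto simp: P1_def)
    then show ?thesis
    proof cases
      case f
      have "cmean c R (\<lambda>w. uf w + K0) = Tf R + K0" using R by (simp add: cmean_add cuf Tf_def)
      moreover have "ln (norm (x1 w)) \<le> uf w + K0 \<and> ln (norm (x0 w)) \<le> uf w + K0" if "w \<in> sphere c R" for w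
        using xz[OF that] ln_norm_lform_le[of f0 w f1 a] nf[of w] K0[OF f(1)] ln_norm_le_lnmax[of f0 w f1] K00
        unfolding f uf_def by auto
      ultimately show ?thesis using bd xz Tfg(1)[OF R(1)] T2[OF R(1,2)]
        by (intro exI[of _ "\<lambda>w. uf w + K0"]) (auto intro!: continuous_intros cuf)
    next
      case g
      have "cmean c R (\<lambda>w. ug w + K0) = Tg R + K0" using R by (simp add: cmean_add cug Tg_def)
      moreover have "ln (norm (x1 w)) \<le> ug w + K0 \<and> ln (norm (x0 w)) \<le> ug w + K0" if "w \<in> sphere c R" for w
        using xz[OF that] ln_norm_lform_le[of g0 w g1 a] ng[of w] K0[OF g(1)] ln_norm_le_lnmax[of g0 w g1] K00
        unfolding g ug_def by auto
      ultimately show ?thesis using bd xz Tfg(2)[OF R(1)] T2[OF R(1,2)]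
        by (intro exI[of _ "\<lambda>w. ug w + K0"]) (auto intro!: continuous_intros cug)
    qed
  qed
  have wr: "(\<forall>a\<in>S. lform f0 f1 a w \<noteq> 0 \<and> norm (wronskian f0 f1 w) \<le> B * norm (lform f0 f1 a w * f0 w)) \<and>
       (\<forall>a\<in>S. lform g0 g1 a w \<noteq> 0 \<and> norm (wronskian g0 g1 w) \<le> B * norm (lform g0 g1 a w * g0 w))"
    if Dw: "D w \<noteq> 0" and B: "\<And>x1 x0. (x1, x0) \<in> P1 \<Longrightarrow> norm (deriv x1 w / x1 w - deriv x0 w / x0 w) \<le> B" for w B
  proof (intro conjI ballI)
    fix a assume a: "a \<in> S"
    have z: "lform f0 f1 a \<in> Z" "lform g0 g1 a \<in> Z" "f0 \<in> Z" "g0 \<in> Z" using a by (auto simp: Z_def)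
    show n1: "lform f0 f1 a w \<noteq> 0" and n2: "lform g0 g1 a w \<noteq> 0" using DZ[OF Dw] z by auto
    have n3: "f0 w \<noteq> 0" "g0 w \<noteq> 0" using DZ[OF Dw] z by auto
    have "norm (wronskian f0 f1 w / (lform f0 f1 a w * f0 w)) \<le> B"
      using B[of "lform f0 f1 a" f0] a log_deriv_lform[OF hol(1,2) n3(1) n1] by (auto simp: P1_def)
    then show "norm (wronskian f0 f1 w) \<le> B * norm (lform f0 f1 a w * f0 w)"
      using n1 n3 by (simp add: norm_divide pos_divide_le_eq norm_mult)
    have "norm (wronskian g0 g1 w / (lform g0 g1 a w * g0 w)) \<le> B"
      using B[of "lform g0 g1 a" g0] a log_deriv_lform[OF hol(3,4) n3(2) n2] by (auto simp: P1_def)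
    then show "norm (wronskian g0 g1 w) \<le> B * norm (lform g0 g1 a w * g0 w)"
      using n2 n3 by (simp add: norm_divide pos_divide_le_eq norm_mult)
  qed
  have cen: "x1 c \<noteq> 0 \<and> x0 c \<noteq> 0 \<and> - ln (norm (x1 c)) \<le> A \<and> - ln (norm (x0 c)) \<le> A"
    if "(x1, x0) \<in> P2" "K1 * t \<le> A" for x1 x0 A
  proof -
    have "A0 * 1 \<le> K1 * t" using t A00 K00 by (intro mult_mono) (auto simp: K1_def m_def)
    moreover have "x1 \<in> Z" "x0 \<in> Z" using PZ[OF that(1)] by auto
    ultimately show ?thesis using c[of x1] c[of x0] A0[of x1] A0[of x0] that(2) by auto
  qed
  obtain R1 where R1: "\<rho> + 2 * h \<le> R1" "R1 \<le> \<rho> + 4 * h" "\<forall>w\<in>sphere c R1. D w \<noteq> 0"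
    using radius_avoiding_zeros[OF Dhol Dc, of "\<rho> + 2 * h" "\<rho> + 4 * h" c] h by auto
  have K1t: "1 \<le> K1 * t" using mult_mono[of 1 K1 1 t] K1 t by auto
  define B1 where "B1 = Kb1 * t^5"
  have B1: "1 \<le> B1" unfolding B1_def using mult_mono[of 1 Kb1 1 "t^5"] Kb1 t by auto
  have "\<exists>r. \<rho> + h \<le> r \<and> r < R1 \<and> (\<forall>w\<in>sphere c r. D w \<noteq> 0 \<and> (\<forall>(x1, x0)\<in>P1. x1 w \<noteq> 0 \<and> x0 w \<noteq> 0 \<and>
     norm (deriv x1 w / x1 w - deriv x0 w / x0 w) \<le> 9600 * card P1 * (K1 * t)^2 * (R1 / (R1 - (\<rho> + h)))^3))"
  proof (rule window)
    show "entire x1 \<and> entire x0" if "(x1, x0) \<in> P1" for x1 x0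
      using that PZ Zhol by (auto simp: P2_def)
    show "x1 c \<noteq> 0 \<and> x0 c \<noteq> 0 \<and> - ln (norm (x1 c)) \<le> K1 * t \<and> - ln (norm (x0 c)) \<le> K1 * t" if "(x1, x0) \<in> P1" for x1 x0
      using that by (intro cen) (auto simp: P2_def)
    show "\<exists>U. continuous_on (sphere c R1) U \<and> cmean c R1 U \<le> K1 * t \<and>
       (\<forall>w\<in>sphere c R1. x1 w \<noteq> 0 \<and> x0 w \<noteq> 0 \<and> ln (norm (x1 w)) \<le> U w \<and> ln (norm (x0 w)) \<le> U w)" if "(x1, x0) \<in> P1" for x1 x0
      using that R1 \<rho> h by (intro U1) auto
  qed (use fP R1 \<rho> h K1t Dhol Dc in auto)
  then obtain r2 where r2: "\<rho> + h \<le> r2" "r2 < R1" "\<And>w. w \<in> sphere c r2 \<Longrightarrow> D w \<noteq> 0"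
    and r2P: "\<And>w x1 x0. \<lbrakk>w \<in> sphere c r2; (x1, x0) \<in> P1\<rbrakk> \<Longrightarrow>
       norm (deriv x1 w / x1 w - deriv x0 w / x0 w) \<le> 9600 * card P1 * (K1 * t)^2 * (R1 / (R1 - (\<rho> + h)))^3"
    by (smt (verit, best) case_prodD)
  have r2B: "norm (deriv x1 w / x1 w - deriv x0 w / x0 w) \<le> B1" if "w \<in> sphere c r2" "(x1, x0) \<in> P1" for w x1 x0
  proof -
    have "9600 * card P1 * (K1 * t)^2 * (R1 / (R1 - (\<rho> + h)))^3 \<le> 9600 * card P1 * (K1 * t)^2 * (512 * t^3)"
      using R1 \<rho> h by (intro mult_left_mono ratio) auto
    also have "\<dots> = Kb1 * (t^2 * t^3)" by (simp add: Kb1_def power_mult_distrib)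
    also have "\<dots> = B1" by (simp add: B1_def flip: power_add)
    finally show ?thesis using r2P[OF that] by linarith
  qed
  have r21: "1 \<le> r2" "r2 \<le> \<rho> + 4 * h" using r2 R1 \<rho> h by auto
  define A2 where "A2 = K3 * t^5"
  have tt: "t \<le> t^5" "1 \<le> t^5" using t by (auto intro: self_le_power one_le_power)
  have A2: "K1 * t \<le> A2" "1 \<le> A2" unfolding A2_def using K3 K1 t tt mult_mono[of 1 K3 1 "t^5"] by (auto intro!: mult_mono)
  have Z5: "f0 \<in> Z" "g0 \<in> Z" "e1 \<in> Z" "e0 \<in> Z" "Y \<in> Z" by (auto simp: Z_def)
  have U2: "\<exists>U. continuous_on (sphere c r2) U \<and> cmean c r2 U \<le> A2 \<and>
       (\<forall>w\<in>sphere c r2. x1 w \<noteq> 0 \<and> x0 w \<noteq> 0 \<and> ln (norm (x1 w)) \<le> U w \<and> ln (norm (x0 w)) \<le> U w)"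
    if x: "(x1, x0) \<in> P2" for x1 x0
  proof (cases "(x1, x0) \<in> P1")
    case True
    then show ?thesis using r21 r2(3) A2 by (intro U1) auto
  next
    case False
    then have xe: "x1 = e1" "x0 = e0" using x by (auto simp: P2_def)
    let ?U = "\<lambda>w. d * (uf w + ug w) + (C + C * ln B1)"
    have "cmean c r2 ?U = d * T r2 + (C + C * ln B1)"
      using r21 by (simp add: cmean_add cmean_cmult cuf cug Tf_def Tg_def T_def continuous_on_add continuous_on_mult_left)
    also have "\<dots> \<le> d * (2 * t) + (C + C * B1)"
      using T2[OF r21] pos B1 ln_le_minus_one[of B1] by (intro add_mono mult_left_mono) auto
    also have "\<dots> \<le> d * (2 * t^5) + (C * t^5 + C * B1)"
      using tt pos by (intro add_mono mult_left_mono) (auto simp: mult_le_cancel_left1)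
    also have "\<dots> = (2 * d + C + C * Kb1) * t^5" by (simp add: B1_def algebra_simps)
    also have "\<dots> \<le> A2" unfolding A2_def K3_def using K1 tt t by (intro mult_right_mono) auto
    finally have m2: "cmean c r2 ?U \<le> A2" .
    have "e1 w \<noteq> 0 \<and> e0 w \<noteq> 0 \<and> ln (norm (e1 w)) \<le> ?U w \<and> ln (norm (e0 w)) \<le> ?U w" if w: "w \<in> sphere c r2" for w
    proof -
      have Dw: "D w \<noteq> 0" using r2(3)[OF w] .
      have n: "f0 w \<noteq> 0" "g0 w \<noteq> 0" "e1 w \<noteq> 0" "e0 w \<noteq> 0" using DZ[OF Dw] Z5 by auto
      note W = wr[OF Dw r2B[OF w]]
      have "ln (norm (e1 w)) \<le> d * (lnmax f0 f1 w + lnmax g0 g1 w) + C + C * ln B1 \<and>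
       ln (norm (e0 w)) \<le> d * (lnmax f0 f1 w + lnmax g0 g1 w) + C + C * ln B1"
        by (rule Be[OF B1 n]) (use W in auto)
      then show ?thesis using n by (simp add: uf_def ug_def)
    qed
    then show ?thesis unfolding xe using m2 
      by (intro exI[of _ ?U]) (auto intro!: continuous_intros cuf cug)
  qed
  have "\<exists>r. \<rho> \<le> r \<and> r < r2 \<and> (\<forall>w\<in>sphere c r. D w \<noteq> 0 \<and> (\<forall>(x1, x0)\<in>P2. x1 w \<noteq> 0 \<and> x0 w \<noteq> 0 \<and>
     norm (deriv x1 w / x1 w - deriv x0 w / x0 w) \<le> 9600 * card P2 * A2^2 * (r2 / (r2 - \<rho>))^3))"
  proof (rule window)
    show "entire x1 \<and> entire x0" if "(x1, x0) \<in> P2" for x1 x0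
      using that PZ Zhol by auto
    show "x1 c \<noteq> 0 \<and> x0 c \<noteq> 0 \<and> - ln (norm (x1 c)) \<le> A2 \<and> - ln (norm (x0 c)) \<le> A2" if "(x1, x0) \<in> P2" for x1 x0
      using that A2 by (intro cen) auto
  qed (use fP r2 \<rho> h A2 Dhol Dc U2 in auto)
  then obtain r where r: "\<rho> \<le> r" "r < r2" "\<And>w. w \<in> sphere c r \<Longrightarrow> D w \<noteq> 0"
    and rP: "\<And>w x1 x0. \<lbrakk>w \<in> sphere c r; (x1, x0) \<in> P2\<rbrakk> \<Longrightarrow>
       norm (deriv x1 w / x1 w - deriv x0 w / x0 w) \<le> 9600 * card P2 * A2^2 * (r2 / (r2 - \<rho>))^3"
    by (smt (verit, best) case_prodD)
  \<comment> \<open>The outer window gives t^2 t^3 = t^5 for \<open>B1\<close>. Estimating ln B1 by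
    B1 makes \<open>A2\<close> of size t^5, and the inner window then gives (t^5)^2 t^3. Only ln B2
    enters the final inequality, so any power of t is harmless.\<close>
  define B2 where "B2 = Kb2 * t^13"
  have "1 \<le> t^13" using t(1) by (rule one_le_power)
  then have B2: "1 \<le> B2" unfolding B2_def using mult_mono[of 1 Kb2 1 "t^13"] Kb2 by auto
  have rB: "norm (deriv x1 w / x1 w - deriv x0 w / x0 w) \<le> B2" if "w \<in> sphere c r" "(x1, x0) \<in> P2" for w x1 x0
  proof -
    have "9600 * card P2 * A2^2 * (r2 / (r2 - \<rho>))^3 \<le> 9600 * card P2 * A2^2 * (512 * t^3)"
      using r2 \<rho> h r21 by (intro mult_left_mono ratio) auto
    also have "\<dots> = Kb2 * ((t^5)^2 * t^3)" by (simp add: A2_def Kb2_def power_mult_distrib)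
    also have "\<dots> = B2" by (simp add: B2_def flip: power_add power_mult)
    finally show ?thesis using rP[OF that] by linarith
  qed
  have key: "\<kappa> * (uf w + ug w) + ln (norm (Y w)) \<le> C + C * ln B2" if w: "w \<in> sphere c r" for w
  proof -
    have Dw: "D w \<noteq> 0" using r(3)[OF w] .
    have n: "f0 w \<noteq> 0" "g0 w \<noteq> 0" "e1 w \<noteq> 0" "e0 w \<noteq> 0" "Y w \<noteq> 0" using DZ[OF Dw] Z5 by auto
    have W: "(\<forall>a\<in>S. lform f0 f1 a w \<noteq> 0 \<and> norm (wronskian f0 f1 w) \<le> B2 * norm (lform f0 f1 a w * f0 w)) \<and>
       (\<forall>a\<in>S. lform g0 g1 a w \<noteq> 0 \<and> norm (wronskian g0 g1 w) \<le> B2 * norm (lform g0 g1 a w * g0 w))"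
      by (rule wr[OF Dw rB[OF w]]) (simp add: P2_def)
    have "norm (deriv e1 w / e1 w - deriv e0 w / e0 w) \<le> B2" using rB[OF w] by (simp add: P2_def)
    then show ?thesis unfolding uf_def ug_def
      by (intro BY[OF B2 n]) (use W in auto)
  qed
  have r0: "0 < r" "0 \<le> r" using r \<rho> by auto
  have Yn: "Y w \<noteq> 0" if "w \<in> sphere c r" for w using DZ[OF r(3)[OF that]] Z5 by auto
  have cY: "continuous_on (sphere c r) (\<lambda>w. ln (norm (Y w)))" using hol(7) Yn by (rule continuous_on_ln_norm_entire)
  have "cmean c r (\<lambda>w. \<kappa> * (uf w + ug w) + ln (norm (Y w))) \<le> cmean c r (\<lambda>_. C + C * ln B2)"
    using key r0 by (intro cmean_mono) (auto intro!: continuous_intros cuf cug cY)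
  also have "cmean c r (\<lambda>w. \<kappa> * (uf w + ug w) + ln (norm (Y w))) = \<kappa> * T r + cmean c r (\<lambda>w. ln (norm (Y w)))"
    using r0 cY by (simp add: cmean_add cmean_cmult cuf cug Tf_def Tg_def T_def continuous_on_add continuous_on_mult_left)
  finally have "\<kappa> * T r + cmean c r (\<lambda>w. ln (norm (Y w))) \<le> C + C * ln B2" by simp
  moreover have "- A0 \<le> cmean c r (\<lambda>w. ln (norm (Y w)))"
    using cmean_ln_norm_ge(1)[OF hol(7) r0(1) c[OF Z5(5)] Yn] A0[OF Z5(5)] by linarith
  moreover have "\<kappa> * t \<le> \<kappa> * T r" unfolding t_def using pos \<rho> r by (intro mult_left_mono Tm) auto
  moreover have "ln B2 = ln Kb2 + 13 * ln t" unfolding B2_def using Kb2 t by (simp add: ln_mult ln_realpow)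
  then have "C * ln B2 = C * ln Kb2 + (13 * C) * ln t" by (simp add: algebra_simps)
  ultimately have "\<kappa> * t \<le> (A0 + C + C * ln Kb2) + (13 * C) * ln t" by linarith
  then show False using M(2)[OF t(2)] by linarith
qed

section \<open>Orders of vanishing\<close>

lemma entire_eqI:
  fixes F G E :: "complex \<Rightarrow> complex"
  assumes "entire F" "entire G" "entire E" "E w0 \<noteq> 0"
    and eq: "\<And>w. E w \<noteq> 0 \<Longrightarrow> F w = G w"
  shows "F z = G z"
proof (rule ccontr)
  assume "F z \<noteq> G z"
  define H where "H w = F w - G w" for w
  have H: "entire H" "H z \<noteq> 0"
    using assms(1,2) \<open>F z \<noteq> G z\<close> unfolding H_def by (auto intro!: holomorphic_intros)
  obtain c where "H c \<noteq> 0" "E c \<noteq> 0"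
    using entire_common_nonzero[of "{H, E}"] H assms(3,4) by auto
  then show False using eq by (simp add: H_def)
qed

text \<open>A relation instead of a function, since an identically vanishing function has no order;
  \<open>vanat\<close>, meaning order at least \<open>m\<close>, does hold for it. The entire
  cofactor makes orders multiply without local arguments.\<close>

definition ordat :: "(complex \<Rightarrow> complex) \<Rightarrow> complex \<Rightarrow> nat \<Rightarrow> bool" where
  "ordat u z m \<longleftrightarrow> (\<exists>\<phi>. entire \<phi> \<and> \<phi> z \<noteq> 0 \<and> (\<forall>w. u w = (w - z) ^ m * \<phi> w))"

definition vanat :: "(complex \<Rightarrow> complex) \<Rightarrow> complex \<Rightarrow> nat \<Rightarrow> bool" where
  "vanat u z m \<longleftrightarrow> (\<exists>\<phi>. entire \<phi> \<and> (\<forall>w. u w = (w - z) ^ m * \<phi> w))"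

lemma ordat_imp_vanat: "ordat u z m \<Longrightarrow> vanat u z m"
  unfolding ordat_def vanat_def by blast

lemma vanat_holomorphic: "vanat u z m \<Longrightarrow> u holomorphic_on A"
proof -
  assume "vanat u z m"
  then obtain \<phi> where \<phi>: "entire \<phi>" "\<And>w. u w = (w - z) ^ m * \<phi> w"
    unfolding vanat_def by blast
  have "(\<lambda>w. (w - z) ^ m * \<phi> w) holomorphic_on A"
    using holomorphic_on_subset[OF \<phi>(1)] by (intro holomorphic_intros) auto
  moreover have "u = (\<lambda>w. (w - z) ^ m * \<phi> w)" using \<phi>(2) by (rule ext)
  ultimately show ?thesis by simp
qed

lemma ordat_exists:
  assumes "entire u" "u w0 \<noteq> 0"
  shows "\<exists>m. ordat u z m"
  unfolding ordat_def by (rule entire_zero_factor[OF assms, of z]) blast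

lemma ordat_0: "\<lbrakk>entire u; u z \<noteq> 0\<rbrakk> \<Longrightarrow> ordat u z 0"
  unfolding ordat_def by auto

lemma vanat_0: "entire u \<Longrightarrow> vanat u z 0"
  unfolding vanat_def by auto

lemma ordat_zero_iff: "ordat u z m \<Longrightarrow> u z = 0 \<longleftrightarrow> 1 \<le> m"
  unfolding ordat_def by (cases m) auto

lemma ordat_mult:
  assumes "ordat u z m" "ordat v z n"
  shows "ordat (\<lambda>w. u w * v w) z (m + n)"
proof -
  obtain \<phi> where \<phi>: "entire \<phi>" "\<phi> z \<noteq> 0" "\<And>w. u w = (w - z) ^ m * \<phi> w"
    using assms(1) unfolding ordat_def by blast
  obtain \<psi> where \<psi>: "entire \<psi>" "\<psi> z \<noteq> 0" "\<And>w. v w = (w - z) ^ n * \<psi> w"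
    using assms(2) unfolding ordat_def by blast
  show ?thesis unfolding ordat_def
    by (rule exI[of _ "\<lambda>w. \<phi> w * \<psi> w"]) (use \<phi> \<psi> in \<open>auto intro!: holomorphic_intros simp: power_add mult_ac\<close>)
qed

lemma vanat_mult:
  assumes "vanat u z m" "vanat v z n"
  shows "vanat (\<lambda>w. u w * v w) z (m + n)"
proof -
  obtain \<phi> where \<phi>: "entire \<phi>" "\<And>w. u w = (w - z) ^ m * \<phi> w"
    using assms(1) unfolding vanat_def by blast
  obtain \<psi> where \<psi>: "entire \<psi>" "\<And>w. v w = (w - z) ^ n * \<psi> w"
    using assms(2) unfolding vanat_def by blast
  show ?thesis unfolding vanat_def
    by (rule exI[of _ "\<lambda>w. \<phi> w * \<psi> w"]) (use \<phi> \<psi> in \<open>auto intro!: holomorphic_intros simp: power_add mult_ac\<close>)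
qed

lemma vanat_le:
  assumes "vanat u z m" "n \<le> m"
  shows "vanat u z n"
proof -
  obtain \<phi> where \<phi>: "entire \<phi>" "\<And>w. u w = (w - z) ^ m * \<phi> w"
    using assms(1) unfolding vanat_def by blast
  show ?thesis unfolding vanat_def
    by (rule exI[of _ "\<lambda>w. (w - z) ^ (m - n) * \<phi> w"])
       (use \<phi> assms(2) in \<open>auto intro!: holomorphic_intros simp: mult.assoc[symmetric] simp flip: power_add\<close>)
qed

lemma ordat_power: "ordat u z m \<Longrightarrow> ordat (\<lambda>w. u w ^ n) z (n * m)"
proof (induction n)
  case 0
  show ?case unfolding ordat_def by (rule exI[of _ "\<lambda>_. 1"]) auto
next
  case (Suc n)
  then show ?case using ordat_mult[of u z m "\<lambda>w. u w ^ n" "n * m"] by simp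
qed

lemma ordat_cmult:
  assumes "ordat u z m" "k \<noteq> 0"
  shows "ordat (\<lambda>w. k * u w) z m"
  using ordat_mult[OF ordat_0[of "\<lambda>_. k"] assms(1)] assms(2) by simp

text \<open>The additional factor \<open>w - z\<close> keeps the formula uniform in
  \<open>m\<close>, including \<open>m = 0\<close>.\<close>

lemma deriv_factored:
  assumes \<phi>: "entire \<phi>" and u: "\<And>w. u w = (w - z) ^ m * \<phi> w"
  shows "(w - z) * deriv u w = (w - z) ^ m * (of_nat m * \<phi> w + (w - z) * deriv \<phi> w)"
proof -
  have d: "(\<phi> has_field_derivative deriv \<phi> w) (at w)"
    using \<phi> by (intro holomorphic_derivI[of _ UNIV]) auto
  have "u = (\<lambda>w. (w - z) ^ m * \<phi> w)" using u by auto
  then have "(u has_field_derivative (of_nat m * (w - z) ^ (m - 1) * \<phi> w + (w - z) ^ m * deriv \<phi> w)) (at w)"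
    using d by (auto intro!: derivative_eq_intros)
  then have "deriv u w = of_nat m * (w - z) ^ (m - 1) * \<phi> w + (w - z) ^ m * deriv \<phi> w"
    by (rule DERIV_imp_deriv)
  moreover have "(w - z) * (of_nat m * (w - z) ^ (m - 1) * \<phi> w) = (w - z) ^ m * (of_nat m * \<phi> w)"
    by (cases m) (simp_all add: mult_ac)
  ultimately show ?thesis by (simp only: distrib_left) (simp only: mult_ac)
qed

lemma wronskian_factored:
  assumes \<phi>: "entire \<phi>" and u: "\<And>w. u w = (w - z) ^ m * \<phi> w"
    and \<psi>: "entire \<psi>" and v: "\<And>w. v w = (w - z) ^ n * \<psi> w"
  shows "(w - z) * wronskian v u w =
     (w - z) ^ (m + n) * ((of_nat m - of_nat n) * (\<phi> w * \<psi> w) + (w - z) * wronskian \<psi> \<phi> w)"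
proof -
  have "(w - z) * wronskian v u w = ((w - z) * deriv u w) * v w - u w * ((w - z) * deriv v w)"
    by (simp add: wronskian_def algebra_simps)
  also have "\<dots> = ((w - z) ^ m * (of_nat m * \<phi> w + (w - z) * deriv \<phi> w)) * ((w - z) ^ n * \<psi> w) -
      ((w - z) ^ m * \<phi> w) * ((w - z) ^ n * (of_nat n * \<psi> w + (w - z) * deriv \<psi> w))"
    by (simp only: deriv_factored[OF \<phi> u] deriv_factored[OF \<psi> v] u v)
  also have "\<dots> = (w - z) ^ (m + n) * ((of_nat m - of_nat n) * (\<phi> w * \<psi> w) + (w - z) * wronskian \<psi> \<phi> w)"
    by (simp add: wronskian_def power_add algebra_simps)
  finally show ?thesis .
qed

lemma cancel_linear_factor:
  assumes "entire F" "entire G" "\<And>w. (w - z) * F w = (w - z) * G w"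
  shows "F w = G (w::complex)"
  by (rule entire_eqI[OF assms(1,2), of "\<lambda>w. w - z" "z + 1"])
     (use assms(3) in \<open>auto intro!: holomorphic_intros\<close>)

lemma vanat_wronskian:
  assumes "ordat u z m" "ordat v z n"
  shows "vanat (wronskian v u) z (m + n - 1)"
proof -
  obtain \<phi> where \<phi>: "entire \<phi>" "\<phi> z \<noteq> 0" "\<And>w. u w = (w - z) ^ m * \<phi> w"
    using assms(1) unfolding ordat_def by blast
  obtain \<psi> where \<psi>: "entire \<psi>" "\<psi> z \<noteq> 0" "\<And>w. v w = (w - z) ^ n * \<psi> w"
    using assms(2) unfolding ordat_def by blast
  have hu: "entire u" "entire v"
    using assms ordat_imp_vanat vanat_holomorphic by blast+
  show ?thesis
  proof (cases "m + n = 0")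
    case True
    then show ?thesis using hu by (auto intro!: vanat_0 holomorphic_intros)
  next
    case False
    define G where "G w = (of_nat m - of_nat n) * (\<phi> w * \<psi> w) + (w - z) * wronskian \<psi> \<phi> w" for w
    have hG: "entire G" unfolding G_def by (intro holomorphic_intros \<phi> \<psi>)
    have "wronskian v u w = (w - z) ^ (m + n - 1) * G w" for w
    proof (rule cancel_linear_factor[where F = "wronskian v u" and G = "\<lambda>w. (w - z) ^ (m + n - 1) * G w" and z = z])
      fix w
      have "(w - z) ^ (m + n) = (w - z) * (w - z) ^ (m + n - 1)"
        using False by (cases "m + n") auto
      then show "(w - z) * wronskian v u w = (w - z) * ((w - z) ^ (m + n - 1) * G w)"
        using wronskian_factored[OF \<phi>(1,3) \<psi>(1,3), of w] by (simp add: G_def)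
    qed (auto intro!: holomorphic_intros hu hG)
    then show ?thesis using hG unfolding vanat_def by blast
  qed
qed

text \<open>The lowest term carries the factor m - n. For equal orders it drops out, which gains one
  order over \<open>vanat_wronskian\<close>: the quotient has neither zero nor pole, so its
  logarithmic derivative has no pole.\<close>

lemma vanat_wronskian_same:
  assumes "ordat u z m" "ordat v z m"
  shows "vanat (wronskian v u) z (m + m)"
proof -
  obtain \<phi> where \<phi>: "entire \<phi>" "\<phi> z \<noteq> 0" "\<And>w. u w = (w - z) ^ m * \<phi> w"
    using assms(1) unfolding ordat_def by blast
  obtain \<psi> where \<psi>: "entire \<psi>" "\<psi> z \<noteq> 0" "\<And>w. v w = (w - z) ^ m * \<psi> w"
    using assms(2) unfolding ordat_def by blast
  have hu: "entire u" "entire v"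
    using assms ordat_imp_vanat vanat_holomorphic by blast+
  have "wronskian v u w = (w - z) ^ (m + m) * wronskian \<psi> \<phi> w" for w
    by (rule cancel_linear_factor[where F = "wronskian v u" and G = "\<lambda>w. (w - z) ^ (m + m) * wronskian \<psi> \<phi> w" and z = z])
       (use wronskian_factored[OF \<phi>(1,3) \<psi>(1,3)] in \<open>auto intro!: holomorphic_intros hu \<phi> \<psi>\<close>)
  moreover have "entire (wronskian \<psi> \<phi>)" by (intro holomorphic_intros \<phi> \<psi>)
  ultimately show ?thesis unfolding vanat_def by blast
qed

lemma ordat_wronskian:
  assumes "ordat u z m" "1 \<le> m" "entire v" "v z \<noteq> 0"
  shows "ordat (wronskian v u) z (m - 1)" "ordat (wronskian u v) z (m - 1)"
proof -
  obtain \<phi> where \<phi>: "entire \<phi>" "\<phi> z \<noteq> 0" "\<And>w. u w = (w - z) ^ m * \<phi> w"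
    using assms(1) unfolding ordat_def by blast
  have v: "\<And>w. v w = (w - z) ^ 0 * v w" by simp
  have hu: "entire u"
    using assms(1) ordat_imp_vanat vanat_holomorphic by blast
  define G where "G w = of_nat m * (\<phi> w * v w) + (w - z) * wronskian v \<phi> w" for w
  have hG: "entire G" unfolding G_def by (intro holomorphic_intros \<phi> assms(3))
  have "wronskian v u w = (w - z) ^ (m - 1) * G w" for w
  proof (rule cancel_linear_factor[where F = "wronskian v u" and G = "\<lambda>w. (w - z) ^ (m - 1) * G w" and z = z])
    fix w
    have "(w - z) ^ m = (w - z) * (w - z) ^ (m - 1)" using assms(2) by (cases m) auto
    then show "(w - z) * wronskian v u w = (w - z) * ((w - z) ^ (m - 1) * G w)"
      using wronskian_factored[OF \<phi>(1,3) assms(3) v, of w] by (simp add: G_def)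
  qed (auto intro!: holomorphic_intros hu hG assms(3))
  moreover have "G z \<noteq> 0" using \<phi> assms by (simp add: G_def)
  ultimately show 1: "ordat (wronskian v u) z (m - 1)" using hG unfolding ordat_def by blast
  have "wronskian u v = (\<lambda>w. (-1) * wronskian v u w)" by (auto simp: wronskian_def)
  then show "ordat (wronskian u v) z (m - 1)" using ordat_cmult[OF 1, of "-1"] by simp
qed

text \<open>Near \<open>z\<close> the powers cancel and the quotient of the cofactors is
  holomorphic. Its values at the respective centres define \<open>E\<close>, and
  \<open>loc_eq\<close> shows that these local quotients agree.\<close>

lemma entire_quotient:
  assumes num: "entire num" and den: "entire den" "den w0 \<noteq> 0"
    and loc: "\<And>z. \<exists>d. ordat den z d \<and> vanat num z d"
  shows "\<exists>E. entire E \<and> (\<forall>w. num w = E w * den w)"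
proof -
  have "\<exists>d \<phi> \<psi>. entire \<phi> \<and> \<phi> z \<noteq> 0 \<and> entire \<psi> \<and>
     (\<forall>w. den w = (w - z) ^ d * \<phi> w) \<and> (\<forall>w. num w = (w - z) ^ d * \<psi> w)" for z
    using loc[of z] unfolding ordat_def vanat_def by blast
  then obtain d \<phi> \<psi> where \<phi>: "\<And>z. entire (\<phi> z)" "\<And>z. \<phi> z z \<noteq> 0"
    and \<psi>: "\<And>z. entire (\<psi> z)"
    and deq: "\<And>z w. den w = (w - z) ^ d z * \<phi> z w" and neq: "\<And>z w. num w = (w - z) ^ d z * \<psi> z w"
    by metis
  define E where "E z = \<psi> z z / \<phi> z z" for z
  have Ew: "E w = num w / den w" if "den w \<noteq> 0" for w
  proof -
    have "d w = 0" using deq[of w w] that by (cases "d w") auto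
    then show ?thesis using deq[of w w] neq[of w w] by (simp add: E_def)
  qed
  have loc_eq: "E w = \<psi> z w / \<phi> z w" if "\<phi> z w \<noteq> 0" for z w
  proof (cases "w = z")
    case False
    then have "den w \<noteq> 0" using deq[of w z] that by simp
    then show ?thesis using Ew[of w] deq[of w z] neq[of w z] False by simp
  qed (simp add: E_def)
  have "entire E"
  proof -
    have "E analytic_on {z}" for z
    proof -
      have op: "open {w. \<phi> z w \<noteq> 0}"
        using \<phi>(1)[of z] holomorphic_on_imp_continuous_on[of "\<phi> z" UNIV]
        by (intro open_Collect_neq continuous_intros) auto
      have "(\<lambda>w. \<psi> z w / \<phi> z w) holomorphic_on {w. \<phi> z w \<noteq> 0}"
        by (intro holomorphic_intros holomorphic_on_subset[OF \<phi>(1)] holomorphic_on_subset[OF \<psi>]) auto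
      then have "E holomorphic_on {w. \<phi> z w \<noteq> 0}"
        by (rule holomorphic_transform) (simp add: loc_eq)
      then show ?thesis using op \<phi>(2) analytic_at by blast
    qed
    then show ?thesis by (metis analytic_imp_holomorphic analytic_on_analytic_at)
  qed
  moreover have "num w = E w * den w" for w
  proof (cases "d w")
    case 0
    then show ?thesis using deq[of w w] neq[of w w] \<phi>(2) by (simp add: E_def)
  next
    case (Suc m)
    then show ?thesis using deq[of w w] neq[of w w] by simp
  qed
  ultimately show ?thesis by blast
qed

text \<open>On a disc without zeros of \<open>u\<close> the derivative of v / u is zero; the
  identity theorem extends the resulting proportionality to the plane.\<close>

lemma wronskian_eq_0_imp_proportional:
  assumes u: "entire u" "u z0 \<noteq> 0" and v: "entire v"
    and W: "\<And>w. wronskian u v w = 0"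
  shows "\<exists>k. \<forall>w. v w = k * u w"
proof -
  have "continuous_on UNIV u" using u holomorphic_on_imp_continuous_on by blast
  then have "open {w. u w \<noteq> 0}" by (intro open_Collect_neq continuous_intros)
  moreover have "z0 \<in> {w. u w \<noteq> 0}" using u(2) by simp
  ultimately obtain r where r: "0 < r" "ball z0 r \<subseteq> {w. u w \<noteq> 0}" by (rule openE)
  have d: "((\<lambda>w. v w / u w) has_field_derivative 0) (at w within ball z0 r)" if "w \<in> ball z0 r" for w
  proof -
    have "u w \<noteq> 0" using r that by auto
    have "(u has_field_derivative deriv u w) (at w)" "(v has_field_derivative deriv v w) (at w)"
      using u v by (auto intro!: holomorphic_derivI[of _ UNIV])
    from DERIV_divide[OF this(2,1) \<open>u w \<noteq> 0\<close>] W[of w]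
    have "((\<lambda>w. v w / u w) has_field_derivative 0) (at w)" by (simp add: wronskian_def)
    then show ?thesis by (rule has_field_derivative_at_within)
  qed
  obtain k where k: "\<And>w. w \<in> ball z0 r \<Longrightarrow> v w / u w = k"
    using has_field_derivative_zero_constant[OF convex_ball d] by blast
  define H where "H w = v w - k * u w" for w
  have H: "entire H" unfolding H_def by (intro holomorphic_intros u v)
  have "H w = 0" for w
  proof (rule ccontr)
    assume "H w \<noteq> 0"
    then have "finite {x \<in> cball z0 (r/2). H x = 0}" by (intro entire_finite_zeros[OF H]) auto
    moreover have "H x = 0" if "x \<in> cball z0 (r/2)" for x
    proof -
      have x: "x \<in> ball z0 r" using that r(1) by auto
      then have "u x \<noteq> 0" using r(2) by auto
      then show ?thesis using k[OF x] by (auto simp: H_def)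
    qed
    then have "{x \<in> cball z0 (r/2). H x = 0} = cball z0 (r/2)" by auto
    moreover have "infinite (cball z0 (r/2))" using uncountable_cball[of "r/2" z0] r(1) countable_finite by auto
    ultimately show False by simp
  qed
  then show ?thesis by (intro exI[of _ k]) (simp add: H_def)
qed

text \<open>
  If \<open>y - a x\<close> is the smallest of the forms, then all the others are comparable to
  \<open>max \<bar>x\<bar> \<bar>y\<bar>\<close>, and the smallest one is absorbed by \<open>W\<close>.
\<close>

lemma second_main_theorem_pointwise:
  fixes S :: "complex set"
  assumes S: "finite S" "S \<noteq> {}"
  shows "\<exists>C\<ge>0. \<forall>x y (W::complex) (B::real). 0 < B \<longrightarrow> x \<noteq> 0 \<longrightarrow> W \<noteq> 0 \<longrightarrow>
     (\<forall>a\<in>S. y - a * x \<noteq> 0 \<and> norm W \<le> B * norm ((y - a * x) * x)) \<longrightarrow>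
     (real (card S) - 1) * ln (max (norm x) (norm y)) + ln (norm W) \<le>
       ln (norm x) + (\<Sum>a\<in>S. ln (norm (y - a * x))) + ln B + C"
proof -
  define K where "K a b = 1 + 2 * (1 + norm b) / norm (b - a)" for a b :: complex
  define C where "C = (\<Sum>a\<in>S. \<Sum>b\<in>S. \<bar>ln (K a b)\<bar>)"
  have "0 \<le> C" unfolding C_def by (intro sum_nonneg) auto
  moreover have "(real (card S) - 1) * ln (max (norm x) (norm y)) + ln (norm W) \<le>
       ln (norm x) + (\<Sum>a\<in>S. ln (norm (y - a * x))) + ln B + C"
    if B: "0 < B" and x: "x \<noteq> 0" and W: "W \<noteq> 0"
      and h: "\<And>a. a \<in> S \<Longrightarrow> y - a * x \<noteq> 0 \<and> norm W \<le> B * norm ((y - a * x) * x)" for x y W :: complex and B :: real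
  proof -
    obtain a where a: "a \<in> S" "\<And>b. b \<in> S \<Longrightarrow> norm (y - a * x) \<le> norm (y - b * x)"
    proof -
      obtain a where "is_arg_min (\<lambda>b. norm (y - b * x)) (\<lambda>b. b \<in> S) a"
        using ex_is_arg_min_if_finite[OF S] by blast
      then show ?thesis using that unfolding is_arg_min_linorder by blast
    qed
    \<comment> \<open>(b - a) x is the difference of the forms for \<open>a\<close> and
      \<open>b\<close>, the latter being the larger. This bounds |x|, and then |y|, by a multiple of
      the form for \<open>b\<close>.\<close>
    have b: "ln (max (norm x) (norm y)) \<le> \<bar>ln (K a b)\<bar> + ln (norm (y - b * x))" if b: "b \<in> S - {a}" for b
    proof -
      have ab: "0 < norm (b - a)" using b by simp
      have L: "0 < norm (y - b * x)" using h[of b] b by simp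
      have "norm ((b - a) * x) = norm ((y - a * x) - (y - b * x))" by (simp add: algebra_simps)
      also have "\<dots> \<le> norm (y - a * x) + norm (y - b * x)" by (rule norm_triangle_ineq4)
      also have "\<dots> \<le> 2 * norm (y - b * x)" using a(2)[of b] b by simp
      finally have "norm (b - a) * norm x \<le> 2 * norm (y - b * x)" by (simp only: norm_mult)
      then have nx: "norm x \<le> 2 * norm (y - b * x) / norm (b - a)"
        using ab by (simp only: pos_le_divide_eq mult.commute)
      have "norm y \<le> norm (y - b * x) + norm (b * x)" using norm_triangle_ineq[of "y - b * x" "b * x"] by simp
      also have "\<dots> \<le> norm (y - b * x) + norm b * (2 * norm (y - b * x) / norm (b - a))"
        unfolding norm_mult by (intro add_left_mono mult_left_mono nx) auto
      also have "\<dots> \<le> K a b * norm (y - b * x)"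
        using ab by (simp add: K_def field_simps)
      finally have y: "norm y \<le> K a b * norm (y - b * x)" .
      have "2 * norm (y - b * x) / norm (b - a) \<le> K a b * norm (y - b * x)"
        using ab by (simp add: K_def field_simps)
      then have xx: "norm x \<le> K a b * norm (y - b * x)" using nx by simp
      have K: "0 < K a b" using ab unfolding K_def by (intro add_pos_nonneg divide_nonneg_nonneg) auto
      have "ln (max (norm x) (norm y)) \<le> ln (K a b * norm (y - b * x))"
        using x y xx by (intro ln_mono) (auto simp: less_max_iff_disj)
      also have "\<dots> = ln (K a b) + ln (norm (y - b * x))" using K L by (simp add: ln_mult)
      finally show ?thesis by simp
    qed
    have cS: "real (card S) - 1 = real (card (S - {a}))"
      using a(1) S by (simp add: card_Diff_singleton_if) (metis One_nat_def Suc_leI card_gt_0_iff of_nat_1 of_nat_diff)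
    have "(real (card S) - 1) * ln (max (norm x) (norm y)) = (\<Sum>b\<in>S-{a}. ln (max (norm x) (norm y)))"
      unfolding cS by simp
    also have "\<dots> \<le> (\<Sum>b\<in>S-{a}. \<bar>ln (K a b)\<bar> + ln (norm (y - b * x)))" by (rule sum_mono) (rule b)
    also have "\<dots> = (\<Sum>b\<in>S-{a}. \<bar>ln (K a b)\<bar>) + (\<Sum>b\<in>S-{a}. ln (norm (y - b * x)))" by (rule sum.distrib)
    also have "(\<Sum>b\<in>S-{a}. \<bar>ln (K a b)\<bar>) \<le> (\<Sum>b\<in>S. \<bar>ln (K a b)\<bar>)" using S by (intro sum_mono2) auto
    also have "(\<Sum>b\<in>S. \<bar>ln (K a b)\<bar>) \<le> C"
      unfolding C_def by (rule member_le_sum[OF a(1)]) (use S in \<open>auto intro: sum_nonneg\<close>)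
    finally have 1: "(real (card S) - 1) * ln (max (norm x) (norm y)) \<le> C + (\<Sum>b\<in>S-{a}. ln (norm (y - b * x)))" by simp
    have "ln (norm W) \<le> ln (B * norm ((y - a * x) * x))" using h[OF a(1)] W by (intro ln_mono) auto
    also have "\<dots> = ln B + ln (norm (y - a * x)) + ln (norm x)"
      using h[OF a(1)] B x by (simp add: norm_mult ln_mult)
    finally have 2: "ln (norm W) \<le> ln B + ln (norm (y - a * x)) + ln (norm x)" .
    have 3: "(\<Sum>b\<in>S. ln (norm (y - b * x))) = ln (norm (y - a * x)) + (\<Sum>b\<in>S-{a}. ln (norm (y - b * x)))"
      using S(1) a(1) by (rule sum.remove)
    show ?thesis using 1 2 unfolding 3 by linarith
  qed
  ultimately show ?thesis by blast
qed

lemma vanat_1: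
  assumes "entire u" "u z = 0"
  shows "vanat u z 1"
proof (cases "\<exists>w. u w \<noteq> 0")
  case True
  then obtain m where m: "ordat u z m" using ordat_exists[OF assms(1)] by blast
  then have "1 \<le> m" using ordat_zero_iff[OF m] assms(2) by simp
  then show ?thesis using vanat_le[OF ordat_imp_vanat[OF m]] by blast
next
  case False
  then show ?thesis unfolding vanat_def by (intro exI[of _ "\<lambda>_. 0"]) auto
qed

text \<open>
  For \<open>F = f0\<^sup>n\<close> and \<open>p\<close> with a simple zero, the meromorphic function \<open>(F / p)'\<close> has a double
  pole with vanishing residue; this is why the logarithmic derivative of a quotient of two such
  functions vanishes at the point.
\<close>

lemma vanat_wronskian_simple_zeros:
  assumes F: "entire F" and G: "entire G"
    and p: "ordat p z 1" and r: "ordat r z 1"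
  defines "e1 \<equiv> \<lambda>w. wronskian p F w * r w ^ 2" and "e0 \<equiv> \<lambda>w. wronskian r G w * p w ^ 2"
  shows "vanat (wronskian e0 e1) z 5"
proof -
  obtain \<phi> where \<phi>: "entire \<phi>" "\<And>w. p w = (w - z) ^ 1 * \<phi> w"
    using p unfolding ordat_def by blast
  obtain \<psi> where \<psi>: "entire \<psi>" "\<And>w. r w = (w - z) ^ 1 * \<psi> w"
    using r unfolding ordat_def by blast
  have hp: "entire p" "entire r"
    using p r ordat_imp_vanat vanat_holomorphic by blast+
  have dv: "(h has_field_derivative deriv h w) (at w)" if "entire h" for h w
    using that by (intro holomorphic_derivI[of _ UNIV]) auto
  \<comment> \<open>The derivative at \<open>z\<close> contains no derivative of \<open>H\<close>:
    the two such terms cancel. This is the vanishing residue in computational form.\<close>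
  have val: "wronskian x H z = - H z * \<chi>' z \<and> (wronskian x H has_field_derivative - 2 * H z * deriv \<chi>' z) (at z)"
    if H: "entire H" and c: "entire \<chi>'" and x: "\<And>w. x w = (w - z) ^ 1 * \<chi>' w" for x H \<chi>'
  proof -
    have dx: "deriv x w = \<chi>' w + (w - z) * deriv \<chi>' w" for w
    proof -
      have "x = (\<lambda>w. (w - z) * \<chi>' w)" using x by auto
      then have "(x has_field_derivative \<chi>' w + (w - z) * deriv \<chi>' w) (at w)"
        using dv[OF c, of w] by (auto intro!: derivative_eq_intros)
      then show ?thesis by (rule DERIV_imp_deriv)
    qed
    have e: "wronskian x H = (\<lambda>w. (w - z) * (deriv H w * \<chi>' w - H w * deriv \<chi>' w) - H w * \<chi>' w)"
      by (rule ext) (simp add: wronskian_def dx x algebra_simps)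
    have dh: "entire (\<lambda>w. deriv H w)" "entire (\<lambda>w. deriv \<chi>' w)"
      using H c by (auto intro!: holomorphic_intros)
    have "((\<lambda>w. (w - z) * (deriv H w * \<chi>' w - H w * deriv \<chi>' w) - H w * \<chi>' w) has_field_derivative
       (deriv H z * \<chi>' z - H z * deriv \<chi>' z) - (deriv H z * \<chi>' z + H z * deriv \<chi>' z)) (at z)"
      using dv[OF H, of z] dv[OF c, of z] dv[OF dh(1), of z] dv[OF dh(2), of z]
      by (auto intro!: derivative_eq_intros)
    then show ?thesis unfolding e by (simp add: mult.assoc)
  qed
  note vp = val[OF F \<phi>] and vr = val[OF G \<psi>]
  define X1 where "X1 w = wronskian p F w * \<psi> w ^ 2" for w
  define X0 where "X0 w = wronskian r G w * \<phi> w ^ 2" for w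
  have hX: "entire X1" "entire X0"
    unfolding X1_def X0_def by (intro holomorphic_intros hp F G \<phi> \<psi>)+
  have e1: "e1 w = (w - z) ^ 2 * X1 w" for w by (simp add: e1_def X1_def \<psi>(2) power_mult_distrib)
  have e0: "e0 w = (w - z) ^ 2 * X0 w" for w by (simp add: e0_def X0_def \<phi>(2) power_mult_distrib)
  have he: "entire e1" "entire e0"
    unfolding e1_def e0_def by (intro holomorphic_intros hp F G)+
  have w4: "wronskian e0 e1 w = (w - z) ^ 4 * wronskian X0 X1 w" for w
  proof (rule cancel_linear_factor[where F = "wronskian e0 e1" and G = "\<lambda>w. (w - z) ^ 4 * wronskian X0 X1 w" and z = z])
    fix w show "(w - z) * wronskian e0 e1 w = (w - z) * ((w - z) ^ 4 * wronskian X0 X1 w)"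
      using wronskian_factored[OF hX(1) e1 hX(2) e0, of w] by simp
  qed (intro holomorphic_intros he hX)+
  have d1: "deriv X1 z = - 2 * F z * deriv \<phi> z * \<psi> z ^ 2 + 2 * \<psi> z * deriv \<psi> z * wronskian p F z"
    unfolding X1_def using vp dv[OF \<psi>(1), of z] by (intro DERIV_imp_deriv) (auto intro!: derivative_eq_intros)
  have d0: "deriv X0 z = - 2 * G z * deriv \<psi> z * \<phi> z ^ 2 + 2 * \<phi> z * deriv \<phi> z * wronskian r G z"
    unfolding X0_def using vr dv[OF \<phi>(1), of z] by (intro DERIV_imp_deriv) (auto intro!: derivative_eq_intros)
  have vp1: "wronskian p F z = - F z * \<phi> z" and vr1: "wronskian r G z = - G z * \<psi> z" using vp vr by auto
  \<comment> \<open>Both functions have the factor (w - z)^2, which gives order 4; this vanishing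
    adds the fifth.\<close>
  have "wronskian X0 X1 z = 0"
    unfolding wronskian_def[of X0 X1] d1 d0 unfolding X1_def X0_def vp1 vr1
    by (simp add: power2_eq_square algebra_simps)
  then have "vanat (wronskian X0 X1) z 1" by (intro vanat_1 holomorphic_intros hX)
  moreover have "vanat (\<lambda>w. (w - z) ^ 4) z 4" unfolding vanat_def by (intro exI[of _ "\<lambda>_. 1"]) auto
  ultimately have "vanat (\<lambda>w. (w - z) ^ 4 * wronskian X0 X1 w) z (4 + 1)" by (intro vanat_mult)
  moreover have "(\<lambda>w. (w - z) ^ 4 * wronskian X0 X1 w) = wronskian e0 e1" using w4 by auto
  ultimately show ?thesis by simp
qed

section \<open>The polynomial in homogeneous coordinates\<close>

text \<open>\<open>A\<close> and \<open>B\<close> are the zero sets of \<open>P\<close> and of its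
  derivative. Passing from indexed families to sets makes distinctness implicit, and the
  multiplicity becomes a function of the zero.\<close>

locale split_poly =
  fixes A B :: "complex set" and q :: "complex \<Rightarrow> nat" and a0 b0 :: complex and P :: "complex poly"
  assumes finA: "finite A" and finB: "finite B" and a0: "a0 \<noteq> 0" and b0: "b0 \<noteq> 0"
    and P_eq: "P = smult a0 (\<Prod>a\<in>A. [:- a, 1:])"
    and P'_eq: "pderiv P = smult b0 (\<Prod>b\<in>B. [:- b, 1:] ^ q b)"
    and q_pos: "\<And>b. b \<in> B \<Longrightarrow> 0 < q b" and cardB: "3 \<le> card B"
begin

text \<open>
  For \<open>f = f1 / f0\<close> and \<open>n = card A\<close> the function \<open>pA f0 f1\<close> is \<open>f0\<^sup>n P(f)\<close>, and \<open>MF f0 f1 / (pA f0 f1)\<^sup>2\<close> is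
  the derivative of \<open>1 / P(f)\<close>.
\<close>

definition "pA f0 f1 z = a0 * (\<Prod>a\<in>A. lform f0 f1 a z)"
definition "pB f0 f1 z = (\<Prod>b\<in>B. lform f0 f1 b z)"
definition "MF f0 f1 = wronskian (pA f0 f1) (\<lambda>z. f0 z ^ card A)"

lemma degree_P: "degree P = card A"
  unfolding P_eq using a0 finA by (simp add: degree_prod_sum_eq)

lemma sum_q: "(\<Sum>b\<in>B. q b) = card A - 1"
proof -
  have "degree (pderiv P) = (\<Sum>b\<in>B. q b)"
    unfolding P'_eq using b0 finB by (simp add: degree_prod_sum_eq degree_power_eq)
  then show ?thesis by (simp add: degree_pderiv degree_P)
qed

lemma card_A: "card B + 1 \<le> card A" "4 \<le> card A"
proof -
  have "(\<Sum>b\<in>B. 1) \<le> (\<Sum>b\<in>B. q b)" using q_pos by (intro sum_mono) (simp add: Suc_leI)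
  then have "card B \<le> card A - 1" unfolding sum_q by simp
  then show "card B + 1 \<le> card A" "4 \<le> card A" using cardB by auto
qed

lemma A_ne: "A \<noteq> {}" using card_A by auto

lemma pderiv_root_iff: "poly (pderiv P) x = 0 \<longleftrightarrow> x \<in> B"
  unfolding P'_eq using b0 finB q_pos by (auto simp: poly_prod)

lemma disjoint: "A \<inter> B = {}"
proof -
  have "poly (pderiv P) a \<noteq> 0" if a: "a \<in> A" for a
  proof -
    define R where "R = smult a0 (\<Prod>x\<in>A-{a}. [:- x, 1:])"
    have "P = [:- a, 1:] * R" unfolding P_eq R_def using prod.remove[OF finA a, of "\<lambda>x. [:- x, 1:]"] by simp
    then have "pderiv P = [:- a, 1:] * pderiv R + R * pderiv [:- a, 1:]" by (simp only: pderiv_mult)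
    then have "poly (pderiv P) a = poly R a" by (simp only: poly_add poly_mult) (simp add: pderiv_pCons)
    also have "\<dots> \<noteq> 0" unfolding R_def using a0 finA by (auto simp: poly_prod)
    finally show ?thesis .
  qed
  then show ?thesis using pderiv_root_iff by blast
qed

lemma pA_eq: "f0 z \<noteq> 0 \<Longrightarrow> pA f0 f1 z = poly P (f1 z / f0 z) * f0 z ^ card A"
  unfolding P_eq pA_def lform_def
  by (simp add: poly_prod prod_constant[symmetric] del: prod_constant flip: prod.distrib)
     (auto intro!: prod.cong simp: field_simps)

lemma pB_eq: "f0 z \<noteq> 0 \<Longrightarrow> poly (pderiv P) (f1 z / f0 z) * f0 z ^ (card A - 1) = b0 * (\<Prod>b\<in>B. lform f0 f1 b z ^ q b)"
proof -
  assume f0: "f0 z \<noteq> 0"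
  have "poly (pderiv P) (f1 z / f0 z) * f0 z ^ (card A - 1) =
     b0 * ((\<Prod>b\<in>B. (f1 z / f0 z - b) ^ q b) * (\<Prod>b\<in>B. f0 z ^ q b))"
    unfolding P'_eq sum_q[symmetric] power_sum by (simp add: poly_prod)
  also have "(\<Prod>b\<in>B. (f1 z / f0 z - b) ^ q b) * (\<Prod>b\<in>B. f0 z ^ q b) = (\<Prod>b\<in>B. lform f0 f1 b z ^ q b)"
    unfolding prod.distrib[symmetric] power_mult_distrib[symmetric]
    using f0 by (intro prod.cong refl) (simp add: lform_def left_diff_distrib)
  finally show ?thesis .
qed

lemma pA_holomorphic: "\<lbrakk>entire f0; entire f1\<rbrakk> \<Longrightarrow> entire (pA f0 f1)"
  unfolding pA_def by (intro holomorphic_intros)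

lemma pB_holomorphic: "\<lbrakk>entire f0; entire f1\<rbrakk> \<Longrightarrow> entire (pB f0 f1)"
  unfolding pB_def by (intro holomorphic_intros)

lemma MF_holomorphic: "\<lbrakk>entire f0; entire f1\<rbrakk> \<Longrightarrow> entire (MF f0 f1)"
  unfolding MF_def by (intro holomorphic_intros pA_holomorphic)

text \<open>Where f0 is non-zero, \<open>MF\<close> is -P'(f) f' f0^(2n) with n = card A.
  Substituting f' = W / f0^2 and the homogeneous form of P'(f), of degree n - 1, leaves f0^(n - 1).
  The identity theorem covers the zeros of f0.\<close>

lemma MF_eq:
  assumes hol: "entire f0" "entire f1" and nz: "f0 w0 \<noteq> 0"
  shows "MF f0 f1 z = - b0 * (\<Prod>b\<in>B. lform f0 f1 b z ^ q b) * wronskian f0 f1 z * f0 z ^ (card A - 1)"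
proof (rule entire_eqI[where F = "MF f0 f1" and E = f0])
  show "entire (\<lambda>z. - b0 * (\<Prod>b\<in>B. lform f0 f1 b z ^ q b) * wronskian f0 f1 z * f0 z ^ (card A - 1))"
    by (intro holomorphic_intros hol)
  fix w assume w: "f0 w \<noteq> 0"
  obtain m where m: "card A = Suc m" using card_A by (cases "card A") auto
  have d: "(f0 has_field_derivative deriv f0 w) (at w)" "(f1 has_field_derivative deriv f1 w) (at w)"
    using hol by (auto intro!: holomorphic_derivI[of _ UNIV])
  have dF: "((\<lambda>z. f1 z / f0 z) has_field_derivative wronskian f0 f1 w / f0 w ^ 2) (at w)"
    using DERIV_divide[OF d(2,1) w] by (simp add: wronskian_def power2_eq_square)
  have dp: "((\<lambda>z. f0 z ^ Suc m) has_field_derivative (of_nat (Suc m) * f0 w ^ m * deriv f0 w)) (at w)"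
    by (rule DERIV_cong[OF DERIV_power_Suc[OF d(1)]]) simp
  define D where "D = poly (pderiv P) (f1 w / f0 w) * (wronskian f0 f1 w / f0 w ^ 2)"
  have "((\<lambda>z. poly P (f1 z / f0 z)) has_field_derivative D) (at w)"
    unfolding D_def by (rule DERIV_chain2[OF poly_DERIV dF])
  from DERIV_mult[OF this dp]
  have "((\<lambda>z. poly P (f1 z / f0 z) * f0 z ^ Suc m) has_field_derivative
     (D * f0 w ^ Suc m + of_nat (Suc m) * f0 w ^ m * deriv f0 w * poly P (f1 w / f0 w))) (at w)" .
  moreover have "open {w. f0 w \<noteq> 0}"
    using holomorphic_on_imp_continuous_on[OF hol(1)] by (intro open_Collect_neq continuous_intros)
  ultimately have "(pA f0 f1 has_field_derivative
     (D * f0 w ^ Suc m + of_nat (Suc m) * f0 w ^ m * deriv f0 w * poly P (f1 w / f0 w))) (at w)"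
    by (rule has_field_derivative_transform_within_open) (use w in \<open>auto simp: pA_eq m\<close>)
  then have dA: "deriv (pA f0 f1) w = D * f0 w ^ Suc m + of_nat (Suc m) * f0 w ^ m * deriv f0 w * poly P (f1 w / f0 w)"
    by (rule DERIV_imp_deriv)
  have "MF f0 f1 w = of_nat (Suc m) * f0 w ^ m * deriv f0 w * pA f0 f1 w - f0 w ^ Suc m * deriv (pA f0 f1) w"
    unfolding MF_def wronskian_def m DERIV_imp_deriv[OF dp] ..
  also have "\<dots> = - D * f0 w ^ Suc m * f0 w ^ Suc m"
    unfolding dA pA_eq[of f0 w f1, OF w] m by (simp add: algebra_simps)
  also have "\<dots> = - (poly (pderiv P) (f1 w / f0 w) * f0 w ^ m) * wronskian f0 f1 w * f0 w ^ m"
    using w by (simp add: D_def power2_eq_square field_simps)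
  also have "poly (pderiv P) (f1 w / f0 w) * f0 w ^ m = b0 * (\<Prod>b\<in>B. lform f0 f1 b w ^ q b)"
    using pB_eq[of f0 w f1] w m by simp
  finally show "MF f0 f1 w = - b0 * (\<Prod>b\<in>B. lform f0 f1 b w ^ q b) * wronskian f0 f1 w * f0 w ^ (card A - 1)"
    using m by simp
qed (use hol nz in \<open>auto intro: MF_holomorphic\<close>)

end

section \<open>Non-constant maps to the sphere and the local order count\<close>

text \<open>Homogeneous coordinates of a non-constant map to the Riemann sphere: by the last clause
  (f0 : f1) takes two different values, which also excludes the constant infinity.\<close>

definition coprime_pair :: "(complex \<Rightarrow> complex) \<Rightarrow> (complex \<Rightarrow> complex) \<Rightarrow> bool" where
  "coprime_pair f0 f1 \<longleftrightarrow> entire f0 \<and> entire f1 \<and>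
     (\<forall>z. f0 z \<noteq> 0 \<or> f1 z \<noteq> 0) \<and> (\<exists>z1 z2. f0 z1 * f1 z2 \<noteq> f1 z1 * f0 z2)"

lemma coprime_pairD:
  assumes "coprime_pair f0 f1"
  shows "entire f0" "entire f1" "\<And>z. f0 z \<noteq> 0 \<or> f1 z \<noteq> 0"
    "\<exists>w. f0 w \<noteq> 0" "\<exists>w. lform f0 f1 a w \<noteq> 0" "\<exists>w. wronskian f0 f1 w \<noteq> 0"
proof -
  note d = assms[unfolded coprime_pair_def]
  show hol: "entire f0" "entire f1" and nz: "\<And>z. f0 z \<noteq> 0 \<or> f1 z \<noteq> 0"
    using d by auto
  obtain z1 z2 where z: "f0 z1 * f1 z2 \<noteq> f1 z1 * f0 z2" using d by blast
  show f0: "\<exists>w. f0 w \<noteq> 0"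
  proof (rule ccontr)
    assume "\<not> ?thesis"
    then have "f0 z1 = 0" "f0 z2 = 0" by auto
    then show False using z by simp
  qed
  show "\<exists>w. lform f0 f1 a w \<noteq> 0"
  proof (rule ccontr)
    assume "\<not> ?thesis"
    then have "f1 z1 = a * f0 z1" "f1 z2 = a * f0 z2" by (auto simp: lform_def)
    then show False using z by simp
  qed
  show "\<exists>w. wronskian f0 f1 w \<noteq> 0"
  proof (rule ccontr)
    assume "\<not> ?thesis"
    then obtain k where "\<forall>w. f1 w = k * f0 w"
      using wronskian_eq_0_imp_proportional[OF hol(1) _ hol(2)] f0 by blast
    then show False using z by simp
  qed
qed

lemma wronskian_lform: 
  assumes "entire f0" "entire f1"
  shows "wronskian f0 (lform f0 f1 a) = wronskian f0 f1"
  by (rule ext) (simp add: wronskian_def deriv_lform[OF assms], simp add: lform_def algebra_simps)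

lemma lform_two_zeros:
  assumes "lform f0 f1 a z = 0" "lform f0 f1 b z = 0" "f0 z \<noteq> 0 \<or> f1 z \<noteq> 0"
  shows "a = b \<and> f0 z \<noteq> 0"
proof -
  have e: "f1 z = a * f0 z" "f1 z = b * f0 z" using assms(1,2) by (auto simp: lform_def)
  then have f0: "f0 z \<noteq> 0" using assms(3) by auto
  have "a * f0 z = b * f0 z" using e by (rule trans[OF sym])
  then show ?thesis using f0 by simp
qed

lemma ordat_prod_lform:
  assumes "coprime_pair f0 f1" "finite S" "a \<in> S" "lform f0 f1 a z = 0" "ordat (lform f0 f1 a) z m"
  shows "ordat (\<lambda>w. \<Prod>b\<in>S. lform f0 f1 b w) z m"
proof -
  note d = coprime_pairD[OF assms(1)]
  have "ordat (\<lambda>w. \<Prod>b\<in>S-{a}. lform f0 f1 b w) z 0"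
  proof (rule ordat_0)
    show "entire (\<lambda>w. \<Prod>b\<in>S-{a}. lform f0 f1 b w)" by (intro holomorphic_intros d)
    show "(\<Prod>b\<in>S-{a}. lform f0 f1 b z) \<noteq> 0"
      using assms(2) lform_two_zeros[OF assms(4) _ d(3)] by auto
  qed
  from ordat_mult[OF assms(5) this] show ?thesis
    by (simp add: prod.remove[OF assms(2,3)])
qed

lemma ordat_wronskian_lform_zero:
  assumes "coprime_pair f0 f1" "lform f0 f1 a z = 0" "ordat (lform f0 f1 a) z m"
  shows "1 \<le> m" "f0 z \<noteq> 0" "ordat (wronskian f0 f1) z (m - 1)"
proof -
  note d = coprime_pairD[OF assms(1)]
  show m: "1 \<le> m" using ordat_zero_iff[OF assms(3)] assms(2) by simp
  show f0: "f0 z \<noteq> 0" using lform_two_zeros[OF assms(2,2) d(3)] by simp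
  show "ordat (wronskian f0 f1) z (m - 1)"
    using ordat_wronskian(1)[OF assms(3) m d(1) f0] wronskian_lform[OF d(1,2)] by simp
qed

text \<open>
  The order count behind \<open>order_check\<close>: \<open>mp\<close>, \<open>mb\<close>, \<open>m0\<close>, \<open>mw\<close>, \<open>mM\<close> are the orders of \<open>P(f)\<close>, \<open>Q(f)\<close>, \<open>f0\<close>, \<open>W\<^sub>f\<close>, \<open>MF\<close>,
  and \<open>s\<close> stands for \<open>2 mw + 2 m0 + mb\<close>.
\<close>

lemma order_arith:
  fixes mp mb mM s mp' mb' mM' s' :: nat
  assumes f: "1 \<le> mp \<and> mb = 0 \<and> s + 2 = 2 * mp \<and> mM + 1 = mp \<or> mp = 0 \<and> 1 \<le> mb \<and> 1 \<le> s \<or>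
      mp = 0 \<and> mb = 0 \<and> 2 \<le> s \<or> mp = 0 \<and> mb = 0 \<and> s = 2 * mM"
   and g: "1 \<le> mp' \<and> mb' = 0 \<and> s' + 2 = 2 * mp' \<and> mM' + 1 = mp' \<or> mp' = 0 \<and> 1 \<le> mb' \<and> 1 \<le> s' \<or>
      mp' = 0 \<and> mb' = 0 \<and> 2 \<le> s' \<or> mp' = 0 \<and> mb' = 0 \<and> s' = 2 * mM'"
   and sb: "1 \<le> mb \<longleftrightarrow> 1 \<le> mb'" and sp: "mp = mp' \<or> 3 \<le> mp \<and> 3 \<le> mp'"
  shows "\<not> (mp = 1 \<and> mp' = 1) \<Longrightarrow> mp + mp' \<le> s + s'"
    and "mM + 2 * mp' \<noteq> mM' + 2 * mp \<Longrightarrow> mp + mp' + 2 \<le> s + s'"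
proof -
  show "mp + mp' \<le> s + s'" if n: "\<not> (mp = 1 \<and> mp' = 1)"
  proof (cases "mp = 0")
    case False
    then have "s + 2 = 2 * mp" "s' + 2 = 2 * mp'" "1 \<le> mp" "1 \<le> mp'" using f g sp by auto
    then show ?thesis using n sp by auto
  qed (use sp in auto)
  show "mp + mp' + 2 \<le> s + s'" if n: "mM + 2 * mp' \<noteq> mM' + 2 * mp"
  proof (cases "mp = 0")
    case False
    then have "s + 2 = 2 * mp" "s' + 2 = 2 * mp'" "mM + 1 = mp" "mM' + 1 = mp'" using f g sp by auto
    \<comment> \<open>Weight two enters here: unequal orders are at least 3, so mp + mp' \<ge> 6 and
      2 (mp + mp') - 4 \<ge> mp + mp' + 2.\<close>
    moreover have "mp \<noteq> mp'" using n calculation by auto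
    ultimately show ?thesis using sp by auto
  next
    case True
    then have "mp' = 0" using sp by auto
    \<comment> \<open>Order 2 is reached by two shared beta-points (1 + 1), by a pole of one
      function, or, since now mM and mM' differ, by twice the positive one of them.\<close>
    then show ?thesis using f g n sb True by auto
  qed
qed
lemma order_sum_cases:
  fixes mp mb m0 mw mM :: nat
  assumes "1 \<le> mp \<and> mb = 0 \<and> m0 = 0 \<and> mw = mp - 1 \<and> mM = mp - 1 \<or>
      mp = 0 \<and> 1 \<le> mb \<and> m0 = 0 \<and> mw = mb - 1 \<or>
      mp = 0 \<and> mb = 0 \<and> 1 \<le> m0 \<and> mw = m0 - 1 \<or>
      mp = 0 \<and> mb = 0 \<and> m0 = 0 \<and> mM = mw"
  shows "1 \<le> mp \<and> mb = 0 \<and> (2 * mw + 2 * m0 + mb) + 2 = 2 * mp \<and> mM + 1 = mp \<or> mp = 0 \<and> 1 \<le> mb \<and> 1 \<le> 2 * mw + 2 * m0 + mb \<or>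
      mp = 0 \<and> mb = 0 \<and> 2 \<le> 2 * mw + 2 * m0 + mb \<or> mp = 0 \<and> mb = 0 \<and> 2 * mw + 2 * m0 + mb = 2 * mM"
  using assms by auto

context split_poly
begin

lemma pole_nonzero:
  assumes "coprime_pair f0 f1" "f0 z = 0"
  shows "pA f0 f1 z \<noteq> 0" "pB f0 f1 z \<noteq> 0"
  using coprime_pairD(3)[OF assms(1), of z] assms(2) finA finB a0 by (auto simp: pA_def pB_def lform_def)

lemma nontrivial:
  assumes "coprime_pair f0 f1"
  shows "\<exists>w. pA f0 f1 w \<noteq> 0" "\<exists>w. pB f0 f1 w \<noteq> 0" "\<exists>w. MF f0 f1 w \<noteq> 0"
proof -
  note d = coprime_pairD[OF assms]
  let ?Z = "{f0, wronskian f0 f1} \<union> lform f0 f1 ` A \<union> lform f0 f1 ` B"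
  have Z: "finite ?Z" "\<And>e. e \<in> ?Z \<Longrightarrow> entire e \<and> (\<exists>w. e w \<noteq> 0)"
    using finA finB d by (auto intro!: holomorphic_intros)
  from entire_common_nonzero[OF Z] obtain c where c: "\<forall>e\<in>?Z. e c \<noteq> 0" ..
  have c': "f0 c \<noteq> 0" "wronskian f0 f1 c \<noteq> 0" "\<And>a. a \<in> A \<Longrightarrow> lform f0 f1 a c \<noteq> 0" "\<And>a. a \<in> B \<Longrightarrow> lform f0 f1 a c \<noteq> 0"
    using c by auto
  show "\<exists>w. pA f0 f1 w \<noteq> 0" using c' finA a0 by (intro exI[of _ c]) (auto simp: pA_def)
  show "\<exists>w. pB f0 f1 w \<noteq> 0" using c' finB by (intro exI[of _ c]) (auto simp: pB_def)
  have "MF f0 f1 c \<noteq> 0" unfolding MF_eq[OF d(1,2) c'(1)] using c' b0 finB by auto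
  then show "\<exists>w. MF f0 f1 w \<noteq> 0" by blast
qed

text \<open>A point is an alpha-point, a beta-point, a pole, or none of these. The cases exclude
  each other because two different forms have no common zero, \<open>A\<close> and \<open>B\<close>
  are disjoint, and at a pole no form vanishes.\<close>

lemma local_orders:
  assumes cp: "coprime_pair f0 f1"
  shows "\<exists>mp mb m0 mw mM. ordat (pA f0 f1) z mp \<and> ordat (pB f0 f1) z mb \<and> ordat f0 z m0 \<and>
     ordat (wronskian f0 f1) z mw \<and> ordat (MF f0 f1) z mM \<and>
     (1 \<le> mp \<and> mb = 0 \<and> m0 = 0 \<and> mw = mp - 1 \<and> mM = mp - 1 \<or>
      mp = 0 \<and> 1 \<le> mb \<and> m0 = 0 \<and> mw = mb - 1 \<or>
      mp = 0 \<and> mb = 0 \<and> 1 \<le> m0 \<and> mw = m0 - 1 \<or>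
      mp = 0 \<and> mb = 0 \<and> m0 = 0 \<and> mM = mw)"
proof -
  note d = coprime_pairD[OF cp]
  have hW: "entire (wronskian f0 f1)" by (intro holomorphic_intros d)
  have hP: "entire (pA f0 f1)" "entire (pB f0 f1)" "entire (MF f0 f1)"
    using d by (auto intro: pA_holomorphic pB_holomorphic MF_holomorphic)
  obtain w0 where w0: "f0 w0 \<noteq> 0" using d(4) by blast
  obtain mM where mM: "ordat (MF f0 f1) z mM" using nontrivial(3)[OF cp] ordat_exists[OF hP(3)] by blast
  have eMF: "MF f0 f1 = (\<lambda>w. wronskian f0 f1 w * (- b0 * (\<Prod>b\<in>B. lform f0 f1 b w ^ q b) * f0 w ^ (card A - 1)))"
    by (rule ext) (simp add: MF_eq[OF d(1,2) w0])
  have MFW: "ordat (MF f0 f1) z m" if m: "ordat (wronskian f0 f1) z m" and "f0 z \<noteq> 0" "pB f0 f1 z \<noteq> 0" for m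
  proof -
    have "ordat (\<lambda>w. - b0 * (\<Prod>b\<in>B. lform f0 f1 b w ^ q b) * f0 w ^ (card A - 1)) z 0"
      using that(2,3) finB b0 by (intro ordat_0 holomorphic_intros d) (auto simp: pB_def)
    from ordat_mult[OF m this] show ?thesis unfolding eMF by simp
  qed
  consider (A) a where "a \<in> A" "lform f0 f1 a z = 0" | (B) b where "b \<in> B" "lform f0 f1 b z = 0"
    | (pole) "f0 z = 0" | (other) "f0 z \<noteq> 0" "pA f0 f1 z \<noteq> 0" "pB f0 f1 z \<noteq> 0"
    using finA finB a0 by (auto simp: pA_def pB_def)
  then show ?thesis
  proof cases
    case A
    obtain m where m: "ordat (lform f0 f1 a) z m"
      using ordat_exists[of "lform f0 f1 a"] d(5) by (metis lform_holomorphic d(1,2))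
    note w = ordat_wronskian_lform_zero[OF cp A(2) m]
    have pB: "pB f0 f1 z \<noteq> 0"
      using lform_two_zeros[OF A(2) _ d(3)] disjoint A(1) finB by (auto simp: pB_def)
    have "ordat (pA f0 f1) z m"
      unfolding pA_def using ordat_cmult[OF ordat_prod_lform[OF cp finA A m] a0] .
    then show ?thesis using w pB MFW[OF w(3) w(2) pB] ordat_0[OF hP(2) pB] ordat_0[OF d(1) w(2)] by blast
  next
    case B
    obtain m where m: "ordat (lform f0 f1 b) z m"
      using ordat_exists[of "lform f0 f1 b"] d(5) by (metis lform_holomorphic d(1,2))
    note w = ordat_wronskian_lform_zero[OF cp B(2) m]
    have pA: "pA f0 f1 z \<noteq> 0"
      using lform_two_zeros[OF B(2) _ d(3)] disjoint B(1) finA a0 by (auto simp: pA_def)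
    have "ordat (pB f0 f1) z m"
      unfolding pB_def using ordat_prod_lform[OF cp finB B m] .
    then show ?thesis using w pA mM ordat_0[OF hP(1) pA] ordat_0[OF d(1) w(2)] by blast
  next
    case pole
    obtain m where m: "ordat f0 z m" using ordat_exists[OF d(1) w0] by blast
    have m1: "1 \<le> m" using ordat_zero_iff[OF m] pole by simp
    have f1: "f1 z \<noteq> 0" using d(3)[of z] pole by simp
    show ?thesis
      using m m1 mM ordat_wronskian(2)[OF m m1 d(2) f1] ordat_0[OF hP(1) pole_nonzero(1)[OF cp pole]]
        ordat_0[OF hP(2) pole_nonzero(2)[OF cp pole]] by blast
  next
    case other
    obtain m where m: "ordat (wronskian f0 f1) z m" using ordat_exists[OF hW] d(6) by blast
    show ?thesis
      using m MFW[OF m other(1,3)] ordat_0[OF hP(1) other(2)] ordat_0[OF hP(2) other(3)] ordat_0[OF d(1) other(1)] by blast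
  qed
qed

text \<open>
  The quotient of \<open>e1 f0 f1 g0 g1\<close> by \<open>e1 g0 g1 f0 f1\<close> is \<open>F' / G'\<close> for \<open>F = 1 / P(f)\<close> and \<open>G = 1 / P(g)\<close>,
  and the quotient of \<open>num\<close> by \<open>den\<close> is the function \<open>Y\<close> of the introduction.
\<close>

definition "e1 f0 f1 g0 g1 w = MF f0 f1 w * pA g0 g1 w ^ 2"

definition "num f0 f1 g0 g1 w = (wronskian (e1 g0 g1 f0 f1) (e1 f0 f1 g0 g1) w) ^ 2 *
   (wronskian f0 f1 w ^ 2 * wronskian g0 g1 w ^ 2 * (f0 w * g0 w) ^ 2 * (pB f0 f1 w * pB g0 g1 w))"

definition "den f0 f1 g0 g1 w = (e1 f0 f1 g0 g1 w * e1 g0 g1 f0 f1 w) ^ 2 * (pA f0 f1 w * pA g0 g1 w)"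

lemma vanat_square: "vanat u z m \<Longrightarrow> vanat (\<lambda>w. u w ^ 2) z (2 * m)"
  using vanat_mult[of u z m u m] by (simp add: power2_eq_square mult_2)

text \<open>The local condition under which \<open>num / den\<close> extends to an entire function.
  \<open>H\<close> has a pole only where the orders \<open>E1\<close> and \<open>E0\<close> of
  numerator and denominator of F' / G' differ.\<close>

lemma order_check:
  assumes cf: "coprime_pair f0 f1" and cg: "coprime_pair g0 g1"
    and sh1: "\<And>z m m'. \<lbrakk>ordat (pA f0 f1) z m; ordat (pA g0 g1) z m'\<rbrakk> \<Longrightarrow> m = m' \<or> 3 \<le> m \<and> 3 \<le> m'"
    and sh2: "\<And>z. pB f0 f1 z = 0 \<longleftrightarrow> pB g0 g1 z = 0"
  shows "\<exists>d. ordat (den f0 f1 g0 g1) z d \<and> vanat (num f0 f1 g0 g1) z d"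
proof -
  obtain mp mb m0 mw mM where f: "ordat (pA f0 f1) z mp" "ordat (pB f0 f1) z mb" "ordat f0 z m0"
     "ordat (wronskian f0 f1) z mw" "ordat (MF f0 f1) z mM"
    and cases_f: "1 \<le> mp \<and> mb = 0 \<and> m0 = 0 \<and> mw = mp - 1 \<and> mM = mp - 1 \<or>
      mp = 0 \<and> 1 \<le> mb \<and> m0 = 0 \<and> mw = mb - 1 \<or>
      mp = 0 \<and> mb = 0 \<and> 1 \<le> m0 \<and> mw = m0 - 1 \<or>
      mp = 0 \<and> mb = 0 \<and> m0 = 0 \<and> mM = mw"
    using local_orders[OF cf, of z] by (elim exE conjE) 
  obtain mp' mb' m0' mw' mM' where g: "ordat (pA g0 g1) z mp'" "ordat (pB g0 g1) z mb'" "ordat g0 z m0'"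
     "ordat (wronskian g0 g1) z mw'" "ordat (MF g0 g1) z mM'"
    and cases_g: "1 \<le> mp' \<and> mb' = 0 \<and> m0' = 0 \<and> mw' = mp' - 1 \<and> mM' = mp' - 1 \<or>
      mp' = 0 \<and> 1 \<le> mb' \<and> m0' = 0 \<and> mw' = mb' - 1 \<or>
      mp' = 0 \<and> mb' = 0 \<and> 1 \<le> m0' \<and> mw' = m0' - 1 \<or>
      mp' = 0 \<and> mb' = 0 \<and> m0' = 0 \<and> mM' = mw'"
    using local_orders[OF cg, of z] by (elim exE conjE) 
  have sb: "1 \<le> mb \<longleftrightarrow> 1 \<le> mb'" using sh2[of z] ordat_zero_iff[OF f(2)] ordat_zero_iff[OF g(2)] by simp
  have sp: "mp = mp' \<or> 3 \<le> mp \<and> 3 \<le> mp'" by (rule sh1[OF f(1) g(1)])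
  define E1 where "E1 = mM + 2 * mp'"
  define E0 where "E0 = mM' + 2 * mp"
  have o1: "ordat (e1 f0 f1 g0 g1) z E1" unfolding e1_def E1_def by (intro ordat_mult ordat_power f g)
  have o0: "ordat (e1 g0 g1 f0 f1) z E0" unfolding e1_def E0_def by (intro ordat_mult ordat_power f g)
  have den: "ordat (den f0 f1 g0 g1) z (2 * (E1 + E0) + (mp + mp'))"
    unfolding den_def by (intro ordat_mult ordat_power o1 o0 f g)
  have numv: "vanat (num f0 f1 g0 g1) z (2 * v + (2 * mw + 2 * mw' + 2 * (m0 + m0') + (mb + mb')))"
    if "vanat (wronskian (e1 g0 g1 f0 f1) (e1 f0 f1 g0 g1)) z v" for v
    unfolding num_def by (intro vanat_mult vanat_square that) (use f g in \<open>auto intro: ordat_imp_vanat\<close>)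
  have fin: "?thesis" if "vanat (wronskian (e1 g0 g1 f0 f1) (e1 f0 f1 g0 g1)) z v"
     "2 * (E1 + E0) + (mp + mp') \<le> 2 * v + (2 * mw + 2 * mw' + 2 * (m0 + m0') + (mb + mb'))" for v
    using den vanat_le[OF numv[OF that(1)] that(2)] by blast
  define rest where "rest = 2 * mw + 2 * mw' + 2 * (m0 + m0') + (mb + mb')"
  note ar = order_arith[OF order_sum_cases[OF cases_f] order_sum_cases[OF cases_g] sb sp]
  have r1: "mp + mp' \<le> rest" if "\<not> (mp = 1 \<and> mp' = 1)"
    using ar(1)[OF that] unfolding rest_def by simp
  have r2: "mp + mp' + 2 \<le> rest" if "E1 \<noteq> E0"
    using ar(2)[OF that[unfolded E1_def E0_def]] unfolding rest_def by simp
  consider (simple) "mp = 1" "mp' = 1" | (same) "\<not> (mp = 1 \<and> mp' = 1)" "E1 = E0" | (diff) "\<not> (mp = 1 \<and> mp' = 1)" "E1 \<noteq> E0" by blast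
  then show ?thesis
  proof cases
    \<comment> \<open>Here E1 = E0 = 2, so \<open>den\<close> has order 2 (2 + 2) + 2 = 10, which
      the squared Wronskian of order at least 5 supplies.\<close>
    case simple
    note df = coprime_pairD[OF cf] and dg = coprime_pairD[OF cg]
    have "vanat (wronskian (\<lambda>w. wronskian (pA g0 g1) (\<lambda>w. g0 w ^ card A) w * pA f0 f1 w ^ 2)
       (\<lambda>w. wronskian (pA f0 f1) (\<lambda>w. f0 w ^ card A) w * pA g0 g1 w ^ 2)) z 5"
      by (rule vanat_wronskian_simple_zeros) (use simple f g in \<open>auto intro!: holomorphic_intros df dg\<close>)
    then have "vanat (wronskian (e1 g0 g1 f0 f1) (e1 f0 f1 g0 g1)) z 5"
      by (simp add: e1_def[abs_def] MF_def)
    then show ?thesis by (rule fin) (use simple ar cases_f cases_g in \<open>auto simp: E1_def E0_def\<close>)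
  next
    case same
    have "vanat (wronskian (e1 g0 g1 f0 f1) (e1 f0 f1 g0 g1)) z (E1 + E1)"
      using vanat_wronskian_same[OF o1] o0 same by simp
    then show ?thesis by (rule fin) (use same(2) r1[OF same(1)] in \<open>simp add: rest_def\<close>)
  next
    case diff
    have "vanat (wronskian (e1 g0 g1 f0 f1) (e1 f0 f1 g0 g1)) z (E1 + E0 - 1)"
      by (rule vanat_wronskian[OF o1 o0])
    then show ?thesis by (rule fin) (use diff(2) r2[OF diff(2)] in \<open>simp add: rest_def\<close>)
  qed
qed

end

section \<open>The case in which H does not vanish identically\<close>

context split_poly
begin

lemma ln_pA_le:
  assumes "f0 z \<noteq> 0 \<or> f1 z \<noteq> 0" "pA f0 f1 z \<noteq> 0"
  shows "ln (norm (pA f0 f1 z)) = ln (norm a0) + (\<Sum>a\<in>A. ln (norm (lform f0 f1 a z)))"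
    and "ln (norm (pA f0 f1 z)) \<le> card A * lnmax f0 f1 z + \<bar>ln (norm a0)\<bar> + (\<Sum>a\<in>A. norm a)"
proof -
  have nz: "lform f0 f1 a z \<noteq> 0" if "a \<in> A" for a using assms(2) that finA by (auto simp: pA_def)
  show e: "ln (norm (pA f0 f1 z)) = ln (norm a0) + (\<Sum>a\<in>A. ln (norm (lform f0 f1 a z)))"
    using a0 nz finA by (simp add: pA_def norm_mult ln_mult prod_norm[symmetric] ln_prod)
  have "(\<Sum>a\<in>A. ln (norm (lform f0 f1 a z))) \<le> (\<Sum>a\<in>A. lnmax f0 f1 z + norm a)"
    by (intro sum_mono ln_norm_lform_le assms(1) nz)
  then show "ln (norm (pA f0 f1 z)) \<le> card A * lnmax f0 f1 z + \<bar>ln (norm a0)\<bar> + (\<Sum>a\<in>A. norm a)"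
    unfolding e by (simp add: sum.distrib)
qed

lemma ln_pB_le:
  assumes "f0 z \<noteq> 0 \<or> f1 z \<noteq> 0" "pB f0 f1 z \<noteq> 0"
  shows "ln (norm (pB f0 f1 z)) = (\<Sum>a\<in>B. ln (norm (lform f0 f1 a z)))"
    and "ln (norm (pB f0 f1 z)) \<le> card B * lnmax f0 f1 z + (\<Sum>a\<in>B. norm a)"
proof -
  have nz: "lform f0 f1 a z \<noteq> 0" if "a \<in> B" for a using assms(2) that finB by (auto simp: pB_def)
  show e: "ln (norm (pB f0 f1 z)) = (\<Sum>a\<in>B. ln (norm (lform f0 f1 a z)))"
    using nz finB by (simp add: pB_def prod_norm[symmetric] ln_prod)
  have "(\<Sum>a\<in>B. ln (norm (lform f0 f1 a z))) \<le> (\<Sum>a\<in>B. lnmax f0 f1 z + norm a)"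
    by (intro sum_mono ln_norm_lform_le assms(1) nz)
  then show "ln (norm (pB f0 f1 z)) \<le> card B * lnmax f0 f1 z + (\<Sum>a\<in>B. norm a)"
    unfolding e by (simp add: sum.distrib)
qed

text \<open>The coefficient 2 card A is the sum of card A - 1 from the beta-product
  (\<open>sum_q\<close>), card A - 1 from the power of f0, and 2 from the Wronskian, which is
  estimated through one form and f0.\<close>

lemma ln_MF_le:
  assumes cp: "coprime_pair f0 f1" and f0: "f0 z \<noteq> 0" and MF: "MF f0 f1 z \<noteq> 0" and B: "0 < M" and a: "a \<in> A"
    and L: "lform f0 f1 a z \<noteq> 0" and W: "norm (wronskian f0 f1 z) \<le> M * norm (lform f0 f1 a z * f0 z)"
  shows "ln (norm (MF f0 f1 z)) \<le> 2 * card A * lnmax f0 f1 z + \<bar>ln (norm b0)\<bar> + (\<Sum>b\<in>B. q b * norm b) + (\<Sum>a\<in>A. norm a) + ln M"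
proof -
  note d = coprime_pairD[OF cp]
  note e = MF_eq[OF d(1,2) f0, of z]
  let ?u = "lnmax f0 f1 z"
  have nz: "wronskian f0 f1 z \<noteq> 0" "\<And>b. b \<in> B \<Longrightarrow> lform f0 f1 b z \<noteq> 0"
    using MF q_pos finB unfolding e by (auto simp: prod_zero_iff) 
  have lf: "ln (norm (f0 z)) \<le> ?u" by (rule ln_norm_le_lnmax[of f0 z f1, OF f0])
  have "ln (norm (wronskian f0 f1 z)) \<le> ln (M * norm (lform f0 f1 a z * f0 z))"
    using W nz by (intro ln_mono) auto
  also have "\<dots> = ln M + ln (norm (lform f0 f1 a z)) + ln (norm (f0 z))"
    using B L f0 by (simp add: norm_mult ln_mult)
  also have "\<dots> \<le> ln M + (?u + norm a) + ?u"
    by (intro add_mono lf ln_norm_lform_le L d(3)) simp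
  also have "norm a \<le> (\<Sum>a\<in>A. norm a)" using a finA by (intro member_le_sum) auto
  finally have lW: "ln (norm (wronskian f0 f1 z)) \<le> ln M + 2 * ?u + (\<Sum>a\<in>A. norm a)" by simp
  have "ln (norm (\<Prod>b\<in>B. lform f0 f1 b z ^ q b)) = (\<Sum>b\<in>B. q b * ln (norm (lform f0 f1 b z)))"
    using nz(2) finB by (simp add: prod_norm[symmetric] norm_power ln_prod ln_realpow)
  also have "\<dots> \<le> (\<Sum>b\<in>B. q b * (?u + norm b))"
    by (intro sum_mono mult_left_mono ln_norm_lform_le d(3) nz) auto
  also have "\<dots> = real (\<Sum>b\<in>B. q b) * ?u + (\<Sum>b\<in>B. q b * norm b)"
    by (simp add: distrib_left sum.distrib sum_distrib_right)
  finally have lB: "ln (norm (\<Prod>b\<in>B. lform f0 f1 b z ^ q b)) \<le> real (card A - 1) * ?u + (\<Sum>b\<in>B. q b * norm b)"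
    unfolding sum_q .
  have "ln (norm (MF f0 f1 z)) = ln (norm b0) + ln (norm (\<Prod>b\<in>B. lform f0 f1 b z ^ q b)) + ln (norm (wronskian f0 f1 z)) + real (card A - 1) * ln (norm (f0 z))"
    unfolding e using b0 nz finB f0 by (simp add: norm_mult ln_mult norm_power ln_realpow)
  moreover have "real (card A - 1) * ln (norm (f0 z)) \<le> real (card A - 1) * ?u" by (intro mult_left_mono lf) auto
  ultimately have "ln (norm (MF f0 f1 z)) \<le> \<bar>ln (norm b0)\<bar> + (real (card A - 1) * ?u + (\<Sum>b\<in>B. q b * norm b)) + (ln M + 2 * ?u + (\<Sum>a\<in>A. norm a)) + real (card A - 1) * ?u"
    using lB lW by linarith
  also have "real (card A - 1) = real (card A) - 1" using card_A by (simp add: of_nat_diff)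
  finally show ?thesis by (simp add: algebra_simps)
qed

text \<open>The parameter \<open>\<epsilon>\<close> treats both versions at once:
  \<open>\<epsilon> = 1\<close> holds for every pair, \<open>\<epsilon> = 0\<close> for pairs with
  denominator 1.\<close>

lemma wronskian_e1_vanishes:
  assumes cf: "coprime_pair f0 f1" and cg: "coprime_pair g0 g1"
    and sh1: "\<And>z m m'. \<lbrakk>ordat (pA f0 f1) z m; ordat (pA g0 g1) z m'\<rbrakk> \<Longrightarrow> m = m' \<or> 3 \<le> m \<and> 3 \<le> m'"
    and sh2: "\<And>z. pB f0 f1 z = 0 \<longleftrightarrow> pB g0 g1 z = 0"
    and ef: "\<And>z. f0 z \<noteq> 0 \<Longrightarrow> ln (norm (f0 z)) \<le> \<epsilon> * lnmax f0 f1 z"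
    and eg: "\<And>z. g0 z \<noteq> 0 \<Longrightarrow> ln (norm (g0 z)) \<le> \<epsilon> * lnmax g0 g1 z"
    and size: "real (card B) + 2 + 4 * \<epsilon> < card A"
  shows "wronskian (e1 g0 g1 f0 f1) (e1 f0 f1 g0 g1) w = 0"
proof (rule ccontr)
  assume nzw: "wronskian (e1 g0 g1 f0 f1) (e1 f0 f1 g0 g1) w \<noteq> 0"
  define E1 where "E1 = e1 f0 f1 g0 g1"
  define E0 where "E0 = e1 g0 g1 f0 f1"
  note df = coprime_pairD[OF cf] and dg = coprime_pairD[OF cg]
  note hol = df(1,2) dg(1,2)
  have hpol: "entire (pA f0 f1)" "entire (pA g0 g1)" "entire (pB f0 f1)" "entire (pB g0 g1)"
     "entire (MF f0 f1)" "entire (MF g0 g1)"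
    by (intro pA_holomorphic pB_holomorphic MF_holomorphic hol)+
  have hE: "entire E1" "entire E0"
    unfolding E1_def E0_def e1_def[abs_def] by (intro holomorphic_intros hpol)+
  have hnum: "entire (num f0 f1 g0 g1)" and hden: "entire (den f0 f1 g0 g1)"
    unfolding num_def[abs_def] den_def[abs_def] E1_def[symmetric] E0_def[symmetric] by (intro holomorphic_intros hpol hE hol)+
  let ?Z = "{wronskian E0 E1, wronskian f0 f1, wronskian g0 g1, f0, g0, pB f0 f1, pB g0 g1, pA f0 f1, pA g0 g1, MF f0 f1, MF g0 g1}"
  have "\<exists>c. \<forall>e\<in>?Z. e c \<noteq> 0"
  proof (rule entire_common_nonzero)
    fix e assume "e \<in> ?Z"
    then show "entire e \<and> (\<exists>w. e w \<noteq> 0)"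
      using nzw df dg nontrivial[OF cf] nontrivial[OF cg] hpol hE
      unfolding E1_def[symmetric] E0_def[symmetric] by (auto intro!: holomorphic_intros)
  qed simp
  then obtain c where c: "\<forall>e\<in>?Z. e c \<noteq> 0" ..
  have numc: "num f0 f1 g0 g1 c \<noteq> 0" and denc: "den f0 f1 g0 g1 c \<noteq> 0"
    using c unfolding num_def den_def E1_def[symmetric] E0_def[symmetric] by (auto simp: E1_def E0_def e1_def)
  have loc: "\<exists>d. ordat (den f0 f1 g0 g1) z d \<and> vanat (num f0 f1 g0 g1) z d" for z
    by (rule order_check[OF cf cg sh1 sh2])
  obtain Y where Y: "entire Y" "\<And>w. num f0 f1 g0 g1 w = Y w * den f0 f1 g0 g1 w"
    using entire_quotient[OF hnum hden denc loc] by blast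
  define S where "S = A \<union> B"
  have S: "finite S" "S \<noteq> {}" using finA finB A_ne by (auto simp: S_def)
  have cS: "card S = card A + card B" unfolding S_def using disjoint by (intro card_Un_disjoint finA finB)
  obtain C1 where C1: "0 \<le> C1" and smt: "\<And>x y (W::complex) (M::real). \<lbrakk>0 < M; x \<noteq> 0; W \<noteq> 0; \<And>a. a \<in> S \<Longrightarrow> y - a * x \<noteq> 0 \<and> norm W \<le> M * norm ((y - a * x) * x)\<rbrakk> \<Longrightarrow>
     (real (card S) - 1) * ln (max (norm x) (norm y)) + ln (norm W) \<le>
       ln (norm x) + (\<Sum>a\<in>S. ln (norm (y - a * x))) + ln M + C1"
    using second_main_theorem_pointwise[OF S] by metis
  define la where "la = \<bar>ln (norm a0)\<bar>"
  define KA where "KA = (\<Sum>a\<in>A. norm a)"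
  define KB where "KB = (\<Sum>a\<in>B. norm a)"
  define Kq where "Kq = \<bar>ln (norm b0)\<bar> + (\<Sum>b\<in>B. q b * norm b)"
  define n where "n = real (card A)"
  define k where "k = real (card B)"
  define CY where "CY = 4 * C1 + 6 * la + 2 * KA + 6 * KB"
  define Ce where "Ce = Kq + 3 * KA + 2 * la"
  define C where "C = 6 + CY + Ce"
  have nn: "0 \<le> la" "0 \<le> KA" "0 \<le> KB" "0 \<le> Kq"
    by (auto simp: la_def KA_def KB_def Kq_def intro!: sum_nonneg add_nonneg_nonneg)
  have C: "0 \<le> C" "6 \<le> C" "CY \<le> C" "Ce \<le> C" using nn C1 by (auto simp: C_def CY_def Ce_def)
  obtain a' where a': "a' \<in> A" using A_ne by blast
  have smt': "(n + k - 1) * lnmax h0 h1 z + ln (norm (wronskian h0 h1 z)) \<le>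
      ln (norm (h0 z)) + ln (norm (pA h0 h1 z)) + la + ln (norm (pB h0 h1 z)) + ln M + C1"
    if "coprime_pair h0 h1" "1 \<le> M" "h0 z \<noteq> 0" "wronskian h0 h1 z \<noteq> 0"
      and l: "\<And>a. a \<in> S \<Longrightarrow> lform h0 h1 a z \<noteq> 0 \<and> norm (wronskian h0 h1 z) \<le> M * norm (lform h0 h1 a z * h0 z)" for h0 h1 M z
  proof -
    have pn: "pA h0 h1 z \<noteq> 0" "pB h0 h1 z \<noteq> 0" using l a0 finA finB by (auto simp: pA_def pB_def S_def)
    note d = coprime_pairD[OF that(1)]
    have "(real (card S) - 1) * ln (max (norm (h0 z)) (norm (h1 z))) + ln (norm (wronskian h0 h1 z)) \<le>
       ln (norm (h0 z)) + (\<Sum>a\<in>S. ln (norm (h1 z - a * h0 z))) + ln M + C1"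
      by (rule smt[of M "h0 z" "wronskian h0 h1 z" "h1 z"])
         (use that in \<open>auto simp: lform_def\<close>)
    moreover have "real (card S) - 1 = n + k - 1" by (simp add: cS n_def k_def)
    moreover have "(\<Sum>a\<in>S. ln (norm (h1 z - a * h0 z))) = (\<Sum>a\<in>A. ln (norm (lform h0 h1 a z))) + (\<Sum>a\<in>B. ln (norm (lform h0 h1 a z)))"
      unfolding S_def lform_def by (rule sum.union_disjoint[OF finA finB disjoint])
    moreover define t where "t = (n + k - 1) * lnmax h0 h1 z"
    ultimately have "t + ln (norm (wronskian h0 h1 z)) \<le> ln (norm (h0 z)) + ((\<Sum>a\<in>A. ln (norm (lform h0 h1 a z))) + (\<Sum>a\<in>B. ln (norm (lform h0 h1 a z)))) + ln M + C1"
      by (simp only: lnmax_def)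
    then show ?thesis unfolding t_def[symmetric] using ln_pA_le(1)[OF d(3) pn(1)] ln_pB_le(1)[OF d(3) pn(2)]
      unfolding la_def by linarith
  qed
  have bound_e: "ln (norm (e1 h0 h1 k0 k1 z)) \<le> (2 * n) * (lnmax h0 h1 z + lnmax k0 k1 z) + C + C * ln M"
    if ch: "coprime_pair h0 h1" and ck: "coprime_pair k0 k1" and M: "1 \<le> M" and h0: "h0 z \<noteq> 0" and e: "e1 h0 h1 k0 k1 z \<noteq> 0"
      and l: "lform h0 h1 a' z \<noteq> 0" "norm (wronskian h0 h1 z) \<le> M * norm (lform h0 h1 a' z * h0 z)" for h0 h1 k0 k1 M z
  proof -
    have nz: "MF h0 h1 z \<noteq> 0" "pA k0 k1 z \<noteq> 0" using e by (auto simp: e1_def)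
    have 1: "ln (norm (MF h0 h1 z)) \<le> 2 * n * lnmax h0 h1 z + Kq + KA + ln M"
      using ln_MF_le[OF ch h0 nz(1) _ a' l] M by (simp add: n_def Kq_def KA_def)
    have 2: "ln (norm (pA k0 k1 z)) \<le> n * lnmax k0 k1 z + la + KA"
      using ln_pA_le(2)[OF coprime_pairD(3)[OF ck] nz(2)] by (simp add: n_def la_def KA_def)
    have "ln (norm (e1 h0 h1 k0 k1 z)) = ln (norm (MF h0 h1 z)) + 2 * ln (norm (pA k0 k1 z))"
      using nz by (simp add: e1_def norm_mult ln_mult norm_power ln_realpow)
    also have "\<dots> \<le> (2 * n * lnmax h0 h1 z + Kq + KA + ln M) + 2 * (n * lnmax k0 k1 z + la + KA)"
      by (intro add_mono mult_left_mono 1 2) simp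
    also have "\<dots> = (2 * n) * (lnmax h0 h1 z + lnmax k0 k1 z) + Ce + 1 * ln M" by (simp add: Ce_def algebra_simps)
    also have "\<dots> \<le> (2 * n) * (lnmax h0 h1 z + lnmax k0 k1 z) + C + C * ln M"
      using C M by (intro add_mono[OF add_left_mono mult_right_mono]) auto
    finally show ?thesis .
  qed
  obtain z1 z2 where z12: "f0 z1 * f1 z2 \<noteq> f1 z1 * f0 z2" using cf unfolding coprime_pair_def by blast
  \<comment> \<open>\<open>ln \<bar>Y\<bar>\<close> contains each Wronskian twice. By the second
    main theorem for the n + k values of \<open>A\<close> and \<open>B\<close> these two are
    replaced by 2 (ln |f0| + ln |P(f)| + ln |Q(f)|) - 2 (n + k - 1) \<open>lnmax\<close>. Together
    with the other factors of \<open>Y\<close> this makes 4 ln |f0| + ln |P(f)| + 3 ln |Q(f)|, so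
    the coefficient of \<open>lnmax\<close> is 4 \<epsilon> + n + 3 k - 2 (n + k - 1) =
    -\<kappa>.\<close>
  define \<kappa> where "\<kappa> = n - k - 2 - 4 * \<epsilon>"
  have \<kappa>: "0 < \<kappa>" using size by (simp add: \<kappa>_def n_def k_def)
  have nzc: "f0 c \<noteq> 0" "g0 c \<noteq> 0" "E1 c \<noteq> 0" "E0 c \<noteq> 0" "Y c \<noteq> 0"
    using c numc Y(2)[of c] by (auto simp: E1_def E0_def e1_def)
  show False
  proof (rule nevanlinna_contradiction[OF hol hE Y(1) df(3) dg(3) S z12 nzc df(5) dg(5) \<kappa>, where d = "2 * n" and C = C])
    fix z M
    assume M: "1 \<le> M" and z: "f0 z \<noteq> 0" "g0 z \<noteq> 0" "E1 z \<noteq> 0" "E0 z \<noteq> 0"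
      and lf: "\<And>a. a \<in> S \<Longrightarrow> lform f0 f1 a z \<noteq> 0 \<and> norm (wronskian f0 f1 z) \<le> M * norm (lform f0 f1 a z * f0 z)"
      and lg: "\<And>a. a \<in> S \<Longrightarrow> lform g0 g1 a z \<noteq> 0 \<and> norm (wronskian g0 g1 z) \<le> M * norm (lform g0 g1 a z * g0 z)"
    have a'S: "a' \<in> S" using a' by (simp add: S_def)
    have "ln (norm (E0 z)) \<le> (2 * n) * (lnmax g0 g1 z + lnmax f0 f1 z) + C + C * ln M"
      unfolding E0_def by (rule bound_e[OF cg cf M z(2)]) (use lg[OF a'S] z in \<open>auto simp: E0_def\<close>)
    moreover have "ln (norm (E1 z)) \<le> (2 * n) * (lnmax f0 f1 z + lnmax g0 g1 z) + C + C * ln M"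
      unfolding E1_def by (rule bound_e[OF cf cg M z(1)]) (use lf[OF a'S] z in \<open>auto simp: E1_def\<close>)
    ultimately show "ln (norm (E1 z)) \<le> (2 * n) * (lnmax f0 f1 z + lnmax g0 g1 z) + C + C * ln M \<and>
       ln (norm (E0 z)) \<le> (2 * n) * (lnmax f0 f1 z + lnmax g0 g1 z) + C + C * ln M" by (simp add: add.commute)
    assume Yz: "Y z \<noteq> 0" and H: "norm (deriv E1 z / E1 z - deriv E0 z / E0 z) \<le> M"
    have pn: "pA f0 f1 z \<noteq> 0" "pB f0 f1 z \<noteq> 0" "pA g0 g1 z \<noteq> 0" "pB g0 g1 z \<noteq> 0"
      using lf lg a0 finA finB by (auto simp: pA_def pB_def S_def)
    have denz: "den f0 f1 g0 g1 z \<noteq> 0" using z pn unfolding den_def E1_def[symmetric] E0_def[symmetric] by simp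
    then have numz: "num f0 f1 g0 g1 z \<noteq> 0" using Y(2)[of z] Yz by simp
    then have wz: "wronskian E0 E1 z \<noteq> 0" "wronskian f0 f1 z \<noteq> 0" "wronskian g0 g1 z \<noteq> 0"
      unfolding num_def E1_def[symmetric] E0_def[symmetric] by auto
    define wh where "wh = ln (norm (wronskian E0 E1 z))"
    define wf where "wf = ln (norm (wronskian f0 f1 z))"
    define wg where "wg = ln (norm (wronskian g0 g1 z))"
    define lf0 where "lf0 = ln (norm (f0 z))"
    define lg0 where "lg0 = ln (norm (g0 z))"
    define le1 where "le1 = ln (norm (E1 z))"
    define le0 where "le0 = ln (norm (E0 z))"
    define pAf where "pAf = ln (norm (pA f0 f1 z))"
    define pAg where "pAg = ln (norm (pA g0 g1 z))"
    define pBf where "pBf = ln (norm (pB f0 f1 z))"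
    define pBg where "pBg = ln (norm (pB g0 g1 z))"
    define uf where "uf = lnmax f0 f1 z"
    define ug where "ug = lnmax g0 g1 z"
    define lM where "lM = ln M"
    have lnum: "ln (norm (num f0 f1 g0 g1 z)) = 2 * wh + 2 * wf + 2 * wg + 2 * lf0 + 2 * lg0 + pBf + pBg"
      unfolding num_def E1_def[symmetric] E0_def[symmetric] wh_def wf_def wg_def lf0_def lg0_def pBf_def pBg_def
      using wz z pn by (simp add: norm_mult norm_power ln_mult ln_realpow)
    have lden: "ln (norm (den f0 f1 g0 g1 z)) = 2 * le1 + 2 * le0 + pAf + pAg"
      unfolding den_def E1_def[symmetric] E0_def[symmetric] le1_def le0_def pAf_def pAg_def
      using z pn by (simp add: norm_mult norm_power ln_mult ln_realpow)
    have lY: "ln (norm (num f0 f1 g0 g1 z)) = ln (norm (Y z)) + ln (norm (den f0 f1 g0 g1 z))"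
      unfolding Y(2) using Yz denz by (simp add: norm_mult ln_mult)
    have "deriv E1 z / E1 z - deriv E0 z / E0 z = wronskian E0 E1 z / (E1 z * E0 z)"
      using z by (simp add: wronskian_def diff_frac_eq mult_ac)
    then have "norm (wronskian E0 E1 z) / (norm (E1 z) * norm (E0 z)) \<le> M" using H by (simp add: norm_divide norm_mult)
    then have "ln (norm (wronskian E0 E1 z) / (norm (E1 z) * norm (E0 z))) \<le> lM"
      unfolding lM_def using wz z M by (intro ln_mono) auto
    then have lH: "wh - le1 - le0 \<le> lM" using wz z by (simp add: ln_div ln_mult wh_def le1_def le0_def)
    have sf: "(n + k - 1) * uf + wf \<le> lf0 + pAf + la + pBf + lM + C1"
      unfolding uf_def wf_def lf0_def pAf_def pBf_def lM_def by (rule smt'[OF cf M z(1) wz(2) lf])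
    have sg: "(n + k - 1) * ug + wg \<le> lg0 + pAg + la + pBg + lM + C1"
      unfolding ug_def wg_def lg0_def pAg_def pBg_def lM_def by (rule smt'[OF cg M z(2) wz(3) lg])
    have bf: "pAf \<le> n * uf + la + KA" "pBf \<le> k * uf + KB" "lf0 \<le> \<epsilon> * uf"
      unfolding pAf_def pBf_def lf0_def uf_def n_def la_def KA_def k_def KB_def
      using ln_pA_le(2)[OF df(3) pn(1)] ln_pB_le(2)[OF df(3) pn(2)] ef[OF z(1)] by auto
    have bg: "pAg \<le> n * ug + la + KA" "pBg \<le> k * ug + KB" "lg0 \<le> \<epsilon> * ug"
      unfolding pAg_def pBg_def lg0_def ug_def n_def la_def KA_def k_def KB_def
      using ln_pA_le(2)[OF dg(3) pn(3)] ln_pB_le(2)[OF dg(3) pn(4)] eg[OF z(2)] by auto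
    \<comment> \<open>Naming the products makes the final estimate linear in these
      quantities.\<close>
    define nkf where "nkf = (n + k - 1) * uf"
    define nkg where "nkg = (n + k - 1) * ug"
    define nf where "nf = n * uf"
    define ng where "ng = n * ug"
    define kf where "kf = k * uf"
    define kg where "kg = k * ug"
    define \<epsilon>f where "\<epsilon>f = \<epsilon> * uf"
    define \<epsilon>g where "\<epsilon>g = \<epsilon> * ug"
    note prods = nkf_def[symmetric] nkg_def[symmetric] nf_def[symmetric] ng_def[symmetric] kf_def[symmetric] kg_def[symmetric] \<epsilon>f_def[symmetric] \<epsilon>g_def[symmetric]
    have exp: "\<kappa> * (uf + ug) = 2 * nkf + 2 * nkg - nf - ng - 3 * kf - 3 * kg - 4 * \<epsilon>f - 4 * \<epsilon>g"
      unfolding nkf_def nkg_def nf_def ng_def kf_def kg_def \<epsilon>f_def \<epsilon>g_def by (simp add: \<kappa>_def algebra_simps)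
    \<comment> \<open>The six terms \<open>lM\<close> are two from the square of \<open>H\<close>
      and two from each of the two second main theorems.\<close>
    have "\<kappa> * (uf + ug) + ln (norm (Y z)) \<le> CY + 6 * lM"
      unfolding exp CY_def using lY lnum lden lH sf[unfolded prods] sg[unfolded prods] bf[unfolded prods] bg[unfolded prods] by linarith
    also have "\<dots> \<le> C + C * lM" using C M by (intro add_mono mult_right_mono) (auto simp: lM_def)
    finally show "\<kappa> * (lnmax f0 f1 z + lnmax g0 g1 z) + ln (norm (Y z)) \<le> C + C * ln M"
      by (simp add: uf_def ug_def lM_def)
  qed (use C in \<open>auto simp: n_def\<close>)
qed

section \<open>The case in which H vanishes identically\<close>

text \<open>A vanishing Wronskian means F' = k0 G' for F = 1 / P(f) and G = 1 / P(g). Integration is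
  again a Wronskian argument: X / Z = F - k0 G has zero derivative. The result is stated without
  denominators.\<close>

lemma fractional_linear_relation:
  assumes cf: "coprime_pair f0 f1" and cg: "coprime_pair g0 g1"
    and W: "\<And>w. wronskian (e1 g0 g1 f0 f1) (e1 f0 f1 g0 g1) w = 0"
  shows "\<exists>k0 k1. k0 \<noteq> 0 \<and> (\<forall>w. f0 w ^ card A * pA g0 g1 w - k0 * (g0 w ^ card A * pA f0 f1 w) = k1 * (pA f0 f1 w * pA g0 g1 w))"
proof -
  note df = coprime_pairD[OF cf] and dg = coprime_pairD[OF cg]
  note hol = df(1,2) dg(1,2)
  have hp: "entire (pA f0 f1)" "entire (pA g0 g1)" "entire (MF f0 f1)" "entire (MF g0 g1)"
    by (intro pA_holomorphic MF_holomorphic hol)+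
  have hE: "entire (e1 f0 f1 g0 g1)" "entire (e1 g0 g1 f0 f1)"
    unfolding e1_def[abs_def] by (intro holomorphic_intros hp)+
  have "\<exists>c. \<forall>e\<in>{pA f0 f1, pA g0 g1, MF f0 f1, MF g0 g1}. e c \<noteq> 0"
    by (rule entire_common_nonzero) (use hp nontrivial[OF cf] nontrivial[OF cg] in auto)
  then obtain c where c: "pA f0 f1 c \<noteq> 0" "pA g0 g1 c \<noteq> 0" "MF f0 f1 c \<noteq> 0" "MF g0 g1 c \<noteq> 0" by auto
  have Ec: "e1 f0 f1 g0 g1 c \<noteq> 0" "e1 g0 g1 f0 f1 c \<noteq> 0" using c by (auto simp: e1_def)
  obtain k0 where k0: "\<And>w. e1 f0 f1 g0 g1 w = k0 * e1 g0 g1 f0 f1 w"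
    using wronskian_eq_0_imp_proportional[OF hE(2) Ec(2) hE(1) W] by blast
  have k0n: "k0 \<noteq> 0" using k0[of c] Ec by auto
  define F where "F w = f0 w ^ card A" for w
  define G where "G w = g0 w ^ card A" for w
  define p where "p = pA f0 f1"
  define r where "r = pA g0 g1"
  have h: "entire F" "entire G" "entire p" "entire r"
    unfolding F_def G_def p_def r_def by (intro holomorphic_intros hol hp)+
  define X where "X w = F w * r w - k0 * (G w * p w)" for w
  define Z where "Z w = p w * r w" for w
  have hXZ: "entire X" "entire Z" unfolding X_def Z_def by (intro holomorphic_intros h)+
  have Wz: "wronskian Z X w = 0" for w
  proof -
    have dv: "(F has_field_derivative deriv F w) (at w)" "(G has_field_derivative deriv G w) (at w)"
       "(p has_field_derivative deriv p w) (at w)" "(r has_field_derivative deriv r w) (at w)"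
      using h by (auto intro!: holomorphic_derivI[of _ UNIV])
    have dX: "deriv X w = (deriv F w * r w + F w * deriv r w) - k0 * (deriv G w * p w + G w * deriv p w)"
      unfolding X_def by (rule DERIV_imp_deriv) (use dv in \<open>auto intro!: derivative_eq_intros\<close>)
    have dZ: "deriv Z w = deriv p w * r w + p w * deriv r w"
      unfolding Z_def by (rule DERIV_imp_deriv) (use dv in \<open>auto intro!: derivative_eq_intros\<close>)
    have "wronskian Z X w = wronskian p F w * r w ^ 2 - k0 * (wronskian r G w * p w ^ 2)"
      unfolding wronskian_def dX dZ unfolding X_def Z_def by (simp add: power2_eq_square algebra_simps)
    also have "\<dots> = 0" using k0[of w] by (simp add: e1_def MF_def p_def r_def F_def[abs_def] G_def[abs_def])
    finally show ?thesis .
  qed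
  have "Z c \<noteq> 0" using c by (simp add: Z_def p_def r_def)
  then obtain k1 where "\<forall>w. X w = k1 * Z w"
    using wronskian_eq_0_imp_proportional[OF hXZ(2) _ hXZ(1) Wz] by blast
  then show ?thesis using k0n unfolding X_def Z_def F_def G_def p_def r_def by blast
qed

end

lemma ordat_vanat_le:
  assumes "ordat u z m" "vanat u z n"
  shows "n \<le> m"
proof (rule ccontr)
  assume n: "\<not> n \<le> m"
  obtain \<phi> where \<phi>: "entire \<phi>" "\<phi> z \<noteq> 0" "\<And>w. u w = (w - z) ^ m * \<phi> w"
    using assms(1) unfolding ordat_def by blast
  obtain \<psi> where \<psi>: "entire \<psi>" "\<And>w. u w = (w - z) ^ n * \<psi> w"
    using assms(2) unfolding vanat_def by blast
  have "\<phi> z = (z - z) ^ (n - m) * \<psi> z"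
  proof (rule entire_eqI[where F = \<phi> and G = "\<lambda>w. (w - z) ^ (n - m) * \<psi> w" and E = "\<lambda>w. w - z" and ?w0.0 = "z + 1"])
    fix w assume w: "w - z \<noteq> 0"
    have "(w - z) ^ n = (w - z) ^ m * (w - z) ^ (n - m)" using n by (simp flip: power_add)
    then have "(w - z) ^ m * \<phi> w = (w - z) ^ m * ((w - z) ^ (n - m) * \<psi> w)" using \<phi>(3)[of w] \<psi>(2)[of w] by (simp only: mult.assoc[symmetric])
    then show "\<phi> w = (w - z) ^ (n - m) * \<psi> w" using w by simp
  qed (auto intro!: holomorphic_intros \<phi> \<psi>)
  then show False using n \<phi>(2) by simp
qed

lemma ordat_unique: "\<lbrakk>ordat u z m; ordat u z n\<rbrakk> \<Longrightarrow> m = n"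
  by (simp add: ordat_vanat_le ordat_imp_vanat antisym)

lemma prod_lform_power_nonzero_at:
  assumes "coprime_pair f0 f1" "finite S" "a \<in> S" "lform f0 f1 a z = 0"
  shows "(\<Prod>b\<in>S-{a}. lform f0 f1 b z ^ e b) \<noteq> 0"
  using assms(2) lform_two_zeros[OF assms(4) _ coprime_pairD(3)[OF assms(1)]] by auto

lemma ordat_prod_lform_power:
  assumes "coprime_pair f0 f1" "finite S" "a \<in> S" "lform f0 f1 a z = 0" "ordat (lform f0 f1 a) z m"
  shows "ordat (\<lambda>w. \<Prod>b\<in>S. lform f0 f1 b w ^ e b) z (e a * m)"
proof -
  note d = coprime_pairD[OF assms(1)]
  have "ordat (\<lambda>w. \<Prod>b\<in>S-{a}. lform f0 f1 b w ^ e b) z 0"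
    by (rule ordat_0) (auto intro!: holomorphic_intros d simp: prod_lform_power_nonzero_at[OF assms(1-4)] simp del: prod_zero_iff)
  from ordat_mult[OF ordat_power[OF assms(5), of "e a"] this] show ?thesis
    by (simp add: prod.remove[OF assms(2,3)])
qed

text \<open>Ramification at least n at every point over \<open>S\<close> makes the quotient of W^n
  by the product of the forms to the power n - 1 entire, since n (m - 1) \<ge> (n - 1) m for m \<ge>
  n. The second main theorem then allows total ramification at most 2, but (1 - 1/n) card S \<ge>
  9/4.\<close>

lemma three_ramified_values_contradiction:
  assumes cg: "coprime_pair g0 g1" and S: "finite S" "3 \<le> card S" and n: "4 \<le> n"
    and ram: "\<And>a z m. \<lbrakk>a \<in> S; lform g0 g1 a z = 0; ordat (lform g0 g1 a) z m\<rbrakk> \<Longrightarrow> n \<le> m"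
  shows False
proof -
  note d = coprime_pairD[OF cg]
  define num where "num w = wronskian g0 g1 w ^ n" for w
  define den where "den w = (\<Prod>a\<in>S. lform g0 g1 a w ^ (n - 1))" for w
  have Sne: "S \<noteq> {}" using S by auto
  have hol: "entire num" "entire den"
    unfolding num_def den_def by (intro holomorphic_intros d)+
  have "\<exists>c. \<forall>e\<in>{wronskian g0 g1, g0} \<union> lform g0 g1 ` S. e c \<noteq> 0"
    by (rule entire_common_nonzero) (use S d in \<open>auto intro!: holomorphic_intros\<close>)
  then obtain c where c: "wronskian g0 g1 c \<noteq> 0" "g0 c \<noteq> 0" "\<And>a. a \<in> S \<Longrightarrow> lform g0 g1 a c \<noteq> 0" by auto
  have nc: "num c \<noteq> 0" "den c \<noteq> 0" using c S by (auto simp: num_def den_def)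
  have loc: "\<exists>m. ordat den z m \<and> vanat num z m" for z
  proof (cases "\<exists>a\<in>S. lform g0 g1 a z = 0")
    case True
    then obtain a where a: "a \<in> S" "lform g0 g1 a z = 0" by blast
    obtain m where m: "ordat (lform g0 g1 a) z m"
      using ordat_exists[of "lform g0 g1 a"] d(5) by (metis lform_holomorphic d(1,2))
    have "n \<le> m" by (rule ram[OF a m])
    have "vanat num z (n * (m - 1))"
      unfolding num_def by (intro ordat_imp_vanat ordat_power ordat_wronskian_lform_zero(3)[OF cg a(2) m])
    moreover have "(n - 1) * m \<le> n * (m - 1)" using \<open>n \<le> m\<close> n by (cases n; cases m) auto
    ultimately have "vanat num z ((n - 1) * m)" by (rule vanat_le)
    moreover have "ordat den z ((n - 1) * m)" unfolding den_def by (rule ordat_prod_lform_power[OF cg S(1) a m])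
    ultimately show ?thesis by blast
  next
    case False
    then have "den z \<noteq> 0" using S by (auto simp: den_def)
    then show ?thesis using hol ordat_0 vanat_0 by blast
  qed
  obtain Y where Y: "entire Y" "\<And>w. num w = Y w * den w"
    using entire_quotient[OF hol nc(2) loc] by blast
  obtain C1 where C1: "0 \<le> C1" and smt: "\<And>x y (W::complex) (M::real). \<lbrakk>0 < M; x \<noteq> 0; W \<noteq> 0; \<And>a. a \<in> S \<Longrightarrow> y - a * x \<noteq> 0 \<and> norm W \<le> M * norm ((y - a * x) * x)\<rbrakk> \<Longrightarrow>
     (real (card S) - 1) * ln (max (norm x) (norm y)) + ln (norm W) \<le>
       ln (norm x) + (\<Sum>a\<in>S. ln (norm (y - a * x))) + ln M + C1"
    using second_main_theorem_pointwise[OF S(1) Sne] by metis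
  define K where "K = (\<Sum>a\<in>S. norm a)"
  define N where "N = real (card S)"
  define r where "r = real n"
  define C where "C = K + r * C1 + r"
  have K0: "0 \<le> K" by (simp add: K_def sum_nonneg)
  have r: "4 \<le> r" "3 \<le> N" using n S by (auto simp: r_def N_def)
  have C: "0 \<le> C" "K + r * C1 \<le> C" "r \<le> C" using K0 C1 r by (auto simp: C_def)
  \<comment> \<open>Halved because \<open>nevanlinna_contradiction\<close> is applied with the same
    pair in both places, with \<open>e1\<close> and \<open>e0\<close> the constant 1.\<close>
  define \<kappa> where "\<kappa> = (r * (N - 2) - N) / 2"
  have "4 * (N - 2) \<le> r * (N - 2)" using r by (intro mult_right_mono) auto
  then have \<kappa>: "0 < \<kappa>" using r unfolding \<kappa>_def by simp
  obtain z1 z2 where z12: "g0 z1 * g1 z2 \<noteq> g1 z1 * g0 z2" using cg unfolding coprime_pair_def by blast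
  have Yc: "Y c \<noteq> 0" using Y(2)[of c] nc by auto
  have one: "entire (\<lambda>_. 1 :: complex)" "(1::complex) \<noteq> 0" by auto
  show False
  proof (rule nevanlinna_contradiction[OF d(1,2) d(1,2) one(1) one(1) Y(1) d(3) d(3) S(1) Sne z12 c(2) c(2) one(2) one(2) Yc d(5) d(5) \<kappa>, where d = 0 and C = C])
    fix z M
    assume M: "1 \<le> M" and z: "g0 z \<noteq> 0"
      and l: "\<And>a. a \<in> S \<Longrightarrow> lform g0 g1 a z \<noteq> 0 \<and> norm (wronskian g0 g1 z) \<le> M * norm (lform g0 g1 a z * g0 z)"
    show "ln (norm (1::complex)) \<le> 0 * (lnmax g0 g1 z + lnmax g0 g1 z) + C + C * ln M \<and>
       ln (norm (1::complex)) \<le> 0 * (lnmax g0 g1 z + lnmax g0 g1 z) + C + C * ln M"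
      using C(1) M by simp
    assume Yz: "Y z \<noteq> 0"
    have denz: "den z \<noteq> 0" using l S by (auto simp: den_def)
    then have "num z \<noteq> 0" using Y(2)[of z] Yz by simp
    then have wz: "wronskian g0 g1 z \<noteq> 0" using n by (auto simp: num_def)
    define L where "L = (\<Sum>a\<in>S. ln (norm (lform g0 g1 a z)))"
    define W where "W = ln (norm (wronskian g0 g1 z))"
    define u where "u = lnmax g0 g1 z"
    have "(real (card S) - 1) * ln (max (norm (g0 z)) (norm (g1 z))) + ln (norm (wronskian g0 g1 z)) \<le>
       ln (norm (g0 z)) + (\<Sum>a\<in>S. ln (norm (g1 z - a * g0 z))) + ln M + C1"
      by (rule smt) (use M z wz l in \<open>auto simp: lform_def\<close>)
    then have "(N - 1) * u + W \<le> ln (norm (g0 z)) + L + ln M + C1"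
      by (simp only: N_def u_def lnmax_def W_def L_def lform_def)
    moreover have "ln (norm (g0 z)) \<le> u" unfolding u_def by (rule ln_norm_le_lnmax[of g0 z g1, OF z])
    ultimately have "(N - 1) * u + W \<le> u + L + ln M + C1" by linarith
    then have 1: "r * ((N - 1) * u + W) \<le> r * (u + L + ln M + C1)" using r by (intro mult_left_mono) auto
    have "L \<le> (\<Sum>a\<in>S. u + norm a)"
      unfolding L_def u_def by (intro sum_mono ln_norm_lform_le d(3)) (use l in auto)
    then have 2: "L \<le> N * u + K" by (simp add: sum.distrib N_def K_def)
    have ln_num: "ln (norm (num z)) = r * W"
      using wz by (simp add: num_def W_def r_def norm_power ln_realpow)
    have "ln (norm (den z)) = (\<Sum>a\<in>S. real (n - 1) * ln (norm (lform g0 g1 a z)))"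
      using l S by (simp add: den_def prod_norm[symmetric] norm_power ln_prod ln_realpow)
    also have "\<dots> = (r - 1) * L" using n by (simp add: L_def r_def sum_distrib_left of_nat_diff)
    finally have ln_den: "ln (norm (den z)) = (r - 1) * L" .
    have lY: "r * W = ln (norm (Y z)) + (r - 1) * L"
      unfolding ln_num[symmetric] ln_den[symmetric] Y(2) using Yz denz by (simp add: norm_mult ln_mult)
    have e: "\<kappa> * (u + u) = r * (N - 1) * u - r * u - N * u" by (simp add: \<kappa>_def field_simps)
    define p1 where "p1 = r * (N - 1) * u"
    define p2 where "p2 = r * u"
    define p3 where "p3 = r * L"
    define p4 where "p4 = r * ln M"
    define p5 where "p5 = r * C1"
    define p6 where "p6 = r * W"
    define p7 where "p7 = N * u"
    have i1: "p1 + p6 \<le> p2 + p3 + p4 + p5"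
      using 1 unfolding p1_def p2_def p3_def p4_def p5_def p6_def by (simp only: distrib_left mult.assoc)
    have i2: "L \<le> p7 + K" using 2 by (simp add: p7_def)
    have lY': "p6 = ln (norm (Y z)) + p3 - L" using lY unfolding p6_def p3_def by (simp add: left_diff_distrib)
    have "p1 - p2 - p7 + ln (norm (Y z)) \<le> K + p5 + p4" using i1 i2 lY' by linarith
    also have "\<dots> \<le> C + C * ln M"
      unfolding p5_def p4_def using C M by (intro add_mono mult_right_mono) auto
    finally show "\<kappa> * (lnmax g0 g1 z + lnmax g0 g1 z) + ln (norm (Y z)) \<le> C + C * ln M"
      unfolding u_def[symmetric] e p1_def p2_def p7_def .
  qed (use C in auto)
qed

context split_poly
begin

lemma order_pderiv_P: "order b (pderiv P) = (if b \<in> B then q b else 0)"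
proof (cases "b \<in> B")
  case True
  have e: "pderiv P = [:- b, 1:] ^ q b * smult b0 (\<Prod>x\<in>B-{b}. [:- x, 1:] ^ q x)"
    unfolding P'_eq prod.remove[OF finB True] by simp
  have nz: "poly (smult b0 (\<Prod>x\<in>B-{b}. [:- x, 1:] ^ q x)) b \<noteq> 0" using b0 finB by (auto simp: poly_prod)
  have p0: "pderiv P \<noteq> 0" unfolding P'_eq using b0 finB by auto
  have "order b (pderiv P) = order b ([:- b, 1:] ^ q b) + order b (smult b0 (\<Prod>x\<in>B-{b}. [:- x, 1:] ^ q x))"
    unfolding e by (rule order_mult) (use p0 e in simp)
  then show ?thesis using True order_0I[OF nz] by (simp add: order_power_n_n)
next
  case False
  then show ?thesis using pderiv_root_iff[of b] by (simp add: order_0I)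
qed

text \<open>A multiple root is a critical point with value -\<mu>, so by \<open>crit\<close> there
  is at most one, say b. The number of remaining, simple roots is card A - 1 - q b, the sum of the
  other \<open>q\<close>, hence at least card B - 1 \<ge> 2.\<close>

lemma shifted_roots:
  fixes \<mu> :: complex
  assumes crit: "\<And>b b'. \<lbrakk>b \<in> B; b' \<in> B; b \<noteq> b'\<rbrakk> \<Longrightarrow> poly P b \<noteq> poly P b'"
  defines "P2 \<equiv> P + [:\<mu>:]"
  shows "finite {x. poly P2 x = 0}" "(\<Sum>x | poly P2 x = 0. order x P2) = card A"
    "\<And>x. poly P2 x = 0 \<Longrightarrow> order x P2 = Suc (if x \<in> B then q x else 0)"
    "3 \<le> card {x. poly P2 x = 0}"
proof -
  have pd: "pderiv P2 = pderiv P" by (simp add: P2_def pderiv_add pderiv_pCons)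
  have degP2: "degree P2 = card A"
    unfolding P2_def using card_A by (subst degree_add_eq_left) (auto simp: degree_P)
  then have P20: "P2 \<noteq> 0" using card_A by auto
  then show fin: "finite {x. poly P2 x = 0}" by (rule poly_roots_finite)
  have pd0: "pderiv P2 \<noteq> 0" unfolding pd P'_eq using b0 finB by auto
  show ord: "order x P2 = Suc (if x \<in> B then q x else 0)" if "poly P2 x = 0" for x
  proof -
    show ?thesis using order_pderiv[OF P20 that] by (simp add: pd order_pderiv_P)
  qed
  have "degree P2 = degree (smult (lead_coeff P2) (\<Prod>z|poly P2 z = 0. [:-z, 1:] ^ order z P2))"
    by (simp only: complex_poly_decompose)
  also have "\<dots> = (\<Sum>x | poly P2 x = 0. order x P2)"
    using P20 fin by (simp add: degree_prod_sum_eq degree_power_eq)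
  finally show sum: "(\<Sum>x | poly P2 x = 0. order x P2) = card A" using degP2 by simp
  let ?G = "{x. poly P2 x = 0}"
  have val: "poly P b = - \<mu>" if "b \<in> ?G" for b using that by (simp add: P2_def eq_neg_iff_add_eq_0)
  show "3 \<le> card ?G"
  proof (cases "?G \<inter> B = {}")
    case True
    have "(\<Sum>x\<in>?G. order x P2) = (\<Sum>x\<in>?G. 1)" using ord True by (intro sum.cong) auto
    then show ?thesis using sum card_A by simp
  next
    case False
    then obtain b where b: "b \<in> ?G" "b \<in> B" by blast
    have "x \<notin> B" if "x \<in> ?G - {b}" for x using crit[of x b] val[of x] val[of b] b that by auto
    then have "(\<Sum>x\<in>?G-{b}. order x P2) = (\<Sum>x\<in>?G-{b}. 1)" using ord by (intro sum.cong) auto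
    moreover have "(\<Sum>x\<in>?G. order x P2) = order b P2 + (\<Sum>x\<in>?G-{b}. order x P2)" by (rule sum.remove[OF fin b(1)])
    moreover have "order b P2 = Suc (q b)" using ord b by auto
    ultimately have 1: "card A = Suc (q b) + card (?G - {b})" using sum by simp
    have "(\<Sum>x\<in>B-{b}. 1) \<le> (\<Sum>x\<in>B-{b}. q x)" using q_pos by (intro sum_mono) (simp add: Suc_leI)
    then have "card (B - {b}) \<le> (\<Sum>x\<in>B-{b}. q x)" by simp
    moreover have "(\<Sum>x\<in>B. q x) = q b + (\<Sum>x\<in>B-{b}. q x)" by (rule sum.remove[OF finB b(2)])
    moreover have "card (B - {b}) = card B - 1" using b(2) finB by simp
    ultimately have "card B - 1 + q b \<le> card A - 1" using sum_q by simp
    then have "2 \<le> card (?G - {b})" using 1 cardB by simp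
    moreover have "card (?G - {b}) = card ?G - 1" using b(1) fin by simp
    ultimately show ?thesis by simp
  qed
qed

lemma fractional_linear_contradiction:
  assumes cf: "coprime_pair f0 f1" and cg: "coprime_pair g0 g1"
    and sh2: "\<And>z. pB f0 f1 z = 0 \<longleftrightarrow> pB g0 g1 z = 0"
    and crit: "\<And>b b'. \<lbrakk>b \<in> B; b' \<in> B; b \<noteq> b'\<rbrakk> \<Longrightarrow> poly P b \<noteq> poly P b'"
    and rel: "\<And>w. f0 w ^ card A * pA g0 g1 w - k0 * (g0 w ^ card A * pA f0 f1 w) = k1 * (pA f0 f1 w * pA g0 g1 w)"
    and k: "k0 \<noteq> 0" "k1 \<noteq> 0"
  shows False
proof -
  note df = coprime_pairD[OF cf] and dg = coprime_pairD[OF cg]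
  define \<mu> where "\<mu> = k0 / k1"
  have \<mu>: "\<mu> \<noteq> 0" using k by (simp add: \<mu>_def)
  define P2 where "P2 = P + [:\<mu>:]"
  define G where "G = {x. poly P2 x = 0}"
  have sr: "finite G" "(\<Sum>x\<in>G. order x P2) = card A" "3 \<le> card G"
    unfolding G_def P2_def by (rule shifted_roots[OF crit]; assumption)+
  have ord: "order x P2 = Suc (if x \<in> B then q x else 0)" if "x \<in> G" for x
    using that unfolding G_def P2_def mem_Collect_eq by (intro shifted_roots(3)[OF crit]) auto
  have P20: "P2 \<noteq> 0" using sr(1) by (auto simp: G_def infinite_UNIV_char_0)
  define p2 where "p2 w = pA g0 g1 w + \<mu> * g0 w ^ card A" for w
  have hp: "entire (pA f0 f1)" "entire (pA g0 g1)"
    by (intro pA_holomorphic df dg)+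
  have rel2: "f0 w ^ card A * pA g0 g1 w = k1 * (pA f0 f1 w * p2 w)" for w
    using rel[of w] k by (simp add: p2_def \<mu>_def field_simps)
  obtain w0 where w0: "g0 w0 \<noteq> 0" using dg(4) by blast
  have p2_eq: "p2 w = lead_coeff P2 * (\<Prod>x\<in>G. lform g0 g1 x w ^ order x P2)" for w
  proof (rule entire_eqI[where F = p2 and E = g0 and ?w0.0 = w0])
    fix w assume w: "g0 w \<noteq> 0"
    have "p2 w = poly P2 (g1 w / g0 w) * g0 w ^ card A"
      by (simp add: p2_def P2_def pA_eq[of g0 w g1, OF w] distrib_right)
    also have "poly P2 (g1 w / g0 w) = poly (smult (lead_coeff P2) (\<Prod>x\<in>G. [:-x, 1:] ^ order x P2)) (g1 w / g0 w)"
      unfolding G_def by (simp only: complex_poly_decompose)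
    also have "\<dots> * g0 w ^ card A = lead_coeff P2 * ((\<Prod>x\<in>G. (g1 w / g0 w - x) ^ order x P2) * (\<Prod>x\<in>G. g0 w ^ order x P2))"
      using power_sum[of "g0 w" "\<lambda>x. order x P2" G] sr(2) by (simp add: poly_prod)
    also have "(\<Prod>x\<in>G. (g1 w / g0 w - x) ^ order x P2) * (\<Prod>x\<in>G. g0 w ^ order x P2) = (\<Prod>x\<in>G. lform g0 g1 x w ^ order x P2)"
      unfolding prod.distrib[symmetric] power_mult_distrib[symmetric]
      using w by (intro prod.cong refl) (simp add: lform_def left_diff_distrib)
    finally show "p2 w = lead_coeff P2 * (\<Prod>x\<in>G. lform g0 g1 x w ^ order x P2)" .
  qed (use dg w0 hp in \<open>auto intro!: holomorphic_intros simp: p2_def[abs_def]\<close>)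
  show False
  proof (rule three_ramified_values_contradiction[OF cg sr(1) sr(3) card_A(2)])
    fix x z m assume x: "x \<in> G" "lform g0 g1 x z = 0" "ordat (lform g0 g1 x) z m"
    have g0: "g0 z \<noteq> 0" using lform_two_zeros[OF x(2,2) dg(3)] by simp
    have "g1 z / g0 z = x" using x(2) g0 by (simp add: lform_def field_simps)
    moreover have "poly P x = - \<mu>" using x(1) by (simp add: G_def P2_def eq_neg_iff_add_eq_0)
    ultimately have pAg: "pA g0 g1 z \<noteq> 0" using \<mu> g0 pA_eq[of g0 z g1, OF g0] by simp
    have ox: "order x P2 = Suc (if x \<in> B then q x else 0)" by (rule ord[OF x(1)])
    have o: "ordat p2 z (order x P2 * m)"
    proof -
      have "p2 = (\<lambda>w. lead_coeff P2 * (\<Prod>x\<in>G. lform g0 g1 x w ^ order x P2))" using p2_eq by (rule ext)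
      then show ?thesis using ordat_cmult[OF ordat_prod_lform_power[OF cg sr(1) x], of "lead_coeff P2"] P20 by simp
    qed
    have m1: "1 \<le> m" using ordat_zero_iff[OF x(3)] x(2) by simp
    then have "p2 z = 0" using ordat_zero_iff[OF o] ox by simp
    \<comment> \<open>At such a point P(g) = -\<mu> is finite and non-zero, so the relation makes
      P(f) infinite there.\<close>
    then have f0: "f0 z = 0" using rel2[of z] pAg by simp
    note pn = pole_nonzero[OF cf f0]
    have xB: "x \<notin> B"
    proof
      assume "x \<in> B"
      then have "pB g0 g1 z = 0" using x(2) finB by (auto simp: pB_def)
      then show False using sh2[of z] pn by simp
    qed
    obtain w1 where "f0 w1 \<noteq> 0" using df(4) by blast
    then obtain m0 where m0: "ordat f0 z m0" using ordat_exists[OF df(1)] by blast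
    have m01: "1 \<le> m0" using ordat_zero_iff[OF m0] f0 by simp
    have "vanat (\<lambda>w. f0 w ^ card A * pA g0 g1 w) z (card A * m0 + 0)"
      by (intro ordat_imp_vanat ordat_mult ordat_power m0 ordat_0 hp pAg)
    moreover have "(\<lambda>w. f0 w ^ card A * pA g0 g1 w) = (\<lambda>w. k1 * (pA f0 f1 w * p2 w))" using rel2 by (rule ext)
    moreover have "ordat (\<lambda>w. k1 * (pA f0 f1 w * p2 w)) z (0 + order x P2 * m)"
      by (intro ordat_cmult ordat_mult ordat_0 hp pn o k)
    \<comment> \<open>Outside \<open>B\<close> the root \<open>x\<close> of \<open>P2\<close> is
      simple, so the right-hand side of the relation has order exactly \<open>m\<close>, whereas the
      left-hand side contains the full power of \<open>f0\<close>.\<close>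
    ultimately have "card A * m0 \<le> m" using ordat_vanat_le ox xB by fastforce
    moreover have "card A * 1 \<le> card A * m0" using m01 by (intro mult_left_mono) auto
    ultimately show "card A \<le> m" by linarith
  qed
qed

end

section \<open>Meromorphic functions sharing sets\<close>

text \<open>The equation may be demanded at every point: at a pole division by zero gives 0, which
  is the dummy value of the normalised representative.\<close>

definition represents :: "(complex \<Rightarrow> complex) \<Rightarrow> (complex \<Rightarrow> complex) \<Rightarrow> (complex \<Rightarrow> complex) \<Rightarrow> bool" where
  "represents f0 f1 f \<longleftrightarrow> coprime_pair f0 f1 \<and> (\<forall>z. is_pole f z \<longleftrightarrow> f0 z = 0) \<and> (\<forall>z. f z = f1 z / f0 z)"

lemma coprime_pair_if_nonconstant:
  assumes "entire f0" "entire f1" "\<And>z. f0 z \<noteq> 0 \<or> f1 z \<noteq> 0"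
    and f: "\<And>z. f z = f1 z / f0 z" and nc: "nonconstant_fun f"
  shows "coprime_pair f0 f1"
proof -
  have "\<exists>z1 z2. f0 z1 * f1 z2 \<noteq> f1 z1 * f0 z2"
  proof (rule ccontr)
    assume "\<not> ?thesis"
    then have e: "f0 z1 * f1 z2 = f1 z1 * f0 z2" for z1 z2 by blast
    have "f z = f w" for z w
    proof (cases "f0 z = 0")
      case True
      \<comment> \<open>Proportional coordinates with one zero of f0 make f0 vanish everywhere, and
        then all values of f are 0 by division by zero.\<close>
      then have "f0 w = 0" using e[of z w] assms(3)[of z] by auto
      then show ?thesis using True f by simp
    next
      case False
      then have "f0 w \<noteq> 0" using e[of z w] assms(3)[of w] by auto
      then show ?thesis using False f e[of z w] by (simp add: field_simps)
    qed
    then have "f constant_on UNIV" unfolding constant_on_def by blast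
    then show False using nc by (simp add: nonconstant_fun_def)
  qed
  then show ?thesis using assms(1-3) by (simp add: coprime_pair_def)
qed

lemma meromorphic_representation:
  assumes "meromorphic_fun f" "nonconstant_fun f"
  shows "\<exists>f0 f1. represents f0 f1 f"
proof -
  have "f nicely_meromorphic_on UNIV" using assms(1) by (simp add: meromorphic_fun_def)
  then obtain h f1 f2 where h: "entire h" "entire f1" "entire f2"
    and z1: "\<forall>z. f1 z = 0 \<longleftrightarrow> \<not> is_pole f z \<and> f z = 0" and z2: "\<forall>z. f2 z = 0 \<longleftrightarrow> is_pole f z"
    and hz: "\<forall>z. h z \<noteq> 0" and eq: "\<forall>z. f z = h z * f1 z / f2 z"
    by (rule weierstrass_factorization_meromorphic_UNIV)
  have "coprime_pair f2 (\<lambda>z. h z * f1 z)"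
  proof (rule coprime_pair_if_nonconstant[where f = f])
    show "f2 z \<noteq> 0 \<or> h z * f1 z \<noteq> 0" for z using z1 z2 hz by auto
  qed (use h eq assms(2) in \<open>auto intro!: holomorphic_intros\<close>)
  then show ?thesis unfolding represents_def using z2 eq by blast
qed

lemma not_pole_entire: "entire f \<Longrightarrow> \<not> is_pole f z"
  by (simp add: analytic_at_imp_no_pole holomorphic_on_imp_analytic_at)

lemma entire_representation:
  assumes "entire_fun f" "nonconstant_fun f"
  shows "represents (\<lambda>_. 1) f f"
proof -
  have h: "entire f" using assms(1) by (simp add: entire_fun_def)
  have "coprime_pair (\<lambda>_. 1) f"
    by (rule coprime_pair_if_nonconstant[where f = f]) (use h assms(2) in auto)
  then show ?thesis using not_pole_entire[OF h] by (simp add: represents_def)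
qed

lemma points_of_iff:
  assumes "represents f0 f1 f"
  shows "z \<in> points_of a f \<longleftrightarrow> lform f0 f1 a z = 0"
proof -
  have d: "coprime_pair f0 f1" "is_pole f z \<longleftrightarrow> f0 z = 0" "f z = f1 z / f0 z"
    using assms by (auto simp: represents_def)
  show ?thesis
  proof (cases "f0 z = 0")
    case True
    then show ?thesis using d coprime_pairD(3)[OF d(1), of z] by (simp add: points_of_def lform_def)
  next
    case False
    then show ?thesis using d by (simp add: points_of_def lform_def divide_eq_eq)
  qed
qed

lemma zorder_eq_ordat:
  assumes r: "represents f0 f1 f" and a: "lform f0 f1 a z = 0" and m: "ordat (lform f0 f1 a) z m"
  shows "zorder (\<lambda>w. f w - a) z = int m"
proof -
  have cp: "coprime_pair f0 f1" and feq: "\<And>z. f z = f1 z / f0 z" using r by (auto simp: represents_def)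
  note d = coprime_pairD[OF cp]
  obtain \<phi> where \<phi>: "entire \<phi>" "\<phi> z \<noteq> 0" "\<And>w. lform f0 f1 a w = (w - z) ^ m * \<phi> w"
    using m unfolding ordat_def by blast
  have f0: "f0 z \<noteq> 0" using lform_two_zeros[OF a a d(3)] by simp
  show ?thesis
  proof (rule zorder_eqI)
    show "open {w. f0 w \<noteq> 0}"
      using holomorphic_on_imp_continuous_on[OF d(1)] by (intro open_Collect_neq continuous_intros)
    show "(\<lambda>w. \<phi> w / f0 w) holomorphic_on {w. f0 w \<noteq> 0}"
      by (intro holomorphic_intros holomorphic_on_subset[OF \<phi>(1)] holomorphic_on_subset[OF d(1)]) auto
    fix w assume w: "w \<in> {w. f0 w \<noteq> 0}" "w \<noteq> z"
    have "f w - a = lform f0 f1 a w / f0 w" using w by (simp add: feq lform_def field_simps)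
    then show "f w - a = \<phi> w / f0 w * (w - z) powi int m" by (simp add: \<phi>(3))
  qed (use f0 \<phi> in auto)
qed

text \<open>The count prescribed by weight two: every order above 2 is recorded as 2 + 1.\<close>

definition truncated_order :: "nat \<Rightarrow> enat" where
  "truncated_order m = (if m \<le> 2 then enat m else 3)"

lemma truncated_order_eqD: "truncated_order m = truncated_order n \<Longrightarrow> m = n \<or> 3 \<le> m \<and> 3 \<le> n"
  by (auto simp: truncated_order_def numeral_eq_enat split: if_splits)

lemma E_pt_eq:
  assumes r: "represents f0 f1 f" and m: "ordat (lform f0 f1 a) z m"
  shows "E_pt 2 a f z = truncated_order m"
proof (cases "lform f0 f1 a z = 0")
  case True
  then show ?thesis
    using zorder_eq_ordat[OF r True m]
    by (auto simp: E_pt_def points_of_iff[OF r] truncated_order_def Let_def numeral_eq_enat plus_1_eSuc eSuc_enat)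
next
  case False
  then have "m = 0" using ordat_zero_iff[OF m] by simp
  then show ?thesis using False by (simp add: E_pt_def points_of_iff[OF r] truncated_order_def zero_enat_def)
qed

context split_poly
begin

text \<open>At most one form vanishes at \<open>z\<close>, so the supremum has at most one non-zero
  term, and the order of this form is that of the whole product.\<close>

lemma E_set_eq:
  assumes r: "represents f0 f1 f" and m: "ordat (pA f0 f1) z m"
  shows "E_set f A 2 z = truncated_order m"
proof -
  have cp: "coprime_pair f0 f1" using r by (simp add: represents_def)
  note d = coprime_pairD[OF cp]
  have ex: "\<exists>m. ordat (lform f0 f1 a) z m" for a
    using ordat_exists[of "lform f0 f1 a"] d(5) by (metis lform_holomorphic d(1,2))
  have zero: "E_pt 2 a f z = 0" if "lform f0 f1 a z \<noteq> 0" for a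
    using that by (simp add: E_pt_def points_of_iff[OF r])
  show ?thesis
  proof (cases "pA f0 f1 z = 0")
    case True
    then obtain a where a: "a \<in> A" "lform f0 f1 a z = 0" using finA a0 by (auto simp: pA_def)
    obtain k where k: "ordat (lform f0 f1 a) z k" using ex by blast
    have "ordat (pA f0 f1) z k"
      unfolding pA_def using ordat_cmult[OF ordat_prod_lform[OF cp finA a k] a0] .
    then have "k = m" using m ordat_unique by blast
    then have e: "E_pt 2 a f z = truncated_order m" using E_pt_eq[OF r k] by simp
    have "E_pt 2 b f z \<le> truncated_order m" if "b \<in> A" for b
    proof (cases "lform f0 f1 b z = 0")
      case True
      then have "b = a" using lform_two_zeros[OF a(2) True d(3)] by simp
      then show ?thesis using e by simp
    qed (simp add: zero)
    then show ?thesis unfolding E_set_def using a(1) e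
      by (intro antisym SUP_least) (auto intro: SUP_upper2)
  next
    case False
    then have "m = 0" using ordat_zero_iff[OF m] by simp
    moreover have "E_pt 2 a f z = 0" if "a \<in> A" for a
      using that False finA by (intro zero) (auto simp: pA_def)
    then have "(SUP a\<in>A. E_pt 2 a f z) = (SUP a\<in>A. 0)" by (intro SUP_cong) auto
    ultimately show ?thesis using A_ne by (simp add: E_set_def truncated_order_def zero_enat_def)
  qed
qed

lemma E_bar_iff:
  assumes r: "represents f0 f1 f"
  shows "z \<in> E_bar f B \<longleftrightarrow> pB f0 f1 z = 0"
proof -
  have "z \<in> E_bar f B \<longleftrightarrow> (\<exists>b\<in>B. z \<in> points_of b f)" by (auto simp: E_bar_def points_of_def)
  then show ?thesis using finB by (simp add: points_of_iff[OF r] pB_def)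
qed

lemma sharing_imp_equal:
  assumes rf: "represents f0 f1 f" and rg: "represents g0 g1 g"
    and mf: "meromorphic_fun f" "nonconstant_fun f" and mg: "meromorphic_fun g" "nonconstant_fun g"
    and sA: "share_weight f g A 2" and sB: "share_IM f g B"
    and uniq: "uniqueness_polynomial P"
    and crit: "\<And>b b'. \<lbrakk>b \<in> B; b' \<in> B; b \<noteq> b'\<rbrakk> \<Longrightarrow> poly P b \<noteq> poly P b'"
    and ef: "\<And>z. f0 z \<noteq> 0 \<Longrightarrow> ln (norm (f0 z)) \<le> \<epsilon> * lnmax f0 f1 z"
    and eg: "\<And>z. g0 z \<noteq> 0 \<Longrightarrow> ln (norm (g0 z)) \<le> \<epsilon> * lnmax g0 g1 z"
    and size: "real (card B) + 2 + 4 * \<epsilon> < card A"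
  shows "f = g"
proof -
  have cf: "coprime_pair f0 f1" and cg: "coprime_pair g0 g1" using rf rg by (auto simp: represents_def)
  have sh1: "m = m' \<or> 3 \<le> m \<and> 3 \<le> m'" if "ordat (pA f0 f1) z m" "ordat (pA g0 g1) z m'" for z m m'
  proof -
    have "truncated_order m = truncated_order m'"
      using E_set_eq[OF rf that(1)] E_set_eq[OF rg that(2)] sA by (simp add: share_weight_def)
    then show ?thesis by (rule truncated_order_eqD)
  qed
  have sh2: "pB f0 f1 z = 0 \<longleftrightarrow> pB g0 g1 z = 0" for z
    using E_bar_iff[OF rf, of z] E_bar_iff[OF rg, of z] sB by (simp add: share_IM_def)
  have W: "wronskian (e1 g0 g1 f0 f1) (e1 f0 f1 g0 g1) w = 0" for w
    by (rule wronskian_e1_vanishes[OF cf cg sh1 sh2 ef eg size])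
  obtain k0 k1 where k0: "k0 \<noteq> 0"
    and rel: "\<And>w. f0 w ^ card A * pA g0 g1 w - k0 * (g0 w ^ card A * pA f0 f1 w) = k1 * (pA f0 f1 w * pA g0 g1 w)"
    using fractional_linear_relation[OF cf cg W] by blast
  have k1: "k1 = 0"
    using fractional_linear_contradiction[OF cf cg sh2 crit rel k0] by blast
  \<comment> \<open>With k1 = 0 the relation reads P(g) = k0 P(f) off the poles, which form a
    negligible set for the cosparse quantifier.\<close>
  have "\<forall>\<^sub>\<approx>z. \<not> is_pole f z" "\<forall>\<^sub>\<approx>z. \<not> is_pole g z"
    using mf mg by (auto simp: meromorphic_fun_def nicely_meromorphic_on_def intro!: meromorphic_on_imp_not_pole_cosparse)
  then have "\<forall>\<^sub>\<approx>z. poly P (f z) = inverse k0 * poly P (g z)"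
  proof eventually_elim
    case (elim z)
    have n: "f0 z \<noteq> 0" "g0 z \<noteq> 0" and v: "f z = f1 z / f0 z" "g z = g1 z / g0 z"
      using elim rf rg by (auto simp: represents_def)
    have "f0 z ^ card A * (poly P (g z) * g0 z ^ card A) = k0 * (g0 z ^ card A * (poly P (f z) * f0 z ^ card A))"
      using rel[of z] k1 pA_eq[of f0 z f1, OF n(1)] pA_eq[of g0 z g1, OF n(2)] by (simp add: v)
    then show ?case using n k0 by (simp add: field_simps)
  qed
  moreover have "inverse k0 \<noteq> 0" using k0 by simp
  ultimately show ?thesis using uniq mf mg unfolding uniqueness_polynomial_def by blast
qed

end

theorem theorem4p2:
  fixes P :: "complex poly" and a0 b0 :: complex
    and \<alpha> \<beta> :: "nat \<Rightarrow> complex" and q :: "nat \<Rightarrow> nat" and n k :: nat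
  assumes P_eq: "P = smult a0 (\<Prod>i=1..n. [:- \<alpha> i, 1:])"
    and a0: "a0 \<noteq> 0"
    and \<alpha>_distinct: "inj_on \<alpha> {1..n}"
    and P'_eq: "pderiv P = smult b0 (\<Prod>s=1..k. [:- \<beta> s, 1:] ^ q s)"
    and b0: "b0 \<noteq> 0"
    and \<beta>_distinct: "inj_on \<beta> {1..k}"
    and q_pos: "\<And>s. s \<in> {1..k} \<Longrightarrow> q s > 0"
    and uniq: "uniqueness_polynomial P"
    and crit: "\<And>s t. 1 \<le> s \<Longrightarrow> s < t \<Longrightarrow> t \<le> k \<Longrightarrow> poly P (\<beta> s) \<noteq> poly P (\<beta> t)"
    and k3: "k \<ge> 3"
  shows "(n \<ge> k + 7 \<longrightarrow>
            (\<forall>f g. meromorphic_fun f \<and> nonconstant_fun f \<and> meromorphic_fun g \<and> nonconstant_fun g \<and>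
               share_weight f g (\<alpha> ` {1..n}) 2 \<and> share_IM f g (\<beta> ` {1..k}) \<longrightarrow> f = g)) \<and>
         (n \<ge> k + 3 \<longrightarrow>
            (\<forall>f g. entire_fun f \<and> nonconstant_fun f \<and> entire_fun g \<and> nonconstant_fun g \<and>
               share_weight f g (\<alpha> ` {1..n}) 2 \<and> share_IM f g (\<beta> ` {1..k}) \<longrightarrow> f = g))"
proof -
  let ?A = "\<alpha> ` {1..n}" and ?B = "\<beta> ` {1..k}"
  \<comment> \<open>Multiplicities are transported from the indices to the zeros themselves.\<close>
  define q' where "q' = q \<circ> inv_into {1..k} \<beta>"
  have q': "q' (\<beta> s) = q s" if "s \<in> {1..k}" for s using that \<beta>_distinct by (simp add: q'_def)
  have cA: "card ?A = n" and cB: "card ?B = k"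
    using card_image[OF \<alpha>_distinct] card_image[OF \<beta>_distinct] by simp_all
  interpret split_poly ?A ?B q' a0 b0 P
  proof
    show "P = smult a0 (\<Prod>a\<in>?A. [:- a, 1:])" by (simp only: P_eq prod.reindex[OF \<alpha>_distinct] o_def)
    have "(\<Prod>s=1..k. [:- \<beta> s, 1:] ^ q s) = (\<Prod>s=1..k. [:- \<beta> s, 1:] ^ q' (\<beta> s))"
      using q' by (intro prod.cong) auto
    then show "pderiv P = smult b0 (\<Prod>b\<in>?B. [:- b, 1:] ^ q' b)"
      by (simp only: P'_eq prod.reindex[OF \<beta>_distinct] o_def)
    show "0 < q' b" if "b \<in> ?B" for b using that q_pos q' by auto
    show "3 \<le> card ?B" using cB k3 by simp
  qed (use a0 b0 in auto)
  have cr: "poly P b \<noteq> poly P b'" if b: "b \<in> ?B" "b' \<in> ?B" "b \<noteq> b'" for b b'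
  proof -
    obtain s t where st: "s \<in> {1..k}" "t \<in> {1..k}" "b = \<beta> s" "b' = \<beta> t" using b by blast
    then have "s \<noteq> t" using b(3) by auto
    then consider "s < t" | "t < s" by linarith
    then show ?thesis using crit[of s t] crit[of t s] st by cases auto
  qed
  have "f = g" if n: "n \<ge> k + 7" and m: "meromorphic_fun f" "nonconstant_fun f" "meromorphic_fun g" "nonconstant_fun g"
    and s: "share_weight f g ?A 2" "share_IM f g ?B" for f g
  proof -
    obtain f0 f1 where rf: "represents f0 f1 f" using meromorphic_representation[OF m(1,2)] by blast
    obtain g0 g1 where rg: "represents g0 g1 g" using meromorphic_representation[OF m(3,4)] by blast
    \<comment> \<open>For arbitrary pairs ln |f0| \<le> \<open>lnmax\<close>, so
      \<open>\<epsilon> = 1\<close> and the size condition reads k + 6 < n.\<close>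
    show ?thesis
      by (rule sharing_imp_equal[OF rf rg m s uniq cr, of 1]) (use n cA cB in \<open>auto intro: ln_norm_le_lnmax\<close>)
  qed
  moreover have "f = g" if n: "n \<ge> k + 3" and m: "entire_fun f" "nonconstant_fun f" "entire_fun g" "nonconstant_fun g"
    and s: "share_weight f g ?A 2" "share_IM f g ?B" for f g
  proof -
    have mer: "meromorphic_fun h" if "entire_fun h" for h
      using that by (simp add: entire_fun_def meromorphic_fun_def analytic_on_imp_nicely_meromorphic_on analytic_on_open)
    \<comment> \<open>An entire function is represented with denominator 1, whose logarithm is 0.
      Thus \<open>\<epsilon> = 0\<close> is allowed and the size condition reads k + 2 < n.\<close>
    show ?thesis
      by (rule sharing_imp_equal[OF entire_representation[OF m(1,2)] entire_representation[OF m(3,4)]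
            mer[OF m(1)] m(2) mer[OF m(3)] m(4) s uniq cr, of 0]) (use n cA cB in auto)
  qed
  ultimately show ?thesis by blast
qed

end
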